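(* Let $\Omega=\mathbb R\times[0,H]$, and let $u\in C^1(\Omega)$ be a percolating flow with tubes $D_j^\pm=\{\rho\in[c_j-h_j,c_j+h_j]\}$ as described in the context. Let $f\in C^1[0,1]$, $f\not\equiv0$, satisfy $f(0)=f(1)=0$, $f\ge0$ on $(0,1)$. Let $T(x,y,t)$ solve $$T_t+u\cdot\nabla T=\kappa\Delta T+\frac{v_0^2}{\kappa}f(T)\ \text{ in }\Omega,\qquad T(x,y,0)=T_0(x,y),$$ with $T\to1$ as $x\to-\infty$, $T\to0$ as $x\to+\infty$, and either Neumann or periodic boundary conditions in $y$, where $T_0$ satisfies $\kappa\Delta T_0+\frac{v_0^2}{\kappa}f(T_0)-u\cdot\nabla T_0\ge0$ and, for some $\lambda>0$, $T_0=1-O(e^{\lambda x})$ for $x<0$, $T_0=O(e^{-\lambda x})$ for $x>0$, $|\nabla T_0|=O(e^{-\lambda|x|})$. Then for all $t>0$ $$V(t)\ge C\left(v_0+\sum_{D_j^\pm}\left(1+\frac{l}{h_j}\right)^{-1}\int_{c_j-h_j}^{c_j+h_j}|u(\rho,\xi)|E_1(\rho,\xi)\frac{d\rho}{H}\right),\qquad l=\frac\kappa{v_0},$$ where the sum is over all tubes (with $c_j,h_j$ those of the corresponding tube) and the constant $C>0$ depends only on the function $f$ and on the constant $K$ in the bounds on the streamline coordinates in the context. (The integrand is independent of $\xi$.)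
   Context: $\kappa,v_0,H>0$ are constants. Neumann conditions: $T_y=0$ at $y=0,H$; periodic conditions: $T(x,y+H,t)=T(x,y,t)$. The temperature satisfies $0\le T\le1$. The differential inequality on $T_0$ guarantees $T_t\ge0$. Bulk burning rate: $V(t)=\int_\Omega T_t\frac{dx\,dy}{H}$. Percolating flow: $u=(u_1,u_2)\in C^1(\Omega)$ is time independent, $\nabla\cdot u=0$, $\int_0^Hu_1(x,y)\,dy=0$, and $u$ is periodic in space. There are finitely many regions (tubes) $D_j^+$ and $D_j^-$, $j=1,\dots,N$, each bounded by streamlines of $u$, such that the projection onto the $x$-axis of each streamline contained in $D_j^\pm$ covers the whole real line (the projection need not be one-to-one). Inside each tube there is a one-to-one $C^2$ change of coordinates $(x,y)\to(\rho,\xi)$, with $\rho$ constant on streamlines and $\xi$ an orthogonal coordinate to $\rho$, $\rho\in[c_j-h_j,c_j+h_j]$ and $\xi\in(-\infty,\infty)$ ($c_j,h_j$ depending on the tube), with $u\cdot\nabla\xi>0$ in $D_j^+$ and $u\cdot\nabla\xi<0$ in $D_j^-$. Write $dx^2+dy^2=E_1^2(\rho,\xi)\,d\rho^2+E_2^2(\rho,\xi)\,d\xi^2$ and $\omega=E_2/E_1$. It is assumed that for some constant $K>0$, on all tubes, $$K^{-1}\le E_{1},E_2,\qquad K^{-1}\le|\omega|\le K,\qquad\left|\frac{\partial\omega}{\partial\xi}\right|,\left|\frac{\partial\omega}{\partial\rho}\right|\le\frac K{h_j},$$ and that on each tube $$\tfrac12\|E_1u\|_{\infty,j}\le E_1(\rho,\xi)|u(\rho,\xi)|\le\|E_1u\|_{\infty,j},\qquad\|E_1u\|_{\infty,j}=\sup_{D_j^\pm}E_1|u|.$$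 The quantity $E_1(\rho,\xi)|u(\rho,\xi)|$ does not depend on $\xi$ by incompressibility. No assumption is made on the streamlines outside the tubes.
   Formalization: In the Neumann case the flow is additionally assumed tangent to the walls (u_2 = 0 at y = 0, H); without this the bound fails, as stationary fronts with V = 0 can exist. The tubes are taken to be non-overlapping (modulo the period), as is implicit in summing over them. *)

theory Defs
  imports "HOL-Analysis.Analysis"
begin

definition C1_on :: "'a::real_normed_vector set \<Rightarrow> ('a \<Rightarrow> 'b::real_normed_vector) \<Rightarrow> bool" where
  "C1_on S g \<longleftrightarrow> (\<exists>g'. (\<forall>p\<in>S. (g has_derivative blinfun_apply (g' p)) (at p within S)) \<and>
     continuous_on S g')"

definition C2_on :: "'a::real_normed_vector set \<Rightarrow> ('a \<Rightarrow> 'b::real_normed_vector) \<Rightarrow> bool" where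
  "C2_on S g \<longleftrightarrow> (\<exists>g'. (\<forall>p\<in>S. (g has_derivative blinfun_apply (g' p)) (at p within S)) \<and>
     C1_on S g')"

text \<open>Derivatives are taken within \<open>S\<close>, hence are one-sided on the boundary of a closed domain.\<close>

definition d1 :: "(real \<times> real) set \<Rightarrow> (real \<times> real \<Rightarrow> real) \<Rightarrow> real \<times> real \<Rightarrow> real" where
  "d1 S g p = frechet_derivative g (at p within S) (1, 0)"

definition d2 :: "(real \<times> real) set \<Rightarrow> (real \<times> real \<Rightarrow> real) \<Rightarrow> real \<times> real \<Rightarrow> real" where
  "d2 S g p = frechet_derivative g (at p within S) (0, 1)"

definition grad :: "(real \<times> real) set \<Rightarrow> (real \<times> real \<Rightarrow> real) \<Rightarrow> real \<times> real \<Rightarrow> real \<times> real" where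
  "grad S g p = (d1 S g p, d2 S g p)"

definition laplacian :: "(real \<times> real) set \<Rightarrow> (real \<times> real \<Rightarrow> real) \<Rightarrow> real \<times> real \<Rightarrow> real" where
  "laplacian S g p = d1 S (d1 S g) p + d2 S (d2 S g) p"

definition divergence ::
  "(real \<times> real) set \<Rightarrow> (real \<times> real \<Rightarrow> real \<times> real) \<Rightarrow> real \<times> real \<Rightarrow> real" where
  "divergence S w p = d1 S (\<lambda>q. fst (w q)) p + d2 S (\<lambda>q. snd (w q)) p"

datatype bdry_cond = Neumann | Periodic

definition strip :: "real \<Rightarrow> (real \<times> real) set" where
  "strip H = UNIV \<times> {0..H}"

text \<open>With periodic conditions all functions live on the plane and are \<open>H\<close>-periodic in \<open>y\<close>;
  the strip is then one period cell.\<close>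

fun domain :: "bdry_cond \<Rightarrow> real \<Rightarrow> (real \<times> real) set" where
  "domain Neumann H = strip H"
| "domain Periodic H = UNIV"

fun scalar_bc :: "bdry_cond \<Rightarrow> real \<Rightarrow> (real \<times> real \<Rightarrow> real) \<Rightarrow> bool" where
  "scalar_bc Neumann H g \<longleftrightarrow> (\<forall>x. d2 (strip H) g (x, 0) = 0 \<and> d2 (strip H) g (x, H) = 0)"
| "scalar_bc Periodic H g \<longleftrightarrow> (\<forall>x y. g (x, y + H) = g (x, y))"

text \<open>Neumann conditions describe insulated solid walls, so there the flow does not cross
  \<open>y = 0\<close> and \<open>y = H\<close>.\<close>

fun flow_bc :: "bdry_cond \<Rightarrow> real \<Rightarrow> (real \<times> real \<Rightarrow> real \<times> real) \<Rightarrow> bool" where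
  "flow_bc Neumann H u \<longleftrightarrow> (\<forall>x. snd (u (x, 0)) = 0 \<and> snd (u (x, H)) = 0)"
| "flow_bc Periodic H u \<longleftrightarrow> (\<forall>x y. u (x, y + H) = u (x, y))"

definition streamline ::
  "(real \<times> real) set \<Rightarrow> (real \<times> real \<Rightarrow> real \<times> real) \<Rightarrow> (real \<times> real) set \<Rightarrow> bool" where
  "streamline S u \<Gamma> \<longleftrightarrow> (\<exists>\<gamma>. (\<forall>s::real. \<gamma> s \<in> S \<and> (\<gamma> has_vector_derivative u (\<gamma> s)) (at s)) \<and>
     \<Gamma> = range \<gamma>)"

datatype flow_dir = Plus | Minus

text \<open>\<open>coords\<close> is the map \<open>(x, y) \<mapsto> (\<rho>, \<xi>)\<close>, whereas \<open>E1\<close> and \<open>E2\<close> are functions of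
  \<open>(\<rho>, \<xi>)\<close>.\<close>

record tube =
  region :: "(real \<times> real) set"
  centre :: real
  hwidth :: real
  coords :: "real \<times> real \<Rightarrow> real \<times> real"
  E1 :: "real \<times> real \<Rightarrow> real"
  E2 :: "real \<times> real \<Rightarrow> real"

definition rho_range :: "tube \<Rightarrow> real set" where
  "rho_range D = {centre D - hwidth D..centre D + hwidth D}"

definition coord_range :: "tube \<Rightarrow> (real \<times> real) set" where
  "coord_range D = rho_range D \<times> UNIV"

definition param :: "tube \<Rightarrow> real \<times> real \<Rightarrow> real \<times> real" where
  "param D = inv_into (region D) (coords D)"

definition open_tube :: "tube \<Rightarrow> (real \<times> real) set" where
  "open_tube D = {p \<in> region D. fst (coords D p) \<in> {centre D - hwidth D<..<centre D + hwidth D}}"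

definition omega :: "tube \<Rightarrow> real \<times> real \<Rightarrow> real" where
  "omega D q = E2 D q / E1 D q"

definition weighted_speed :: "(real \<times> real \<Rightarrow> real \<times> real) \<Rightarrow> tube \<Rightarrow> real \<times> real \<Rightarrow> real" where
  "weighted_speed u D q = norm (u (param D q)) * E1 D q"

text \<open>The level sets \<open>\<rho> = const\<close> fill the tube and are streamlines; in particular
  \<open>\<rho> = c - h\<close> and \<open>\<rho> = c + h\<close> are the streamlines bounding it.\<close>

definition stream_coords ::
  "(real \<times> real) set \<Rightarrow> (real \<times> real \<Rightarrow> real \<times> real) \<Rightarrow> tube \<Rightarrow> bool" where
  "stream_coords S u D \<longleftrightarrow>
     hwidth D > 0 \<and> region D \<subseteq> S \<and>
     bij_betw (coords D) (region D) (coord_range D) \<and>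
     C2_on (region D) (coords D) \<and> C2_on (coord_range D) (param D) \<and>
     (\<forall>r\<in>rho_range D. streamline S u {p \<in> region D. fst (coords D p) = r}) \<and>
     (\<forall>\<Gamma>. streamline S u \<Gamma> \<and> \<Gamma> \<subseteq> region D \<longrightarrow> fst ` \<Gamma> = UNIV)"

fun tube_dir :: "flow_dir \<Rightarrow> (real \<times> real \<Rightarrow> real \<times> real) \<Rightarrow> tube \<Rightarrow> bool" where
  "tube_dir Plus u D \<longleftrightarrow>
     (\<forall>p\<in>region D. u p \<bullet> grad (region D) (\<lambda>q. snd (coords D q)) p > 0)"
| "tube_dir Minus u D \<longleftrightarrow>
     (\<forall>p\<in>region D. u p \<bullet> grad (region D) (\<lambda>q. snd (coords D q)) p < 0)"

text \<open>The first clause says \<open>dx\<^sup>2 + dy\<^sup>2 = E1\<^sup>2 d\<rho>\<^sup>2 + E2\<^sup>2 d\<xi>\<^sup>2\<close>; the absence of a cross term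
  is the orthogonality of \<open>\<rho>\<close> and \<open>\<xi>\<close>.\<close>

definition metric_bounds :: "real \<Rightarrow> tube \<Rightarrow> bool" where
  "metric_bounds K D \<longleftrightarrow> (\<forall>q\<in>coord_range D.
     (\<forall>v. (norm (frechet_derivative (param D) (at q within coord_range D) v))\<^sup>2 =
          (E1 D q)\<^sup>2 * (fst v)\<^sup>2 + (E2 D q)\<^sup>2 * (snd v)\<^sup>2) \<and>
     1 / K \<le> E1 D q \<and> 1 / K \<le> E2 D q \<and>
     1 / K \<le> \<bar>omega D q\<bar> \<and> \<bar>omega D q\<bar> \<le> K \<and>
     \<bar>d1 (coord_range D) (omega D) q\<bar> \<le> K / hwidth D \<and>
     \<bar>d2 (coord_range D) (omega D) q\<bar> \<le> K / hwidth D)"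

definition speed_bounds :: "(real \<times> real \<Rightarrow> real \<times> real) \<Rightarrow> tube \<Rightarrow> bool" where
  "speed_bounds u D \<longleftrightarrow> (\<forall>q\<in>coord_range D.
     (1/2) * (SUP q'\<in>coord_range D. weighted_speed u D q') \<le> weighted_speed u D q \<and>
     weighted_speed u D q \<le> (SUP q'\<in>coord_range D. weighted_speed u D q'))"

definition tube_index :: "nat \<Rightarrow> (nat \<times> flow_dir) set" where
  "tube_index N = {1..N} \<times> {Plus, Minus}"

fun lattice_shifts :: "bdry_cond \<Rightarrow> int set" where
  "lattice_shifts Neumann = {0}"
| "lattice_shifts Periodic = UNIV"

text \<open>Different tubes overlap at most along bounding streamlines.  In the periodic case a tube is
  represented by a lift to the plane, which must also be disjoint from the lifts of all tubes
  (itself included) shifted by nonzero multiples of the period.\<close>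

definition disjoint_tubes ::
  "bdry_cond \<Rightarrow> real \<Rightarrow> nat \<Rightarrow> (nat \<times> flow_dir \<Rightarrow> tube) \<Rightarrow> bool" where
  "disjoint_tubes bc H N D \<longleftrightarrow>
     (\<forall>i\<in>tube_index N. \<forall>j\<in>tube_index N. \<forall>k\<in>lattice_shifts bc. i \<noteq> j \<or> k \<noteq> 0 \<longrightarrow>
        open_tube (D i) \<inter> (\<lambda>(x, y). (x, y + of_int k * H)) ` open_tube (D j) = {})"

definition percolating_flow ::
  "bdry_cond \<Rightarrow> real \<Rightarrow> real \<Rightarrow> (real \<times> real \<Rightarrow> real \<times> real) \<Rightarrow> nat \<Rightarrow>
   (nat \<times> flow_dir \<Rightarrow> tube) \<Rightarrow> bool" where
  "percolating_flow bc H K u N D \<longleftrightarrow>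
     C1_on (domain bc H) u \<and>
     (\<forall>p\<in>domain bc H. divergence (domain bc H) u p = 0) \<and>
     (\<forall>x. integral {0..H} (\<lambda>y. fst (u (x, y))) = 0) \<and>
     (\<exists>L>0. \<forall>x y. (x, y) \<in> domain bc H \<longrightarrow> u (x + L, y) = u (x, y)) \<and>
     flow_bc bc H u \<and>
     disjoint_tubes bc H N D \<and>
     (\<forall>(j, s)\<in>tube_index N.
        stream_coords (domain bc H) u (D (j, s)) \<and> tube_dir s u (D (j, s)) \<and>
        metric_bounds K (D (j, s)) \<and> speed_bounds u (D (j, s)))"

definition reaction_term :: "(real \<Rightarrow> real) \<Rightarrow> bool" where
  "reaction_term f \<longleftrightarrow> C1_on {0..1} f \<and> f 0 = 0 \<and> f 1 = 0 \<and>
     (\<forall>s\<in>{0<..<1}. f s \<ge> 0) \<and> (\<exists>s\<in>{0..1}. f s \<noteq> 0)"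

definition initial_temperature ::
  "bdry_cond \<Rightarrow> real \<Rightarrow> real \<Rightarrow> real \<Rightarrow> (real \<Rightarrow> real) \<Rightarrow> (real \<times> real \<Rightarrow> real \<times> real) \<Rightarrow>
   (real \<times> real \<Rightarrow> real) \<Rightarrow> bool" where
  "initial_temperature bc H \<kappa> v0 f u T0 \<longleftrightarrow>
     C2_on (domain bc H) T0 \<and>
     (\<forall>p\<in>domain bc H. \<kappa> * laplacian (domain bc H) T0 p + v0\<^sup>2 / \<kappa> * f (T0 p)
          - u p \<bullet> grad (domain bc H) T0 p \<ge> 0) \<and>
     (\<exists>a>0. \<exists>M. \<forall>(x, y)\<in>strip H.
        (x < 0 \<longrightarrow> \<bar>1 - T0 (x, y)\<bar> \<le> M * exp (a * x)) \<and>
        (x > 0 \<longrightarrow> \<bar>T0 (x, y)\<bar> \<le> M * exp (- a * x)) \<and>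
        norm (grad (domain bc H) T0 (x, y)) \<le> M * exp (- a * \<bar>x\<bar>))"

text \<open>Classical solutions.  The argument order is \<open>T t (x, y)\<close>.\<close>

definition temperature ::
  "bdry_cond \<Rightarrow> real \<Rightarrow> real \<Rightarrow> real \<Rightarrow> (real \<Rightarrow> real) \<Rightarrow> (real \<times> real \<Rightarrow> real \<times> real) \<Rightarrow>
   (real \<times> real \<Rightarrow> real) \<Rightarrow> (real \<Rightarrow> real \<times> real \<Rightarrow> real) \<Rightarrow> bool" where
  "temperature bc H \<kappa> v0 f u T0 T \<longleftrightarrow>
     continuous_on ({0..} \<times> domain bc H) (\<lambda>(t, p). T t p) \<and>
     (\<forall>p\<in>domain bc H. T 0 p = T0 p) \<and>
     (\<forall>t\<ge>0. \<forall>p\<in>domain bc H. 0 \<le> T t p \<and> T t p \<le> 1) \<and>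
     (\<forall>t\<ge>0. scalar_bc bc H (T t)) \<and>
     (\<forall>t\<ge>0. \<forall>y\<in>{0..H}. ((\<lambda>x. T t (x, y)) \<longlongrightarrow> 1) at_bot \<and> ((\<lambda>x. T t (x, y)) \<longlongrightarrow> 0) at_top) \<and>
     (\<forall>t>0. C2_on (domain bc H) (T t)) \<and>
     (\<forall>t>0. \<forall>p\<in>domain bc H. (\<lambda>s. T s p) differentiable (at t) \<and>
        deriv (\<lambda>s. T s p) t + u p \<bullet> grad (domain bc H) (T t) p =
          \<kappa> * laplacian (domain bc H) (T t) p + v0\<^sup>2 / \<kappa> * f (T t p))"

definition bulk_burning_rate :: "real \<Rightarrow> (real \<Rightarrow> real \<times> real \<Rightarrow> real) \<Rightarrow> real \<Rightarrow> real" where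
  "bulk_burning_rate H T t = (LINT p:strip H|lborel. deriv (\<lambda>s. T s p) t / H)"

end

theory Submission
  imports Defs
begin

text \<open>By the maximum principle \<open>T\<close> is nondecreasing in time and, at each time, tends to its limits at
  \<open>x = \<plusminus>\<infinity>\<close> exponentially. Fix \<open>t\<close>, write \<open>\<theta> = T t\<close>, \<open>\<tau> = T\<^sub>t \<ge> 0\<close>, \<open>F = (v0\<^sup>2 / \<kappa>) f(\<theta>)\<close> and
  \<open>Q = \<integral>\<tau> = H V(t)\<close>. Multiplying the equation by \<open>1\<close> and by \<open>\<theta>\<close> bounds \<open>\<integral>F\<close> and \<open>\<kappa> \<integral>|\<nabla>\<theta>|\<^sup>2\<close> by
  multiples of \<open>Q\<close>. Let \<open>g\<close> be a bump function supported where \<open>f > 0\<close>, with \<open>g\<^sup>2 \<le> c f\<close>, and \<open>G\<close> its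
  primitive, increasing from 0 to 1. Then \<open>v0 g(\<theta>) |\<nabla>\<theta>| \<le> (c F + \<kappa> |\<nabla>\<theta>|\<^sup>2) / 2\<close>, and integrating
  \<open>\<partial>\<^sub>x G(\<theta>)\<close> gives \<open>v0 \<le> C V\<close>.

  In a tube one tests the equation with \<open>\<phi>(\<rho>) g(\<theta>)\<close>, where \<open>\<phi>\<close> is a cutoff across the tube. The
  transport term is an exact \<open>\<xi>\<close>-derivative, because \<open>E1 |u|\<close> does not depend on \<open>\<xi>\<close>, and integrates to
  \<open>\<plusminus>\<integral>\<phi> E1 |u| d\<rho>\<close>; all other terms are controlled by the integral of \<open>\<tau> + F + \<kappa> |\<nabla>\<theta>|\<^sup>2\<close> over the
  tube, the only unbounded factor being \<open>\<kappa> |\<nabla>\<phi>| / v0 \<le> C l / h\<close>. Since the tubes are disjoint, these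
  integrals sum up to a multiple of \<open>Q\<close>.\<close>

section \<open>Differentiation and integration in the plane\<close>

text \<open>A classical solution comes with no decay of its derivatives. Neither the finiteness of
  \<open>Q\<close> nor any integration by parts over the unbounded strip is free, so identities are
  first proved with a cutoff in \<open>x\<close> at scale \<open>R\<close>, up to an error
  \<open>err / R\<close>. Counting sizes makes the errors small except for transport, where the
  nonzero limit at the left end has to be removed by the zero mean of \<open>u1\<close>. Along a
  tube no cutoff in \<xi> is used: \<open>g\<close> vanishes near 0 and 1, so \<open>g\<close> of
  the temperature lives over a bounded range of \<open>x\<close>. The obstacle is that a tube may
  wander, and boundedness in \<open>x\<close> must be turned into boundedness in \<xi>. This is a
  packing argument resting on \<open>E1, E2 \<ge> 1 / K\<close>, which make the coordinates
  Lipschitz. The diffusion term is integrated by parts only once, so a single derivative falls on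
  the cutoff across the tube. It meets the product of \<open>g\<close> and the gradient, the very
  quantity that Young's inequality controls once a factor \<open>v0\<close> is split off; hence l /
  h and nothing worse.\<close>

lemma C1_on_bounded_linear:
  assumes L: "bounded_linear L" and g: "C1_on S g"
  shows "C1_on S (\<lambda>p. L (g p))"
proof -
  from g obtain g' where g': "\<And>p. p \<in> S \<Longrightarrow> (g has_derivative blinfun_apply (g' p)) (at p within S)"
    and c: "continuous_on S g'" unfolding C1_on_def by blast
  have "continuous_on S (\<lambda>p. Blinfun L o\<^sub>L g' p)"
    by (intro continuous_intros c)
  moreover have "((\<lambda>p. L (g p)) has_derivative blinfun_apply (Blinfun L o\<^sub>L g' p)) (at p within S)"
    if "p \<in> S" for p
  proof -
    have "blinfun_apply (Blinfun L o\<^sub>L g' p) = (\<lambda>x. L (g' p x))"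
      by (rule ext) (simp add: bounded_linear_Blinfun_apply[OF L])
    then show ?thesis using bounded_linear.has_derivative[OF L g'[OF that]] by simp
  qed
  ultimately show ?thesis unfolding C1_on_def by (intro exI[of _ "\<lambda>p. Blinfun L o\<^sub>L g' p"]) simp
qed

lemma C1_on_cong:
  assumes "\<And>p. p \<in> S \<Longrightarrow> f p = g p" "C1_on S f"
  shows "C1_on S g"
proof -
  from assms(2) obtain g' where g': "\<And>p. p \<in> S \<Longrightarrow> (f has_derivative blinfun_apply (g' p)) (at p within S)"
    and c: "continuous_on S g'" unfolding C1_on_def by blast
  then show ?thesis unfolding C1_on_def
    by (intro exI[of _ g'] conjI ballI) (auto intro: has_derivative_transform[where f=f] simp: assms(1))
qed

lemma C1_on_imp_continuous_on:
  assumes "C1_on S g" shows "continuous_on S g"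
  using assms unfolding C1_on_def
  by (metis continuous_on_eq_continuous_within has_derivative_continuous)

lemma C2_on_imp_C1_on:
  assumes "C2_on S g" shows "C1_on S g"
  using assms unfolding C2_on_def C1_on_def[of S g]
  using C1_on_imp_continuous_on by blast

text \<open>\<open>frechet_derivative\<close> picks some derivative; this condition makes
  derivatives within \<open>S\<close> unique, so that \<open>d1\<close> and \<open>d2\<close> mean
  the expected thing also at boundary points.\<close>

definition two_dim_at_points :: "(real \<times> real) set \<Rightarrow> bool" where
  "two_dim_at_points S \<longleftrightarrow>
     (\<forall>p\<in>S. \<forall>i\<in>Basis. \<forall>e>0. \<exists>d. 0 < \<bar>d\<bar> \<and> \<bar>d\<bar> < e \<and> p + d *\<^sub>R i \<in> S)"

lemma partials_has_derivative:
  assumes "g differentiable (at p within S)"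
  shows "(g has_derivative (\<lambda>v. fst v * d1 S g p + snd v * d2 S g p)) (at p within S)"
proof -
  have h: "(g has_derivative frechet_derivative g (at p within S)) (at p within S)"
    using assms frechet_derivative_works by blast
  interpret bounded_linear "frechet_derivative g (at p within S)"
    using h has_derivative_bounded_linear by blast
  have "frechet_derivative g (at p within S) v = fst v * d1 S g p + snd v * d2 S g p" for v
  proof -
    have "v = fst v *\<^sub>R (1,0) + snd v *\<^sub>R (0,1)" by (simp add: prod_eq_iff)
    then have "frechet_derivative g (at p within S) v
        = frechet_derivative g (at p within S) (fst v *\<^sub>R (1,0) + snd v *\<^sub>R (0,1))" by simp
    then show ?thesis unfolding add scaleR d1_def d2_def by simp
  qed
  then show ?thesis using h by presburger
qed

lemma C1_onD:
  assumes S: "two_dim_at_points S" and g: "C1_on S g"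
  shows C1_on_has_derivative: "p \<in> S \<Longrightarrow>
      (g has_derivative (\<lambda>v. fst v * d1 S g p + snd v * d2 S g p)) (at p within S)"
    and C1_on_continuous_d1: "continuous_on S (d1 S g)"
    and C1_on_continuous_d2: "continuous_on S (d2 S g)"
proof -
  from g obtain g' where g': "\<And>p. p \<in> S \<Longrightarrow> (g has_derivative blinfun_apply (g' p)) (at p within S)"
    and c: "continuous_on S g'" unfolding C1_on_def by blast
  have eq: "frechet_derivative g (at p within S) = blinfun_apply (g' p)" if "p \<in> S" for p
    by (rule frechet_derivative_unique_within[OF frechet_derivative_works[THEN iffD1, OF differentiableI[OF g'[OF that]]] g'[OF that]])
       (use S that in \<open>auto simp: two_dim_at_points_def\<close>)
  have "continuous_on S (\<lambda>p. g' p v)" for v by (intro continuous_intros c)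
  then show "continuous_on S (d1 S g)" "continuous_on S (d2 S g)"
    unfolding d1_def d2_def by (auto simp: eq cong: continuous_on_cong)
  show "(g has_derivative (\<lambda>v. fst v * d1 S g p + snd v * d2 S g p)) (at p within S)" if "p \<in> S"
    using partials_has_derivative differentiableI[OF g'[OF that]] by blast
qed

lemma C2_on_partials_C1_on:
  assumes S: "two_dim_at_points S" and g: "C2_on S g"
  shows "C1_on S (d1 S g)" "C1_on S (d2 S g)"
proof -
  from g obtain g' where g': "\<And>p. p \<in> S \<Longrightarrow> (g has_derivative blinfun_apply (g' p)) (at p within S)"
    and c: "C1_on S g'" unfolding C2_on_def by blast
  have eq: "frechet_derivative g (at p within S) = blinfun_apply (g' p)" if "p \<in> S" for p
    by (rule frechet_derivative_unique_within[OF frechet_derivative_works[THEN iffD1, OF differentiableI[OF g'[OF that]]] g'[OF that]])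
       (use S that in \<open>auto simp: two_dim_at_points_def\<close>)
  have "C1_on S (\<lambda>p. g' p v)" for v
    by (intro C1_on_bounded_linear[OF _ c] bounded_linear_intros)
  note C = this[of "(1,0)"] this[of "(0,1)"]
  show "C1_on S (d1 S g)" by (rule C1_on_cong[OF _ C(1)]) (simp add: d1_def eq)
  show "C1_on S (d2 S g)" by (rule C1_on_cong[OF _ C(2)]) (simp add: d2_def eq)
qed

lemma has_derivative_slices:
  fixes g :: "real \<times> real \<Rightarrow> real"
  assumes g: "(g has_derivative (\<lambda>v. fst v * a + snd v * b)) (at (x, y) within X \<times> Y)"
    and xy: "x \<in> X" "y \<in> Y"
  shows "((\<lambda>x. g (x, y)) has_real_derivative a) (at x within X)"
    and "((\<lambda>y. g (x, y)) has_real_derivative b) (at y within Y)"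
proof -
  have "((\<lambda>x. (x, y)) has_derivative (\<lambda>h. (h, 0))) (at x within X)"
    by (rule has_derivative_Pair[OF has_derivative_ident has_derivative_const])
  then have "((\<lambda>x. g (x, y)) has_derivative (\<lambda>h. fst (h, 0::real) * a + snd (h, 0::real) * b)) (at x within X)"
    by (rule has_derivative_in_compose[where g=g])
       (rule has_derivative_subset[OF g], use xy in auto)
  then show "((\<lambda>x. g (x, y)) has_real_derivative a) (at x within X)"
    by (simp add: has_field_derivative_def mult_commute_abs)
  have "((\<lambda>y. (x, y)) has_derivative (\<lambda>h. (0, h))) (at y within Y)"
    by (rule has_derivative_Pair[OF has_derivative_const has_derivative_ident])
  then have "((\<lambda>y. g (x, y)) has_derivative (\<lambda>h. fst (0::real, h) * a + snd (0::real, h) * b)) (at y within Y)"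
    by (rule has_derivative_in_compose[where g=g])
       (rule has_derivative_subset[OF g], use xy in auto)
  then show "((\<lambda>y. g (x, y)) has_real_derivative b) (at y within Y)"
    by (simp add: has_field_derivative_def mult_commute_abs)
qed

text \<open>Fubini and the fundamental theorem of calculus, one component at a time. Each component
  is differentiated only in its own variable and within the closed interval, so one-sided
  derivatives at the walls qualify. With one component zero it becomes an integrated one-dimensional
  statement, and it is often used so.\<close>

lemma integral_divergence_box:
  fixes X1 X2 D1 D2 :: "real \<times> real \<Rightarrow> real"
  assumes ab: "a \<le> b" "c \<le> d"
    and X1: "\<And>x y. x \<in> {a..b} \<Longrightarrow> y \<in> {c..d} \<Longrightarrow> ((\<lambda>x. X1 (x, y)) has_real_derivative D1 (x, y)) (at x within {a..b})"
    and X2: "\<And>x y. x \<in> {a..b} \<Longrightarrow> y \<in> {c..d} \<Longrightarrow> ((\<lambda>y. X2 (x, y)) has_real_derivative D2 (x, y)) (at y within {c..d})"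
    and D1: "continuous_on (cbox (a, c) (b, d)) D1"
    and D2: "continuous_on (cbox (a, c) (b, d)) D2"
  shows "integral (cbox (a, c) (b, d)) (\<lambda>p. D1 p + D2 p) =
    integral {c..d} (\<lambda>y. X1 (b, y) - X1 (a, y)) + integral {a..b} (\<lambda>x. X2 (x, d) - X2 (x, c))"
proof -
  have "integral (cbox (a, c) (b, d)) (\<lambda>p. D1 p + D2 p) =
     integral (cbox (a, c) (b, d)) D1 + integral (cbox (a, c) (b, d)) D2"
    by (intro integral_add integrable_continuous D1 D2)
  moreover have "integral (cbox (a, c) (b, d)) D1 = integral {c..d} (\<lambda>y. integral {a..b} (\<lambda>x. D1 (x, y)))"
    using integral_prod_continuous[OF D1] integral_swap_continuous[of a c b d "\<lambda>x y. D1 (x, y)"] D1 by simp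
  moreover have "\<dots> = integral {c..d} (\<lambda>y. X1 (b, y) - X1 (a, y))"
    by (intro integral_cong integral_unique fundamental_theorem_of_calculus ab)
       (use X1 in \<open>auto simp: has_real_derivative_iff_has_vector_derivative\<close>)
  moreover have "integral (cbox (a, c) (b, d)) D2 = integral {a..b} (\<lambda>x. integral {c..d} (\<lambda>y. D2 (x, y)))"
    using integral_prod_continuous[OF D2] by simp
  moreover have "\<dots> = integral {a..b} (\<lambda>x. X2 (x, d) - X2 (x, c))"
    by (intro integral_cong integral_unique fundamental_theorem_of_calculus ab)
       (use X2 in \<open>auto simp: has_real_derivative_iff_has_vector_derivative\<close>)
  ultimately show ?thesis by simp
qed

text \<open>If \<open>c < 0\<close>, then near \<open>y0\<close> the sign of \<open>g'\<close> is
  opposite to that of \<open>y - y0\<close>, and the mean value theorem yields a value below the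
  minimum. As stationarity is a premise, \<open>y0\<close> may be an end point; this covers minima
  at a Neumann wall.\<close>

lemma second_derivative_nonneg_at_min:
  fixes g g' :: "real \<Rightarrow> real"
  assumes g: "\<And>y. y \<in> Y \<Longrightarrow> (g has_real_derivative g' y) (at y within Y)"
    and g2: "(g' has_real_derivative c) (at y0 within Y)"
    and Y: "convex Y" "y0 \<in> Y" "at y0 within Y \<noteq> bot" and z: "g' y0 = 0"
    and min: "\<And>y. y \<in> Y \<Longrightarrow> g y0 \<le> g y"
  shows "0 \<le> c"
proof (rule ccontr)
  assume "\<not> 0 \<le> c"
  then have "c < 0" by simp
  have "((\<lambda>y. (g' y - g' y0) / (y - y0)) \<longlongrightarrow> c) (at y0 within Y)"
    using g2 by (simp add: has_field_derivative_iff)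
  then have "eventually (\<lambda>y. (g' y - g' y0) / (y - y0) < 0) (at y0 within Y)"
    using \<open>c < 0\<close> order_tendstoD(2) by blast
  then obtain d where d: "d > 0" "\<And>y. y \<in> Y \<Longrightarrow> y \<noteq> y0 \<Longrightarrow> dist y y0 < d \<Longrightarrow> g' y / (y - y0) < 0"
    unfolding eventually_at by (auto simp: z)
  from Y(3) obtain y1 where y1: "y1 \<in> Y" "y1 \<noteq> y0" "dist y1 y0 < d"
    using d(1) by (metis islimpt_approachable trivial_limit_within)
  have sub: "closed_segment y0 y1 \<subseteq> Y" using Y y1 by (simp add: closed_segment_subset)
  have mvt: "\<exists>\<xi>\<in>{r<..<t}. g t - g r = (t - r) * g' \<xi>" if "r < t" "{r..t} \<subseteq> Y" for r t
  proof -
    have "(g has_derivative (\<lambda>h. g' x * h)) (at x within {r..t})" if "x \<in> {r..t}" for x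
    proof -
      have "x \<in> Y" using that \<open>{r..t} \<subseteq> Y\<close> by blast
      then show ?thesis
        using g has_derivative_subset[OF _ \<open>{r..t} \<subseteq> Y\<close>] by (auto simp: has_field_derivative_def)
    qed
    then show ?thesis
      using mvt_simple[OF that(1), of g "\<lambda>x h. g' x * h"] by (auto simp: mult.commute)
  qed
  have "\<exists>\<xi>\<in>open_segment y0 y1. g y1 - g y0 = g' \<xi> * (y1 - y0)"
  proof (cases "y0 < y1")
    case True
    then show ?thesis using mvt[OF True] sub
      by (auto simp: open_segment_eq_real_ivl closed_segment_eq_real_ivl mult.commute)
  next
    case False
    then have lt: "y1 < y0" using y1 by simp
    then obtain \<xi> where "\<xi> \<in> {y1<..<y0}" "g y0 - g y1 = (y0 - y1) * g' \<xi>"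
      using mvt[OF lt] sub by (auto simp: closed_segment_eq_real_ivl)
    then show ?thesis using lt
      by (intro bexI[of _ \<xi>]) (auto simp: open_segment_eq_real_ivl algebra_simps)
  qed
  then obtain \<xi> where \<xi>: "\<xi> \<in> open_segment y0 y1" "g y1 - g y0 = g' \<xi> * (y1 - y0)" by blast
  have \<xi>': "\<xi> \<in> Y" "\<xi> \<noteq> y0" "dist \<xi> y0 < d"
    using \<xi>(1) sub y1 by (auto simp: open_segment_eq_real_ivl closed_segment_eq_real_ivl dist_real_def split: if_splits)
  have "g' \<xi> / (\<xi> - y0) < 0" using d(2) \<xi>' by blast
  moreover have "(\<xi> - y0) * (y1 - y0) > 0"
    using \<xi>(1) by (auto simp: open_segment_eq_real_ivl zero_less_mult_iff split: if_splits)
  ultimately have "g' \<xi> * (y1 - y0) < 0"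
    by (auto simp: divide_less_0_iff mult_less_0_iff zero_less_mult_iff)
  then show False using \<xi>(2) min[OF y1(1)] by simp
qed

text \<open>Source of the bump in \<open>reaction_cutoff\<close> and of the cutoff across a tube:
  squaring the positive part gives a \<open>C1\<close> function, which is as much smoothness as a
  single integration by parts asks for.\<close>

lemma max_zero_square_has_derivative:
  "((\<lambda>s::real. (max 0 s)\<^sup>2) has_real_derivative 2 * max 0 s) (at s)"
proof (cases "s = 0")
  case True
  have "((\<lambda>y::real. (max 0 y)\<^sup>2 / y) \<longlongrightarrow> 0) (at 0)"
  proof (rule Lim_null_comparison)
    show "\<forall>\<^sub>F y::real in at 0. norm ((max 0 y)\<^sup>2 / y) \<le> \<bar>y\<bar>"
      by (rule always_eventually) (auto simp: max_def power2_eq_square)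
    show "((\<lambda>y::real. \<bar>y\<bar>) \<longlongrightarrow> 0) (at 0)" by (simp add: tendsto_rabs_zero)
  qed
  then show ?thesis using True by (simp add: has_field_derivative_iff)
next
  case False
  consider "s < 0" | "s > 0" using False by linarith
  then show ?thesis
  proof cases
    case 1
    have "((\<lambda>s::real. 0) has_real_derivative 2 * max 0 s) (at s)" using 1 by (simp add: max_def)
    then show ?thesis
      by (rule has_field_derivative_transform_within_open[where S="{..<0}"]) (use 1 in \<open>auto simp: max_def\<close>)
  next
    case 2
    have "((\<lambda>s::real. s\<^sup>2) has_real_derivative 2 * max 0 s) (at s)"
      using 2 by (auto intro!: derivative_eq_intros)
    then show ?thesis
      by (rule has_field_derivative_transform_within_open[where S="{0<..}"]) (use 2 in \<open>auto simp: max_def\<close>)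
  qed
qed

section \<open>A parabolic maximum principle\<close>

fun cross_section :: "bdry_cond \<Rightarrow> real \<Rightarrow> real set" where
  "cross_section Neumann H = {0..H}"
| "cross_section Periodic H = UNIV"

lemma domain_eq: "domain bc H = UNIV \<times> cross_section bc H"
  by (cases bc) (auto simp: strip_def)

lemma convex_cross_section: "convex (cross_section bc H)"
  by (cases bc) auto

lemma closed_domain: "closed (domain bc H)"
  by (cases bc) (auto simp: strip_def intro!: closed_Times)

lemma strip_subset_domain: "strip H \<subseteq> domain bc H"
  by (cases bc) auto

lemma cross_section_nontrivial:
  assumes "H > 0" "y \<in> cross_section bc H"
  shows "at y within cross_section bc H \<noteq> bot"
  using assms
  by (cases bc) (auto simp: trivial_limit_within islimpt_Icc)

lemma two_dim_at_points_Times: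
  assumes "\<And>x. x \<in> X \<Longrightarrow> x islimpt X" "\<And>y. y \<in> Y \<Longrightarrow> y islimpt Y"
  shows "two_dim_at_points (X \<times> Y)"
  unfolding two_dim_at_points_def
proof (intro ballI allI impI)
  fix p i :: "real \<times> real" and e :: real
  assume p: "p \<in> X \<times> Y" and i: "i \<in> Basis" and e: "e > 0"
  have "fst p islimpt X" "snd p islimpt Y" using assms p by auto
  then obtain x y where xy: "x \<in> X" "x \<noteq> fst p" "dist x (fst p) < e" "y \<in> Y" "y \<noteq> snd p" "dist y (snd p) < e"
    using e unfolding islimpt_approachable by metis
  from i consider "i = (1, 0)" | "i = (0, 1)" by (auto simp: Basis_prod_def)
  then show "\<exists>d. 0 < \<bar>d\<bar> \<and> \<bar>d\<bar> < e \<and> p + d *\<^sub>R i \<in> X \<times> Y"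
  proof cases
    case 1
    then show ?thesis using p xy by (intro exI[of _ "x - fst p"]) (cases p, auto simp: dist_real_def)
  next
    case 2
    then show ?thesis using p xy by (intro exI[of _ "y - snd p"]) (cases p, auto simp: dist_real_def)
  qed
qed

lemma two_dim_at_points_domain:
  assumes "H > 0" shows "two_dim_at_points (domain bc H)"
  unfolding domain_eq
  by (rule two_dim_at_points_Times)
     (use cross_section_nontrivial[OF assms, of _ bc] in \<open>auto simp: trivial_limit_within islimpt_UNIV\<close>)

lemma periodic_int_shift:
  fixes g :: "real \<times> real \<Rightarrow> 'a"
  assumes "\<And>x y. g (x, y + H) = g (x, y)"
  shows "g (x, y + of_int k * H) = g (x, y)"
proof -
  have nat: "g (x, y + of_nat n * H) = g (x, y)" for n y
    by (induction n) (use assms[of x "y + of_nat _ * H"] in \<open>auto simp: algebra_simps\<close>)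
  show ?thesis
    using nat[of y "nat k"] nat[of "y + of_int k * H" "nat (- k)"] by (cases "k \<ge> 0") auto
qed

lemma period_representative:
  fixes y H :: real
  assumes "H > 0" obtains k :: int where "y + of_int k * H \<in> {0..H}"
proof
  have "of_int \<lfloor>y / H\<rfloor> \<le> y / H" "y / H \<le> of_int \<lfloor>y / H\<rfloor> + 1" by linarith+
  then have "of_int \<lfloor>y / H\<rfloor> * H \<le> y" "y \<le> (of_int \<lfloor>y / H\<rfloor> + 1) * H"
    using assms by (simp_all only: pos_le_divide_eq pos_divide_le_eq)
  then show "y + of_int (- \<lfloor>y / H\<rfloor>) * H \<in> {0..H}" by (auto simp: algebra_simps)
qed

text \<open>At a Neumann wall the boundary condition gives the claim; any other point is interior
  and Fermat's theorem applies.\<close>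

lemma deriv_zero_at_min:
  assumes "\<And>y. y \<in> cross_section bc H \<Longrightarrow> g y0 \<le> g y" "y0 \<in> cross_section bc H"
    and "(g has_real_derivative g') (at y0 within cross_section bc H)"
    and "bc = Neumann \<Longrightarrow> y0 = 0 \<or> y0 = H \<Longrightarrow> g' = 0"
  shows "g' = 0"
proof (cases "bc = Neumann \<and> (y0 = 0 \<or> y0 = H)")
  case False
  then have i: "y0 \<in> interior (cross_section bc H)" using assms(2) by (cases bc) auto
  then obtain d where d: "d > 0" "ball y0 d \<subseteq> cross_section bc H" by (auto simp: mem_interior)
  have "(g has_real_derivative g') (at y0)" using assms(3) i by (metis at_within_interior)
  then show ?thesis
    by (rule DERIV_local_min[OF _ d(1)]) (use d assms(1) in \<open>auto simp: dist_real_def\<close>)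
qed (use assms in auto)

text \<open>On an unbounded strip the infimum need not be attained. Adding
  \<open>e * exp (l * t) * (1 + x^2)\<close> forces nonpositive values into a bounded range of
  \<open>x\<close>; at the first time such a value occurs, the derivative tests contradict
  \<open>ineq\<close>. The inequality is required only where \<open>w < 0\<close>, which is where a
  Lipschitz reaction term has a usable sign. Derivatives are separate parameters so that differences
  of solutions can be inserted directly.\<close>

lemma parabolic_max_principle:
  fixes w wt wx wy wxx wyy :: "real \<Rightarrow> real \<times> real \<Rightarrow> real" and u :: "real \<times> real \<Rightarrow> real \<times> real"
  assumes H: "H > 0" and \<kappa>: "\<kappa> \<ge> 0" and c: "c \<ge> 0"
    and cont: "continuous_on ({0..} \<times> domain bc H) (\<lambda>(t, p). w t p)"
    and per: "\<And>t x y. bc = Periodic \<Longrightarrow> t \<ge> 0 \<Longrightarrow> w t (x, y + H) = w t (x, y)"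
    and neu: "\<And>t x. bc = Neumann \<Longrightarrow> t > 0 \<Longrightarrow> wy t (x, 0) = 0 \<and> wy t (x, H) = 0"
    and init: "\<And>p. p \<in> domain bc H \<Longrightarrow> w 0 p \<ge> 0"
    and below: "\<And>t p. t \<ge> 0 \<Longrightarrow> p \<in> domain bc H \<Longrightarrow> w t p \<ge> - M"
    and wt: "\<And>t p. t > 0 \<Longrightarrow> p \<in> domain bc H \<Longrightarrow> ((\<lambda>s. w s p) has_real_derivative wt t p) (at t)"
    and wx: "\<And>t x y. t > 0 \<Longrightarrow> y \<in> cross_section bc H \<Longrightarrow>
      ((\<lambda>x. w t (x, y)) has_real_derivative wx t (x, y)) (at x)"
    and wxx: "\<And>t x y. t > 0 \<Longrightarrow> y \<in> cross_section bc H \<Longrightarrow>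
      ((\<lambda>x. wx t (x, y)) has_real_derivative wxx t (x, y)) (at x)"
    and wy: "\<And>t x y. t > 0 \<Longrightarrow> y \<in> cross_section bc H \<Longrightarrow>
      ((\<lambda>y. w t (x, y)) has_real_derivative wy t (x, y)) (at y within cross_section bc H)"
    and wyy: "\<And>t x y. t > 0 \<Longrightarrow> y \<in> cross_section bc H \<Longrightarrow>
      ((\<lambda>y. wy t (x, y)) has_real_derivative wyy t (x, y)) (at y within cross_section bc H)"
    and u: "\<And>p. p \<in> domain bc H \<Longrightarrow> \<bar>fst (u p)\<bar> \<le> U"
    and ineq: "\<And>t p. t > 0 \<Longrightarrow> p \<in> domain bc H \<Longrightarrow> w t p < 0 \<Longrightarrow>
      wt t p + (fst (u p) * wx t p + snd (u p) * wy t p) - \<kappa> * (wxx t p + wyy t p) \<ge> c * w t p"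
    and t: "t \<ge> 0" and p: "p \<in> domain bc H"
  shows "w t p \<ge> 0"
proof (rule ccontr)
  assume neg: "\<not> w t p \<ge> 0"
  \<comment> \<open>A growth rate beating, in this order, the zero-order term, the drift (as
    \<open>2 * \<bar>x\<bar> \<le> 1 + x^2\<close>) and the second derivative 2 of the weight; the
    final 1 makes the contradiction strict.\<close>
  define l where "l = c + U + 2 * \<kappa> + 1"
  have U: "U \<ge> 0" using u[OF p] by simp
  have l: "l > 0" using c U \<kappa> by (simp add: l_def)
  define \<psi> where "\<psi> p = 1 + (fst p)\<^sup>2" for p :: "real \<times> real"
  have \<psi>: "\<psi> p \<ge> 1" for p by (simp add: \<psi>_def)
  \<comment> \<open>The perturbation at \<open>(t, p)\<close> is then half of
    \<open>- w t p\<close>, so \<open>z\<close> is still negative there.\<close>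
  define e where "e = - w t p / (2 * (exp (l * t) * \<psi> p))"
  have e: "e > 0" unfolding e_def
    by (rule divide_pos_pos) (use neg \<psi>[of p] in auto)
  define z where "z s q = w s q + e * exp (l * s) * \<psi> q" for s q
  have ztp: "z t p < 0"
  proof -
    have "e * exp (l * t) * \<psi> p = - w t p / 2"
      using \<psi>[of p] by (simp add: e_def field_simps)
    then show ?thesis using neg by (simp add: z_def)
  qed
  have rep: "\<exists>y'\<in>{0..H}. z s (x, y') = z s (x, y)" if "s \<ge> 0" "(x, y) \<in> domain bc H" for s x y
  proof (cases bc)
    case Neumann
    then show ?thesis using that by (auto simp: strip_def)
  next
    case Periodic
    obtain k :: int where k: "y + of_int k * H \<in> {0..H}" using period_representative[OF H] .
    have "w s (x, y + of_int k * H) = w s (x, y)"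
      by (rule periodic_int_shift) (use per Periodic that in auto)
    then show ?thesis using k by (auto simp: z_def \<psi>_def)
  qed
  \<comment> \<open>Beyond \<open>R\<close> the perturbation outweighs the lower bound
    \<open>- M\<close>.\<close>
  define R where "R = (\<bar>M\<bar> + 1) / e + 1"
  have R: "R \<ge> 1" using e by (simp add: R_def)
  have far: "z s (x, y) > 0" if "s \<ge> 0" "(x, y) \<in> domain bc H" "\<bar>x\<bar> > R" for s x y
  proof -
    have "(\<bar>M\<bar> + 1) / e \<le> \<bar>x\<bar>" using that by (simp add: R_def)
    also have "\<bar>x\<bar> \<le> x\<^sup>2" 
      using self_le_power[of "\<bar>x\<bar>" 2] that R by simp
    finally have "\<bar>M\<bar> + 1 \<le> e * x\<^sup>2" using e by (simp add: field_simps)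
    also have "\<dots> \<le> e * \<psi> (x, y)" using e by (simp add: \<psi>_def)
    also have "\<dots> \<le> e * \<psi> (x, y) * exp (l * s)"
      using mult_left_mono[of 1 "exp (l * s)" "e * \<psi> (x, y)"] e \<psi>[of "(x,y)"] l that by simp
    finally show ?thesis using below[OF that(1,2)] by (simp add: z_def mult_ac)
  qed
  have contz: "continuous_on ({0..} \<times> domain bc H) (\<lambda>(s, q). z s q)"
    unfolding z_def \<psi>_def using cont by (auto simp: split_beta intro!: continuous_intros)
  define B where "B = {0..t} \<times> ({-R..R} \<times> {0..H})"
  have "compact B" unfolding B_def by (intro compact_Times compact_Icc)
  have Bsub: "B \<subseteq> {0..} \<times> domain bc H"
    using strip_subset_domain[of H bc] by (auto simp: B_def strip_def)
  define Z where "Z = {q \<in> B. (\<lambda>(s, q). z s q) q \<le> 0}"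
  have "closed Z" unfolding Z_def
    by (rule continuous_on_closed_Collect_le[OF continuous_on_subset[OF contz Bsub] continuous_on_const
          compact_imp_closed[OF \<open>compact B\<close>]])
  then have "compact Z"
    using \<open>compact B\<close> by (metis (no_types, lifting) Z_def compact_Int_closed inf.absorb2 mem_Collect_eq subsetI)
  \<comment> \<open>Periodicity moves a nonpositive point into the compact box without changing its
    time, so minimising the time over \<open>Z\<close> finds the first such time on the whole
    domain.\<close>
  have inZ: "\<exists>y'. (s, (x, y')) \<in> Z" if "0 \<le> s" "s \<le> t" "(x, y) \<in> domain bc H" "z s (x, y) \<le> 0" for s x y
    using rep[OF that(1,3)] far[OF that(1,3)] that by (force simp: Z_def B_def)
  have "Z \<noteq> {}" using inZ[of t "fst p" "snd p"] t p ztp by auto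
  then obtain q0 where q0: "q0 \<in> Z" "\<And>q. q \<in> Z \<Longrightarrow> fst q0 \<le> fst q"
    using continuous_attains_inf[OF \<open>compact Z\<close> _ continuous_on_fst[OF continuous_on_id]] by blast
  obtain t0 x0 y0 where q0_eq: "q0 = (t0, (x0, y0))" by (metis surj_pair)
  have t0: "0 \<le> t0" "t0 \<le> t" and p0: "(x0, y0) \<in> domain bc H" and z0: "z t0 (x0, y0) \<le> 0"
    using q0(1) subsetD[OF Bsub, of q0] by (auto simp: q0_eq Z_def B_def)
  have before: "z s q > 0" if "0 \<le> s" "s < t0" "q \<in> domain bc H" for s q
  proof (rule ccontr)
    assume "\<not> z s q > 0"
    then have "\<exists>y'. (s, (fst q, y')) \<in> Z"
      using inZ[of s "fst q" "snd q"] that t0 by simp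
    then obtain y' where "(s, (fst q, y')) \<in> Z" ..
    then show False using q0(2) that by (force simp: q0_eq)
  qed
  have "t0 \<noteq> 0"
  proof
    assume "t0 = 0"
    then have "z 0 (x0, y0) \<le> 0" using z0 by simp
    moreover have "e * exp (l * 0) * \<psi> (x0, y0) > 0" using e \<psi>[of "(x0,y0)"] by simp
    ultimately show False using init[OF p0] by (simp add: z_def)
  qed
  then have t0pos: "t0 > 0" using t0 by simp
  have zmin: "z t0 q \<ge> 0" if "q \<in> domain bc H" for q
  proof -
    have "continuous_on {0..t0} (\<lambda>s. z s q)"
      using continuous_on_compose2[OF contz, of "{0..t0}" "\<lambda>s. (s, q)"] that
      by (force intro: continuous_on_Pair continuous_on_id continuous_on_const)
    then have "((\<lambda>s. z s q) \<longlongrightarrow> z t0 q) (at t0 within {0..t0})"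
      using t0 by (auto simp: continuous_on_def)
    moreover have "at t0 within {0..t0} = at_left t0"
      using t0pos by (rule at_within_Icc_at_left)
    moreover have "eventually (\<lambda>s. 0 \<le> z s q) (at_left t0)"
      unfolding eventually_at_left[OF t0pos] 
      using before[OF _ _ that] t0pos by (intro exI[of _ 0]) (simp add: less_imp_le)
    ultimately show ?thesis
      using tendsto_lowerbound[of "\<lambda>s. z s q" "z t0 q" "at_left t0" 0] trivial_limit_at_left_real by auto
  qed
  have z0': "z t0 (x0, y0) = 0" using z0 zmin[OF p0] by simp
  define E where "E = e * exp (l * t0)"
  have E: "E > 0" using e by (simp add: E_def)
  have y0: "y0 \<in> cross_section bc H" using p0 by (simp add: domain_eq)
  have zx: "((\<lambda>x. z t0 (x, y0)) has_real_derivative wx t0 (x, y0) + E * (2 * x)) (at x)" for x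
    unfolding z_def \<psi>_def E_def by (auto intro!: derivative_eq_intros wx t0pos y0)
  have zxx: "((\<lambda>x. wx t0 (x, y0) + E * (2 * x)) has_real_derivative wxx t0 (x0, y0) + E * 2) (at x0)"
    by (auto intro!: derivative_eq_intros wxx t0pos y0)
  have zy: "((\<lambda>y. z t0 (x0, y)) has_real_derivative wy t0 (x0, y)) (at y within cross_section bc H)"
    if "y \<in> cross_section bc H" for y
    unfolding z_def \<psi>_def by (auto intro!: derivative_eq_intros wy t0pos that)
  have zt: "((\<lambda>s. z s (x0, y0)) has_real_derivative wt t0 (x0, y0) + E * l * \<psi> (x0, y0)) (at t0)"
    unfolding z_def E_def by (auto intro!: derivative_eq_intros wt t0pos p0)
  have x0: "wx t0 (x0, y0) + E * (2 * x0) = 0"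
    by (rule DERIV_local_min[OF zx, of 1]) (use zmin z0' y0 in \<open>auto simp: domain_eq\<close>)
  have 1: "wxx t0 (x0, y0) + E * 2 \<ge> 0"
    by (rule second_derivative_nonneg_at_min[where Y=UNIV, OF zx zxx _ _ _ x0])
       (use zmin z0' y0 in \<open>auto simp: domain_eq\<close>)
  have y00: "wy t0 (x0, y0) = 0"
    by (rule deriv_zero_at_min[OF _ y0 zy[OF y0]])
       (use zmin z0' y0 neu t0pos in \<open>auto simp: domain_eq\<close>)
  have 2: "wyy t0 (x0, y0) \<ge> 0"
    by (rule second_derivative_nonneg_at_min[OF zy wyy[OF t0pos y0] convex_cross_section y0
          cross_section_nontrivial[OF H y0] y00])
       (use zmin z0' in \<open>auto simp: domain_eq\<close>)
  \<comment> \<open>A positive time derivative would make \<open>z\<close> negative just before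
    \<open>t0\<close>.\<close>
  have 3: "wt t0 (x0, y0) + E * l * \<psi> (x0, y0) \<le> 0"
  proof (rule ccontr)
    assume "\<not> ?thesis"
    then obtain d where d: "d > 0" "\<And>h. h > 0 \<Longrightarrow> h < d \<Longrightarrow> z (t0 - h) (x0, y0) < z t0 (x0, y0)"
      using has_real_derivative_pos_inc_left[OF zt] by auto
    define h where "h = min (d / 2) t0"
    have "h > 0" "h < d" "t0 - h \<ge> 0" "t0 - h < t0" using d(1) t0pos by (auto simp: h_def)
    then show False using d(2)[of h] before[of "t0 - h" "(x0, y0)"] p0 z0' by auto
  qed
  define P where "P = \<psi> (x0, y0)"
  have w0: "w t0 (x0, y0) = - E * P" using z0' by (simp add: z_def E_def P_def)
  have P: "P \<ge> 1" "2 * \<bar>x0\<bar> \<le> P"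
    using \<psi>[of "(x0,y0)"] sum_squares_bound[of "\<bar>x0\<bar>" 1] by (auto simp: P_def \<psi>_def)
  have "w t0 (x0, y0) < 0" using w0 E P by simp
  from ineq[OF t0pos p0 this]
  have I: "c * (- E * P) \<le> wt t0 (x0, y0) + fst (u (x0, y0)) * wx t0 (x0, y0)
      - \<kappa> * (wxx t0 (x0, y0) + wyy t0 (x0, y0))" using w0 y00 by simp
  have "\<kappa> * (wxx t0 (x0, y0) + wyy t0 (x0, y0)) \<ge> \<kappa> * (- (E * 2))"
    using 1 2 \<kappa> by (intro mult_left_mono) auto
  moreover have "fst (u (x0, y0)) * wx t0 (x0, y0) \<le> U * (E * P)"
  proof -
    have "wx t0 (x0, y0) = - (E * (2 * x0))" using x0 by simp
    then have "\<bar>wx t0 (x0, y0)\<bar> = E * (2 * \<bar>x0\<bar>)" using E by (simp add: abs_mult)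
    also have "\<dots> \<le> E * P" using E P by (intro mult_left_mono) auto
    finally have "\<bar>fst (u (x0, y0)) * wx t0 (x0, y0)\<bar> \<le> U * (E * P)"
      using u[OF p0] by (auto simp: abs_mult intro!: mult_mono)
    then show ?thesis by linarith
  qed
  moreover have "wt t0 (x0, y0) \<le> - (E * l * P)" using 3 by (simp add: P_def)
  ultimately have "c * (- E * P) \<le> - (E * l * P) + U * (E * P) + \<kappa> * (E * 2)" using I by linarith
  moreover have "\<kappa> * (E * 2) \<le> 2 * \<kappa> * (E * P)"
    using mult_left_mono[of 1 P "2 * \<kappa> * E"] P E \<kappa> by (simp add: mult_ac)
  ultimately have "0 \<le> E * P * (c + U + 2 * \<kappa> - l)" by (simp add: algebra_simps)
  moreover have "E * P * (c + U + 2 * \<kappa> - l) < 0" using E P by (auto simp: l_def mult_less_0_iff)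
  ultimately show False by simp
qed

section \<open>Monotonicity in time and decay at infinity\<close>

lemma C1_slices:
  assumes H: "H > 0" and g: "C1_on (domain bc H) g" and y: "y \<in> cross_section bc H"
  shows "((\<lambda>x. g (x, y)) has_real_derivative d1 (domain bc H) g (x, y)) (at x within A)"
    and "B \<subseteq> cross_section bc H \<Longrightarrow>
      ((\<lambda>y. g (x, y)) has_real_derivative d2 (domain bc H) g (x, y)) (at y within B)"
proof -
  have p: "(x, y) \<in> domain bc H" using y by (simp add: domain_eq)
  note h = C1_on_has_derivative[OF two_dim_at_points_domain[OF H] g p]
  have "((\<lambda>x. g (x, y)) has_real_derivative d1 (domain bc H) g (x, y)) (at x within UNIV)"
    by (rule has_derivative_slices(1)[where Y="cross_section bc H"]) (use h y in \<open>auto simp: domain_eq\<close>)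
  then show "((\<lambda>x. g (x, y)) has_real_derivative d1 (domain bc H) g (x, y)) (at x within A)"
    by (rule DERIV_subset) simp
  have "((\<lambda>y. g (x, y)) has_real_derivative d2 (domain bc H) g (x, y)) (at y within cross_section bc H)"
    by (rule has_derivative_slices(2)[where X=UNIV]) (use h y in \<open>auto simp: domain_eq\<close>)
  then show "((\<lambda>y. g (x, y)) has_real_derivative d2 (domain bc H) g (x, y)) (at y within B)"
    if "B \<subseteq> cross_section bc H" by (rule DERIV_subset) (rule that)
qed

lemma C2_slices:
  assumes H: "H > 0" and g: "C2_on (domain bc H) g" and y: "y \<in> cross_section bc H"
  shows "((\<lambda>x. g (x, y)) has_real_derivative d1 (domain bc H) g (x, y)) (at x)"
    and "((\<lambda>x. d1 (domain bc H) g (x, y)) has_real_derivative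
           d1 (domain bc H) (d1 (domain bc H) g) (x, y)) (at x)"
    and "((\<lambda>y. g (x, y)) has_real_derivative d2 (domain bc H) g (x, y)) (at y within cross_section bc H)"
    and "((\<lambda>y. d2 (domain bc H) g (x, y)) has_real_derivative
           d2 (domain bc H) (d2 (domain bc H) g) (x, y)) (at y within cross_section bc H)"
proof -
  note P = C2_on_partials_C1_on[OF two_dim_at_points_domain[OF H] g]
  show "((\<lambda>x. g (x, y)) has_real_derivative d1 (domain bc H) g (x, y)) (at x)"
    by (rule C1_slices(1)[OF H C2_on_imp_C1_on[OF g] y])
  show "((\<lambda>x. d1 (domain bc H) g (x, y)) has_real_derivative
           d1 (domain bc H) (d1 (domain bc H) g) (x, y)) (at x)"
    by (rule C1_slices(1)[OF H P(1) y])
  show "((\<lambda>y. g (x, y)) has_real_derivative d2 (domain bc H) g (x, y)) (at y within cross_section bc H)"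
    by (rule C1_slices(2)[OF H C2_on_imp_C1_on[OF g] y order_refl])
  show "((\<lambda>y. d2 (domain bc H) g (x, y)) has_real_derivative
           d2 (domain bc H) (d2 (domain bc H) g) (x, y)) (at y within cross_section bc H)"
    by (rule C1_slices(2)[OF H P(2) y order_refl])
qed

lemma partials_cong:
  assumes "\<And>q. q \<in> S \<Longrightarrow> f q = g q" "p \<in> S"
  shows "d1 S f p = d1 S g p" "d2 S f p = d2 S g p"
proof -
  have "(f has_derivative D) (at p within S) \<longleftrightarrow> (g has_derivative D) (at p within S)" for D
    using has_derivative_transform[OF assms(2), of f g D] has_derivative_transform[OF assms(2), of g f D] assms(1)
    by auto
  then show "d1 S f p = d1 S g p" "d2 S f p = d2 S g p"
    by (simp_all add: d1_def d2_def frechet_derivative_def)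
qed

lemma reaction_bounds:
  assumes f: "reaction_term f"
  obtains Lf where "Lf \<ge> 0" "\<And>s t. s \<in> {0..1} \<Longrightarrow> t \<in> {0..1} \<Longrightarrow> \<bar>f s - f t\<bar> \<le> Lf * \<bar>s - t\<bar>"
    "continuous_on {0..1} f" "\<And>s. s \<in> {0..1} \<Longrightarrow> 0 \<le> f s"
proof -
  from f obtain f' where f': "\<And>p. p \<in> {0..1} \<Longrightarrow> (f has_derivative blinfun_apply (f' p)) (at p within {0..1})"
    and c: "continuous_on {0..1} f'" unfolding reaction_term_def C1_on_def by blast
  have "compact (f' ` {0..1})" by (intro compact_continuous_image c) auto
  then obtain B where B: "\<And>p. p \<in> {0..1} \<Longrightarrow> norm (f' p) \<le> B"
    using compact_imp_bounded bounded_iff by (metis imageI)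
  have "\<bar>f s - f t\<bar> \<le> B * \<bar>s - t\<bar>" if "s \<in> {0..1}" "t \<in> {0..1}" for s t
    using differentiable_bound[of "{0..1}" f "\<lambda>p. blinfun_apply (f' p)" B s t] f' B that
    by (auto simp: norm_blinfun.rep_eq)
  moreover have "0 \<le> B" using order_trans[OF norm_ge_zero B[of 0]] by simp
  moreover have "continuous_on {0..1} f"
    using f unfolding reaction_term_def by (blast intro: C1_on_imp_continuous_on)
  moreover have "0 \<le> f s" if "s \<in> {0..1}" for s
  proof -
    consider "s = 0" | "s = 1" | "s \<in> {0<..<1}" using \<open>s \<in> {0..1}\<close> by fastforce
    then show ?thesis using f unfolding reaction_term_def by cases auto
  qed
  ultimately show thesis using that by blast
qed

lemma flow_bounded:
  assumes H: "H > 0" and C: "C1_on (domain bc H) u" and L: "L > 0"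
    and px: "\<And>x y. (x, y) \<in> domain bc H \<Longrightarrow> u (x + L, y) = u (x, y)"
    and bc: "flow_bc bc H u"
  obtains U where "\<And>p. p \<in> domain bc H \<Longrightarrow> norm (u p) \<le> U"
proof -
  have "compact (u ` ({0..L} \<times> {0..H}))"
    using strip_subset_domain[of H bc]
    by (intro compact_continuous_image compact_Times compact_Icc
        continuous_on_subset[OF C1_on_imp_continuous_on[OF C]]) (auto simp: strip_def)
  then obtain U where U: "\<And>p. p \<in> {0..L} \<times> {0..H} \<Longrightarrow> norm (u p) \<le> U"
    using compact_imp_bounded bounded_iff by (metis imageI)
  have "norm (u (x, y)) \<le> U" if xy: "(x, y) \<in> domain bc H" for x y
  proof -
    have "\<exists>y'\<in>{0..H}. \<forall>x. u (x, y') = u (x, y)"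
    proof (cases bc)
      case Neumann
      then show ?thesis using xy by (auto simp: strip_def)
    next
      case Periodic
      obtain k :: int where k: "y + of_int k * H \<in> {0..H}" using period_representative[OF H] .
      have "u (x, y + of_int k * H) = u (x, y)" for x
        by (rule periodic_int_shift) (use bc Periodic in auto)
      then show ?thesis using k by blast
    qed
    then obtain y' where y': "y' \<in> {0..H}" "\<And>x. u (x, y') = u (x, y)" by blast
    obtain k :: int where k: "x + of_int k * L \<in> {0..L}" using period_representative[OF L] .
    have dom: "(x, y') \<in> domain bc H" for x using y'(1) strip_subset_domain[of H bc] by (auto simp: strip_def)
    \<comment> \<open>\<open>periodic_int_shift\<close> shifts the second coordinate; the roles are
      exchanged here with a dummy first coordinate 0.\<close>
    have "u (x + of_int k * L, y') = u (x, y')"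
      using periodic_int_shift[of "\<lambda>q. u (snd q, y')" L 0 x k] px dom by simp
    then have "u (x, y) = u (x + of_int k * L, y')" using y'(2) by simp
    then show ?thesis using U[of "(x + of_int k * L, y')"] k y' by simp
  qed
  then show thesis using that by auto
qed

text \<open>The rate in \<open>t\<close> is chosen so that the exponential is a supersolution:
  \<open>a * U\<close> pays for the drift, \<open>\<kappa> * a\<^sup>2\<close> for the diffusion and
  \<open>c\<close> for the linear bound on the reaction. Both signs of \<sigma> are allowed, for the
  decay of \<open>T\<close> on the right and of \<open>1 - T\<close> on the left.\<close>

lemma exp_barrier:
  fixes \<phi> \<phi>t \<phi>x \<phi>y \<phi>xx \<phi>yy :: "real \<Rightarrow> real \<times> real \<Rightarrow> real" and u :: "real \<times> real \<Rightarrow> real \<times> real"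
  assumes H: "H > 0" and \<kappa>: "\<kappa> \<ge> 0" and c: "c \<ge> 0" and M: "M \<ge> 0" and \<sigma>: "\<bar>\<sigma>\<bar> = a"
    and cont: "continuous_on ({0..} \<times> domain bc H) (\<lambda>(t, p). \<phi> t p)"
    and per: "\<And>t x y. bc = Periodic \<Longrightarrow> t \<ge> 0 \<Longrightarrow> \<phi> t (x, y + H) = \<phi> t (x, y)"
    and neu: "\<And>t x. bc = Neumann \<Longrightarrow> t > 0 \<Longrightarrow> \<phi>y t (x, 0) = 0 \<and> \<phi>y t (x, H) = 0"
    and init: "\<And>p. p \<in> domain bc H \<Longrightarrow> \<phi> 0 p \<le> M * exp (\<sigma> * fst p)"
    and le1: "\<And>t p. t \<ge> 0 \<Longrightarrow> p \<in> domain bc H \<Longrightarrow> \<phi> t p \<le> 1"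
    and \<phi>t: "\<And>t p. t > 0 \<Longrightarrow> p \<in> domain bc H \<Longrightarrow> ((\<lambda>s. \<phi> s p) has_real_derivative \<phi>t t p) (at t)"
    and \<phi>x: "\<And>t x y. t > 0 \<Longrightarrow> y \<in> cross_section bc H \<Longrightarrow>
      ((\<lambda>x. \<phi> t (x, y)) has_real_derivative \<phi>x t (x, y)) (at x)"
    and \<phi>xx: "\<And>t x y. t > 0 \<Longrightarrow> y \<in> cross_section bc H \<Longrightarrow>
      ((\<lambda>x. \<phi>x t (x, y)) has_real_derivative \<phi>xx t (x, y)) (at x)"
    and \<phi>y: "\<And>t x y. t > 0 \<Longrightarrow> y \<in> cross_section bc H \<Longrightarrow>
      ((\<lambda>y. \<phi> t (x, y)) has_real_derivative \<phi>y t (x, y)) (at y within cross_section bc H)"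
    and \<phi>yy: "\<And>t x y. t > 0 \<Longrightarrow> y \<in> cross_section bc H \<Longrightarrow>
      ((\<lambda>y. \<phi>y t (x, y)) has_real_derivative \<phi>yy t (x, y)) (at y within cross_section bc H)"
    and u: "\<And>p. p \<in> domain bc H \<Longrightarrow> \<bar>fst (u p)\<bar> \<le> U"
    and ineq: "\<And>t p. t > 0 \<Longrightarrow> p \<in> domain bc H \<Longrightarrow>
      \<phi>t t p + (fst (u p) * \<phi>x t p + snd (u p) * \<phi>y t p) - \<kappa> * (\<phi>xx t p + \<phi>yy t p) \<le> c * \<phi> t p"
    and t: "t \<ge> 0" and p: "p \<in> domain bc H"
  shows "\<phi> t p \<le> M * exp (\<sigma> * fst p + (a * U + \<kappa> * a\<^sup>2 + c) * t)"
proof -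
  define b where "b = a * U + \<kappa> * a\<^sup>2 + c"
  define E where "E t p = M * exp (\<sigma> * fst p + b * t)" for t :: real and p :: "real \<times> real"
  have E: "E t p \<ge> 0" for t :: real and p :: "real \<times> real" using M by (simp add: E_def)
  have "0 \<le> E t p - \<phi> t p"
  proof (rule parabolic_max_principle[where w = "\<lambda>t p. E t p - \<phi> t p" and M = 1
        and wt = "\<lambda>t p. b * E t p - \<phi>t t p" and wx = "\<lambda>t p. \<sigma> * E t p - \<phi>x t p"
        and wxx = "\<lambda>t p. \<sigma>\<^sup>2 * E t p - \<phi>xx t p" and wy = "\<lambda>t p. - \<phi>y t p" and wyy = "\<lambda>t p. - \<phi>yy t p",
        OF H \<kappa> c _ _ _ _ _ _ _ _ _ _ u _ t p])
    show "continuous_on ({0..} \<times> domain bc H) (\<lambda>(t, p). E t p - \<phi> t p)"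
      unfolding E_def using cont by (auto simp: split_beta intro!: continuous_intros)
    show "0 \<le> E 0 p - \<phi> 0 p" if "p \<in> domain bc H" for p using init[OF that] by (simp add: E_def)
    show "- 1 \<le> E t p - \<phi> t p" if "t \<ge> 0" "p \<in> domain bc H" for t p
      using le1[OF that] E[of t p] by simp
    show "E t (x, y + H) - \<phi> t (x, y + H) = E t (x, y) - \<phi> t (x, y)" if "bc = Periodic" "0 \<le> t" for t x y
      using per[OF that] by (simp add: E_def)
    show "- \<phi>y t (x, 0) = 0 \<and> - \<phi>y t (x, H) = 0" if "bc = Neumann" "0 < t" for t x
      using neu[OF that] by simp
    show "((\<lambda>s. E s p - \<phi> s p) has_real_derivative b * E t p - \<phi>t t p) (at t)"
      if "t > 0" "p \<in> domain bc H" for t p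
      unfolding E_def by (auto intro!: derivative_eq_intros \<phi>t that)
    fix t x y :: real assume a: "t > 0" "y \<in> cross_section bc H"
    show "((\<lambda>x. E t (x, y) - \<phi> t (x, y)) has_real_derivative \<sigma> * E t (x, y) - \<phi>x t (x, y)) (at x)"
      unfolding E_def by (auto intro!: derivative_eq_intros \<phi>x a)
    show "((\<lambda>x. \<sigma> * E t (x, y) - \<phi>x t (x, y)) has_real_derivative \<sigma>\<^sup>2 * E t (x, y) - \<phi>xx t (x, y)) (at x)"
      unfolding E_def by (auto intro!: derivative_eq_intros \<phi>xx a simp: power2_eq_square)
    show "((\<lambda>y. E t (x, y) - \<phi> t (x, y)) has_real_derivative - \<phi>y t (x, y)) (at y within cross_section bc H)"
      unfolding E_def by (auto intro!: derivative_eq_intros \<phi>y a)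
    show "((\<lambda>y. - \<phi>y t (x, y)) has_real_derivative - \<phi>yy t (x, y)) (at y within cross_section bc H)"
      by (auto intro!: derivative_eq_intros \<phi>yy a)
  next
    fix t :: real and p assume tp: "0 < t" "p \<in> domain bc H"
    have "\<bar>fst (u p) * \<sigma>\<bar> \<le> U * a" using u[OF tp(2)] \<sigma> by (auto simp: abs_mult intro!: mult_mono)
    then have "b + fst (u p) * \<sigma> - \<kappa> * \<sigma>\<^sup>2 \<ge> c"
      using \<sigma> by (auto simp: b_def abs_le_iff mult.commute)
    then have "(b + fst (u p) * \<sigma> - \<kappa> * \<sigma>\<^sup>2) * E t p \<ge> c * E t p"
      using E by (intro mult_right_mono)
    then show "c * (E t p - \<phi> t p) \<le> b * E t p - \<phi>t t p +
        (fst (u p) * (\<sigma> * E t p - \<phi>x t p) + snd (u p) * - \<phi>y t p) -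
        \<kappa> * (\<sigma>\<^sup>2 * E t p - \<phi>xx t p + - \<phi>yy t p)"
      using ineq[OF tp] by (simp add: algebra_simps)
  qed
  then show ?thesis by (simp add: E_def b_def)
qed

section \<open>The time-dependent problem\<close>

locale combustion =
  fixes bc :: bdry_cond and \<kappa> v0 H U :: real and f :: "real \<Rightarrow> real"
    and u :: "real \<times> real \<Rightarrow> real \<times> real" and T0 :: "real \<times> real \<Rightarrow> real" and T :: "real \<Rightarrow> real \<times> real \<Rightarrow> real"
  assumes \<kappa>: "\<kappa> > 0" and v0: "v0 > 0" and H: "H > 0"
    and f: "reaction_term f"
    and U: "\<And>p. p \<in> domain bc H \<Longrightarrow> norm (u p) \<le> U"
    and T0: "initial_temperature bc H \<kappa> v0 f u T0"
    and T: "temperature bc H \<kappa> v0 f u T0 T"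
begin

abbreviation "S \<equiv> domain bc H"
abbreviation "D1 \<equiv> d1 (domain bc H)"
abbreviation "D2 \<equiv> d2 (domain bc H)"

lemma T_cont: "continuous_on ({0..} \<times> S) (\<lambda>(t, p). T t p)"
  and T_init: "p \<in> S \<Longrightarrow> T 0 p = T0 p"
  and T_range: "t \<ge> 0 \<Longrightarrow> p \<in> S \<Longrightarrow> 0 \<le> T t p" "t \<ge> 0 \<Longrightarrow> p \<in> S \<Longrightarrow> T t p \<le> 1"
  and T_bc: "t \<ge> 0 \<Longrightarrow> scalar_bc bc H (T t)"
  and T_C2: "t > 0 \<Longrightarrow> C2_on S (T t)"
  using T unfolding temperature_def by auto

lemma T_deriv: "t > 0 \<Longrightarrow> p \<in> S \<Longrightarrow> ((\<lambda>s. T s p) has_real_derivative deriv (\<lambda>s. T s p) t) (at t)"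
  using T unfolding temperature_def by (auto simp: DERIV_deriv_iff_real_differentiable)

lemma T_pde: "t > 0 \<Longrightarrow> p \<in> S \<Longrightarrow>
    deriv (\<lambda>s. T s p) t + (fst (u p) * D1 (T t) p + snd (u p) * D2 (T t) p)
      - \<kappa> * (D1 (D1 (T t)) p + D2 (D2 (T t)) p) = v0\<^sup>2 / \<kappa> * f (T t p)"
  using T unfolding temperature_def by (auto simp: grad_def inner_prod_def laplacian_def)

lemma T0_C2: "C2_on S T0"
  and T0_pde: "p \<in> S \<Longrightarrow> (fst (u p) * D1 T0 p + snd (u p) * D2 T0 p)
      - \<kappa> * (D1 (D1 T0) p + D2 (D2 T0) p) \<le> v0\<^sup>2 / \<kappa> * f (T0 p)"
  using T0 unfolding initial_temperature_def by (auto simp: grad_def inner_prod_def laplacian_def)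

lemma T0_range: "p \<in> S \<Longrightarrow> 0 \<le> T0 p" "p \<in> S \<Longrightarrow> T0 p \<le> 1"
  using T_range[of 0 p] T_init[of p] by auto

lemma per: "bc = Periodic \<Longrightarrow> t \<ge> 0 \<Longrightarrow> T t (x, y + H) = T t (x, y)"
  using T_bc[of t] by auto

lemma neu: "bc = Neumann \<Longrightarrow> t \<ge> 0 \<Longrightarrow> D2 (T t) (x, 0) = 0 \<and> D2 (T t) (x, H) = 0"
  using T_bc[of t] by auto

text \<open>The initial datum inherits the wall condition from \<open>T 0\<close>: the two agree on
  the domain, and derivatives taken within the domain see nothing else.\<close>

lemma neu0: "bc = Neumann \<Longrightarrow> D2 T0 (x, 0) = 0 \<and> D2 T0 (x, H) = 0"
proof -
  assume n: "bc = Neumann"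
  have "D2 T0 p = D2 (T 0) p" if "p \<in> S" for p
    by (rule partials_cong(2)[OF _ that]) (simp add: T_init)
  moreover have "(x, 0) \<in> S" "(x, H) \<in> S" using H n by (auto simp: strip_def)
  ultimately show ?thesis using neu[OF n, of 0] by simp
qed

lemma u1: "p \<in> S \<Longrightarrow> \<bar>fst (u p)\<bar> \<le> U"
  using order_trans[OF norm_fst_le[of "fst (u p)" "snd (u p)"]] U[of p] by simp

text \<open>The differential inequality makes \<open>T0\<close> a stationary subsolution. Where the
  difference is negative, the Lipschitz bound for \<open>f\<close> bounds the difference of the
  reaction terms from below by a multiple of the difference itself, as the maximum principle
  demands.\<close>

lemma T_ge_T0: assumes t: "t \<ge> 0" and p: "p \<in> S" shows "T0 p \<le> T t p"
proof -
  obtain Lf where Lf: "Lf \<ge> 0" "\<And>s t. s \<in> {0..1} \<Longrightarrow> t \<in> {0..1} \<Longrightarrow> \<bar>f s - f t\<bar> \<le> Lf * \<bar>s - t\<bar>"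
    using reaction_bounds[OF f] by metis
  define k where "k = v0\<^sup>2 / \<kappa>"
  define c where "c = k * Lf"
  have c: "c \<ge> 0" using \<kappa> Lf by (simp add: c_def k_def)
  have "0 \<le> T t p - T0 p"
  proof (rule parabolic_max_principle[where w = "\<lambda>t p. T t p - T0 p" and M = 1
        and wt = "\<lambda>t p. deriv (\<lambda>s. T s p) t" and wx = "\<lambda>t p. D1 (T t) p - D1 T0 p"
        and wxx = "\<lambda>t p. D1 (D1 (T t)) p - D1 (D1 T0) p" and wy = "\<lambda>t p. D2 (T t) p - D2 T0 p"
        and wyy = "\<lambda>t p. D2 (D2 (T t)) p - D2 (D2 T0) p",
        OF H less_imp_le[OF \<kappa>] c _ _ _ _ _ _ _ _ _ _ u1 _ t p])
    have "continuous_on ({0..} \<times> S) (\<lambda>q. T0 (snd q))"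
      by (rule continuous_on_compose2[OF C1_on_imp_continuous_on[OF C2_on_imp_C1_on[OF T0_C2]]])
         (auto intro: continuous_intros)
    then show "continuous_on ({0..} \<times> S) (\<lambda>(t, p). T t p - T0 p)"
      using T_cont by (auto simp: split_beta intro!: continuous_intros)
    show "0 \<le> T 0 p - T0 p" if "p \<in> S" for p using T_init[OF that] by simp
    show "- 1 \<le> T t p - T0 p" if "t \<ge> 0" "p \<in> S" for t p
      using T_range[OF that] T0_range[OF that(2)] by simp
    show "T t (x, y + H) - T0 (x, y + H) = T t (x, y) - T0 (x, y)" if "bc = Periodic" "0 \<le> t" for t x y
      using per[OF that] per[OF that(1), of 0] T_init that by simp
    show "D2 (T t) (x, 0) - D2 T0 (x, 0) = 0 \<and> D2 (T t) (x, H) - D2 T0 (x, H) = 0"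
      if "bc = Neumann" "0 < t" for t x
      using neu[OF that(1), of t] neu0[OF that(1)] that by simp
    show "((\<lambda>s. T s p - T0 p) has_real_derivative deriv (\<lambda>s. T s p) t) (at t)" if "t > 0" "p \<in> S" for t p
      using DERIV_diff[OF T_deriv[OF that] DERIV_const] by simp
    fix t x y :: real assume a: "t > 0" "y \<in> cross_section bc H"
    note s = C2_slices[OF H T_C2[OF a(1)] a(2)] and s0 = C2_slices[OF H T0_C2 a(2)]
    show "((\<lambda>x. T t (x, y) - T0 (x, y)) has_real_derivative D1 (T t) (x, y) - D1 T0 (x, y)) (at x)"
      by (intro DERIV_diff s s0)
    show "((\<lambda>x. D1 (T t) (x, y) - D1 T0 (x, y)) has_real_derivative
        D1 (D1 (T t)) (x, y) - D1 (D1 T0) (x, y)) (at x)" by (intro DERIV_diff s s0)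
    show "((\<lambda>y. T t (x, y) - T0 (x, y)) has_real_derivative D2 (T t) (x, y) - D2 T0 (x, y))
        (at y within cross_section bc H)" by (intro DERIV_diff s s0)
    show "((\<lambda>y. D2 (T t) (x, y) - D2 T0 (x, y)) has_real_derivative
        D2 (D2 (T t)) (x, y) - D2 (D2 T0) (x, y)) (at y within cross_section bc H)"
      by (intro DERIV_diff s s0)
  next
    fix t p assume tp: "0 < t" "p \<in> S" and neg: "T t p - T0 p < 0"
    have "\<bar>f (T t p) - f (T0 p)\<bar> \<le> Lf * \<bar>T t p - T0 p\<bar>"
      using T_range[of t p] T0_range[of p] tp by (intro Lf) auto
    then have "f (T t p) - f (T0 p) \<ge> Lf * (T t p - T0 p)"
      using neg by (simp add: abs_le_iff algebra_simps)
    then have "k * (f (T t p) - f (T0 p)) \<ge> k * (Lf * (T t p - T0 p))"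
      using \<kappa> by (intro mult_left_mono) (auto simp: k_def)
    then show "c * (T t p - T0 p) \<le> deriv (\<lambda>s. T s p) t +
        (fst (u p) * (D1 (T t) p - D1 T0 p) + snd (u p) * (D2 (T t) p - D2 T0 p)) -
        \<kappa> * (D1 (D1 (T t)) p - D1 (D1 T0) p + (D2 (D2 (T t)) p - D2 (D2 T0) p))"
      using T_pde[OF tp] T0_pde[OF tp(2)] by (simp add: c_def algebra_simps flip: k_def)
  qed
  then show ?thesis by simp
qed

text \<open>A time translate is again a solution, and \<open>T_ge_T0\<close> orders the two initial
  data.\<close>

lemma T_mono: assumes t: "t \<ge> 0" and s: "s \<ge> 0" and p: "p \<in> S" shows "T t p \<le> T (t + s) p"
proof -
  obtain Lf where Lf: "Lf \<ge> 0" "\<And>s t. s \<in> {0..1} \<Longrightarrow> t \<in> {0..1} \<Longrightarrow> \<bar>f s - f t\<bar> \<le> Lf * \<bar>s - t\<bar>"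
    using reaction_bounds[OF f] by metis
  define k where "k = v0\<^sup>2 / \<kappa>"
  define c where "c = k * Lf"
  have c: "c \<ge> 0" using \<kappa> Lf by (simp add: c_def k_def)
  have "0 \<le> T (t + s) p - T t p"
  proof (rule parabolic_max_principle[where w = "\<lambda>t p. T (t + s) p - T t p" and M = 1
        and wt = "\<lambda>t p. deriv (\<lambda>s. T s p) (t + s) - deriv (\<lambda>s. T s p) t"
        and wx = "\<lambda>t p. D1 (T (t + s)) p - D1 (T t) p"
        and wxx = "\<lambda>t p. D1 (D1 (T (t + s))) p - D1 (D1 (T t)) p"
        and wy = "\<lambda>t p. D2 (T (t + s)) p - D2 (T t) p"
        and wyy = "\<lambda>t p. D2 (D2 (T (t + s))) p - D2 (D2 (T t)) p",
        OF H less_imp_le[OF \<kappa>] c _ _ _ _ _ _ _ _ _ _ u1 _ t p])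
    have "continuous_on ({0..} \<times> S) (\<lambda>q. (\<lambda>(t, p). T t p) (fst q + s, snd q))"
      by (rule continuous_on_compose2[OF T_cont]) (use s in \<open>auto intro!: continuous_intros\<close>)
    then show "continuous_on ({0..} \<times> S) (\<lambda>(t, p). T (t + s) p - T t p)"
      using T_cont by (auto simp: split_beta intro!: continuous_intros)
    show "0 \<le> T (0 + s) p - T 0 p" if "p \<in> S" for p using T_init[OF that] T_ge_T0[OF s that] by simp
    show "- 1 \<le> T (t + s) p - T t p" if "t \<ge> 0" "p \<in> S" for t p
      using T_range[OF that] T_range[of "t + s" p] that s by simp
    show "T (t + s) (x, y + H) - T t (x, y + H) = T (t + s) (x, y) - T t (x, y)"
      if "bc = Periodic" "0 \<le> t" for t x y
      using per[OF that] per[OF that(1), of "t + s"] s that by simp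
    show "D2 (T (t + s)) (x, 0) - D2 (T t) (x, 0) = 0 \<and> D2 (T (t + s)) (x, H) - D2 (T t) (x, H) = 0"
      if "bc = Neumann" "0 < t" for t x
      using neu[OF that(1), of t] neu[OF that(1), of "t + s"] that s by simp
    show "((\<lambda>r. T (r + s) p - T r p) has_real_derivative
        deriv (\<lambda>s. T s p) (t + s) - deriv (\<lambda>s. T s p) t) (at t)" if "t > 0" "p \<in> S" for t p
      using T_deriv[of "t + s" p] s that
      by (intro DERIV_diff T_deriv that DERIV_shift[THEN iffD1]) auto
    fix t x y :: real assume a: "t > 0" "y \<in> cross_section bc H"
    have a': "t + s > 0" using a s by simp
    note s = C2_slices[OF H T_C2[OF a(1)] a(2)] and s0 = C2_slices[OF H T_C2[OF a'] a(2)]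
    show "((\<lambda>x. T (t + s) (x, y) - T t (x, y)) has_real_derivative D1 (T (t + s)) (x, y) - D1 (T t) (x, y)) (at x)"
      by (intro DERIV_diff s s0)
    show "((\<lambda>x. D1 (T (t + s)) (x, y) - D1 (T t) (x, y)) has_real_derivative
        D1 (D1 (T (t + s))) (x, y) - D1 (D1 (T t)) (x, y)) (at x)" by (intro DERIV_diff s s0)
    show "((\<lambda>y. T (t + s) (x, y) - T t (x, y)) has_real_derivative D2 (T (t + s)) (x, y) - D2 (T t) (x, y))
        (at y within cross_section bc H)" by (intro DERIV_diff s s0)
    show "((\<lambda>y. D2 (T (t + s)) (x, y) - D2 (T t) (x, y)) has_real_derivative
        D2 (D2 (T (t + s))) (x, y) - D2 (D2 (T t)) (x, y)) (at y within cross_section bc H)"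
      by (intro DERIV_diff s s0)
  next
    fix t p assume tp: "0 < t" "p \<in> S" and neg: "T (t + s) p - T t p < 0"
    have tp': "0 < t + s" using tp s by simp
    have "\<bar>f (T (t + s) p) - f (T t p)\<bar> \<le> Lf * \<bar>T (t + s) p - T t p\<bar>"
      using T_range[of t p] T_range[of "t + s" p] tp tp' by (intro Lf) auto
    then have "f (T (t + s) p) - f (T t p) \<ge> Lf * (T (t + s) p - T t p)"
      using neg by (simp add: abs_le_iff algebra_simps)
    then have "k * (f (T (t + s) p) - f (T t p)) \<ge> k * (Lf * (T (t + s) p - T t p))"
      using \<kappa> by (intro mult_left_mono) (auto simp: k_def)
    then show "c * (T (t + s) p - T t p) \<le> deriv (\<lambda>s. T s p) (t + s) - deriv (\<lambda>s. T s p) t +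
        (fst (u p) * (D1 (T (t + s)) p - D1 (T t) p) + snd (u p) * (D2 (T (t + s)) p - D2 (T t) p)) -
        \<kappa> * (D1 (D1 (T (t + s))) p - D1 (D1 (T t)) p + (D2 (D2 (T (t + s))) p - D2 (D2 (T t)) p))"
      using T_pde[OF tp] T_pde[OF tp' tp(2)] by (simp add: c_def algebra_simps flip: k_def)
  qed
  then show ?thesis by simp
qed

lemma time_derivative_nonneg:
  assumes t: "t > 0" and p: "p \<in> S" shows "0 \<le> deriv (\<lambda>s. T s p) t"
proof (rule ccontr)
  assume "\<not> ?thesis"
  then obtain d where d: "d > 0" "\<And>h. h > 0 \<Longrightarrow> h < d \<Longrightarrow> T (t + h) p < T t p"
    using has_real_derivative_neg_dec_right[OF T_deriv[OF t p]] by auto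
  then have "T (t + d/2) p < T t p" using d(2)[of "d/2"] by simp
  then show False using T_mono[of t "d/2" p] d(1) t p by simp
qed

text \<open>For \<open>T\<close> the barrier absorbs the reaction since \<open>f 0 = 0\<close> and
  \<open>f\<close> is Lipschitz; for \<open>1 - T\<close> the reaction has the favourable sign. The
  constant grows with \<open>t\<close>, which is harmless because \<open>t\<close> stays fixed from
  here on.\<close>

lemma exponential_decay:
  assumes t: "t > 0"
  obtains a M where "a > 0" "M \<ge> 0" "\<And>p. p \<in> S \<Longrightarrow> T t p \<le> M * exp (- a * fst p)"
    "\<And>p. p \<in> S \<Longrightarrow> 1 - T t p \<le> M * exp (a * fst p)"
proof -
  obtain Lf where Lf: "Lf \<ge> 0" "\<And>s t. s \<in> {0..1} \<Longrightarrow> t \<in> {0..1} \<Longrightarrow> \<bar>f s - f t\<bar> \<le> Lf * \<bar>s - t\<bar>"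
      "\<And>s. s \<in> {0..1} \<Longrightarrow> 0 \<le> f s"
    using reaction_bounds[OF f] by metis
  define c where "c = v0\<^sup>2 / \<kappa> * Lf"
  have c: "c \<ge> 0" using \<kappa> Lf by (simp add: c_def)
  have f0: "f 0 = 0" using f by (simp add: reaction_term_def)
  obtain a M0 where a: "a > 0" and M0: "\<And>x y. (x, y) \<in> strip H \<Longrightarrow> x < 0 \<Longrightarrow> \<bar>1 - T0 (x, y)\<bar> \<le> M0 * exp (a * x)"
    "\<And>x y. (x, y) \<in> strip H \<Longrightarrow> x > 0 \<Longrightarrow> \<bar>T0 (x, y)\<bar> \<le> M0 * exp (- a * x)"
    using T0 unfolding initial_temperature_def by fastforce
  \<comment> \<open>With \<open>M \<ge> 1\<close> the bounds hold trivially on the half line where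
    the exponential is at least 1.\<close>
  define M where "M = max M0 1"
  have M: "M \<ge> 1" by (simp add: M_def)
  have init: "T0 p \<le> M * exp (- a * fst p) \<and> 1 - T0 p \<le> M * exp (a * fst p)" if "p \<in> S" for p
  proof -
    obtain x y where p: "p = (x, y)" by (metis surj_pair)
    \<comment> \<open>Decay of \<open>T0\<close> is assumed on the strip only, hence the reduction
      to one period.\<close>
    have "\<exists>y'. (x, y') \<in> strip H \<and> T0 (x, y') = T0 (x, y)"
    proof (cases bc)
      case Neumann
      then show ?thesis using that p by auto
    next
      case Periodic
      obtain k :: int where k: "y + of_int k * H \<in> {0..H}" using period_representative[OF H] .
      have "T 0 (x, y + of_int k * H) = T 0 (x, y)"
        by (rule periodic_int_shift) (use per Periodic in auto)
      then show ?thesis using k T_init Periodic by (auto simp: strip_def)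
    qed
    then obtain y' where y': "(x, y') \<in> strip H" "T0 (x, y') = T0 (x, y)" by blast
    have le1: "1 \<le> M * exp r" if "r \<ge> 0" for r
      using mult_mono[of 1 M 1 "exp r"] M that by simp
    have leM: "M0 * exp r \<le> M * exp r" for r by (simp add: M_def)
    have ax: "a * x \<ge> 0" if "x \<ge> 0" using that a by simp
    have ax': "a * x \<le> 0" if "x \<le> 0" using that a by (simp add: mult_nonneg_nonpos)
    show ?thesis
    proof (cases "x > 0")
      case True
      have "T0 p \<le> M * exp (- a * x)" 
        using M0(2)[OF y'(1) True] leM[of "- a * x"] y'(2) unfolding p by linarith
      moreover have "1 - T0 p \<le> M * exp (a * x)" using T0_range[OF that] le1[of "a * x"] ax True by simp
      ultimately show ?thesis by (simp add: p)
    next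
      case False
      have "1 - T0 p \<le> M * exp (a * x)"
      proof (cases "x = 0")
        case True
        then show ?thesis using T0_range[OF that] le1[of 0] by simp
      next
        case nz: False
        then have "x < 0" using False by simp
        then show ?thesis 
          using M0(1)[OF y'(1)] leM[of "a * x"] y'(2) unfolding p by linarith
      qed
      moreover have "T0 p \<le> M * exp (- a * x)" using T0_range[OF that] le1[of "- a * x"] ax' False by simp
      ultimately show ?thesis by (simp add: p)
    qed
  qed
  define b where "b = a * U + \<kappa> * a\<^sup>2 + c"
  have A: "T t p \<le> M * exp (- a * fst p + b * t)" if "p \<in> S" for p
    unfolding b_def
  proof (rule exp_barrier[where \<phi> = T and \<phi>t = "\<lambda>t p. deriv (\<lambda>s. T s p) t" and \<phi>x = "\<lambda>t. D1 (T t)"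
        and \<phi>xx = "\<lambda>t. D1 (D1 (T t))" and \<phi>y = "\<lambda>t. D2 (T t)" and \<phi>yy = "\<lambda>t. D2 (D2 (T t))",
        OF H less_imp_le[OF \<kappa>] c _ _ T_cont per _ _ T_range(2) T_deriv _ _ _ _ u1 _ less_imp_le[OF t] that])
    show "deriv (\<lambda>s. T s p) t + (fst (u p) * D1 (T t) p + snd (u p) * D2 (T t) p)
        - \<kappa> * (D1 (D1 (T t)) p + D2 (D2 (T t)) p) \<le> c * T t p" if "t > 0" "p \<in> S" for t p
    proof -
      have "f (T t p) \<le> Lf * T t p" using Lf(2)[of "T t p" 0] T_range[of t p] that by (simp add: f0)
      then have "v0\<^sup>2 / \<kappa> * f (T t p) \<le> v0\<^sup>2 / \<kappa> * (Lf * T t p)" using \<kappa> by (intro mult_left_mono) auto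
      then show ?thesis using T_pde[OF that] by (simp add: c_def)
    qed
  qed (use M a init T_init neu C2_slices[OF H T_C2] in auto)
  have B: "1 - T t p \<le> M * exp (a * fst p + b * t)" if "p \<in> S" for p
    unfolding b_def
  proof (rule exp_barrier[where \<phi> = "\<lambda>t p. 1 - T t p" and \<phi>t = "\<lambda>t p. - deriv (\<lambda>s. T s p) t"
        and \<phi>x = "\<lambda>t p. - D1 (T t) p"
        and \<phi>xx = "\<lambda>t p. - D1 (D1 (T t)) p" and \<phi>y = "\<lambda>t p. - D2 (T t) p" and \<phi>yy = "\<lambda>t p. - D2 (D2 (T t)) p",
        OF H less_imp_le[OF \<kappa>] c _ _ _ _ _ _ _ _ _ _ _ _ u1 _ less_imp_le[OF t] that])
    show "- deriv (\<lambda>s. T s p) t + (fst (u p) * - D1 (T t) p + snd (u p) * - D2 (T t) p)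
        - \<kappa> * (- D1 (D1 (T t)) p + - D2 (D2 (T t)) p) \<le> c * (1 - T t p)" if "t > 0" "p \<in> S" for t p
    proof -
      have "f (T t p) \<ge> 0" using Lf(3)[of "T t p"] T_range[of t p] that by simp
      then have "v0\<^sup>2 / \<kappa> * f (T t p) \<ge> 0" using \<kappa> by simp
      moreover have "c * (1 - T t p) \<ge> 0" using c T_range[of t p] that by simp
      ultimately show ?thesis using T_pde[OF that] by (simp add: algebra_simps)
    qed
    show "continuous_on ({0..} \<times> S) (\<lambda>(t, p). 1 - T t p)"
      using T_cont by (auto simp: split_beta intro!: continuous_intros)
    show "((\<lambda>s. 1 - T s p) has_real_derivative - deriv (\<lambda>s. T s p) t) (at t)" if "t > 0" "p \<in> S" for t p
      using DERIV_diff[OF DERIV_const T_deriv[OF that]] by simp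
    fix t x y :: real assume a: "t > 0" "y \<in> cross_section bc H"
    note s = C2_slices[OF H T_C2[OF a(1)] a(2), of x]
    show "((\<lambda>x. 1 - T t (x, y)) has_real_derivative - D1 (T t) (x, y)) (at x)"
      using DERIV_diff[OF DERIV_const s(1)] by simp
    show "((\<lambda>x. - D1 (T t) (x, y)) has_real_derivative - D1 (D1 (T t)) (x, y)) (at x)"
      by (intro DERIV_minus s)
    show "((\<lambda>y. 1 - T t (x, y)) has_real_derivative - D2 (T t) (x, y)) (at y within cross_section bc H)"
      using DERIV_diff[OF DERIV_const s(3)] by simp
    show "((\<lambda>y. - D2 (T t) (x, y)) has_real_derivative - D2 (D2 (T t)) (x, y)) (at y within cross_section bc H)"
      by (intro DERIV_minus s)
  qed (use M a init T_init neu per T_range in auto)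
  show thesis
  proof (rule that[of a "M * exp (b * t)"])
    show "T t p \<le> M * exp (b * t) * exp (- a * fst p)" if "p \<in> S" for p
      using A[OF that] by (simp add: mult.assoc mult_exp_exp add.commute)
    show "1 - T t p \<le> M * exp (b * t) * exp (a * fst p)" if "p \<in> S" for p
      using B[OF that] by (simp add: mult.assoc mult_exp_exp add.commute)
  qed (use a M in auto)
qed

end

section \<open>Mass and energy identities\<close>

text \<open>On an interval inside \<open>(0, 1)\<close> the function \<open>f\<close> is at least
  half of one of its positive values, and \<open>g\<close> is a normalised bump there. This lower
  bound is what permits \<open>g\<^sup>2 \<le> c * f\<close>. All constants are merged into one
  \<open>c\<close> determined by \<open>f\<close> alone.\<close>

lemma reaction_cutoff:
  assumes f: "reaction_term f"
  obtains \<alpha> \<beta> c and g g' G :: "real \<Rightarrow> real" where "0 < \<alpha>" "\<alpha> < \<beta>" "\<beta> < 1" "c > 0"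
    "\<And>s. s \<in> {0..1} \<Longrightarrow> (G has_real_derivative g s) (at s)"
    "\<And>s. (g has_real_derivative g' s) (at s)" "continuous_on UNIV g'"
    "\<And>s. s \<in> {0..\<alpha>} \<Longrightarrow> G s = 0" "\<And>s. s \<in> {\<beta>..1} \<Longrightarrow> G s = 1"
    "\<And>s. 0 \<le> g s" "\<And>s. s \<notin> {\<alpha>..\<beta>} \<Longrightarrow> g s = 0" "\<And>s. s \<in> {0..1} \<Longrightarrow> (g s)\<^sup>2 \<le> c * f s"
    "\<And>s. s \<in> {0..1} \<Longrightarrow> g s \<le> c" "\<And>s. s \<in> {0..1} \<Longrightarrow> \<bar>g' s\<bar> \<le> c"
proof -
  obtain cf: "continuous_on {0..1} f" and f_nonneg: "\<And>s. s \<in> {0..1} \<Longrightarrow> 0 \<le> f s"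
    using reaction_bounds[OF f] by metis
  obtain s0 where s0: "s0 \<in> {0..1}" "f s0 \<noteq> 0" using f unfolding reaction_term_def by blast
  have s0': "0 < s0" "s0 < 1"
    using s0 f unfolding reaction_term_def by (auto simp: less_le)
  have fs0: "f s0 > 0" using f_nonneg[OF s0(1)] s0(2) by simp
  define m where "m = f s0 / 2"
  have m: "m > 0" using fs0 by (simp add: m_def)
  obtain d where d: "d > 0" "\<And>s. s \<in> {0..1} \<Longrightarrow> dist s s0 < d \<Longrightarrow> dist (f s) (f s0) < m"
    using cf s0(1) m unfolding continuous_on_iff by metis
  \<comment> \<open>Half distances keep \<open>{\<alpha>..\<beta>}\<close> strictly inside
    \<open>(0, 1)\<close> and inside the neighbourhood where \<open>f\<close> stays above
    \<open>m\<close>.\<close>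
  define r where "r = min (d/2) (min (s0/2) ((1 - s0)/2))"
  have r: "r > 0" "r \<le> d/2" "r \<le> s0/2" "r \<le> (1-s0)/2"
    using d(1) s0' by (auto simp: r_def min_def)
  define \<alpha> where "\<alpha> = s0 - r"
  define \<beta> where "\<beta> = s0 + r"
  have ab: "0 < \<alpha>" "\<alpha> < \<beta>" "\<beta> < 1" using r s0' by (auto simp: \<alpha>_def \<beta>_def)
  have fm: "f s \<ge> m" if "s \<in> {\<alpha>..\<beta>}" for s
  proof -
    have "dist s s0 < d" "s \<in> {0..1}" using that r d(1) ab by (auto simp: \<alpha>_def \<beta>_def dist_real_def)
    then have "\<bar>f s - f s0\<bar> < m" using d(2) by (simp add: dist_real_def)
    then show ?thesis unfolding m_def abs_less_iff by argo
  qed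
  define q where "q s = (s - \<alpha>) * (\<beta> - s)" for s :: real
  define p where "p s = (max 0 (q s))\<^sup>2" for s
  define p' where "p' s = 2 * max 0 (q s) * (\<alpha> + \<beta> - 2 * s)" for s
  have q': "(q has_real_derivative \<alpha> + \<beta> - 2 * s) (at s)" for s
    unfolding q_def by (auto intro!: derivative_eq_intros simp: algebra_simps)
  have p': "(p has_real_derivative p' s) (at s)" for s
    unfolding p_def p'_def by (rule DERIV_chain2[OF max_zero_square_has_derivative q'])
  have contp: "continuous_on A p" for A
    using p' by (meson DERIV_isCont continuous_at_imp_continuous_on)
  have contp': "continuous_on A p'" for A unfolding p'_def q_def by (intro continuous_intros)
  have p0: "p s = 0" if "s \<notin> {\<alpha><..<\<beta>}" for s
  proof -
    have "q s \<le> 0" using that ab unfolding q_def mult_le_0_iff by auto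
    then show ?thesis by (simp add: p_def max_def)
  qed
  \<comment> \<open>Starting at -1 makes 0 an interior point of the range of integration, so that
    \<open>P\<close> has two-sided derivatives on all of \<open>{0..1}\<close>.\<close>
  define P where "P s = integral {-1..s} p" for s
  have P': "(P has_real_derivative p s) (at s)" if "s \<in> {0..1}" for s
  proof -
    have "(P has_real_derivative p s) (at s within {-1..2})"
      unfolding P_def by (rule integral_has_real_derivative[OF contp]) (use that in auto)
    moreover have "s \<in> interior {-1..2}" using that by auto
    ultimately show ?thesis by (metis at_within_interior)
  qed
  have P0: "P s = 0" if "s \<in> {0..\<alpha>}" for s
  proof -
    have "integral {-1..s} p = integral {-1..s} (\<lambda>_. 0)" by (rule integral_cong) (use that p0 in auto)
    then show ?thesis by (simp add: P_def)
  qed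
  have P1: "P s = P \<beta>" if "s \<in> {\<beta>..1}" for s
  proof -
    have "integral {\<beta>..s} p = integral {\<beta>..s} (\<lambda>_. 0)" by (rule integral_cong) (use that p0 in auto)
    moreover have "integral {-1..\<beta>} p + integral {\<beta>..s} p = integral {-1..s} p"
      by (rule Henstock_Kurzweil_Integration.integral_combine)
         (use that ab contp in \<open>auto intro: integrable_continuous_real\<close>)
    ultimately show ?thesis by (simp add: P_def)
  qed
  have "\<exists>z>\<alpha>. z < \<beta> \<and> P \<beta> - P \<alpha> = (\<beta> - \<alpha>) * p z"
    by (rule MVT2[OF ab(2)]) (use P' ab in auto)
  then obtain z where z: "\<alpha> < z" "z < \<beta>" "P \<beta> - P \<alpha> = (\<beta> - \<alpha>) * p z" by blast
  have "q z > 0" using z by (simp add: q_def)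
  then have N: "P \<beta> > 0" using z(3) P0[of \<alpha>] ab by (simp add: p_def)
  have "compact (p ` {0..1})" "compact (p' ` {0..1})"
    by (intro compact_continuous_image contp contp' compact_Icc)+
  then have "bounded (p ` {0..1})" "bounded (p' ` {0..1})" by (auto intro: compact_imp_bounded)
  then obtain B1 B2 where "\<forall>x\<in>p ` {0..1}. norm x \<le> B1" "\<forall>x\<in>p' ` {0..1}. norm x \<le> B2"
    unfolding bounded_iff by metis
  then have B: "\<And>s. s \<in> {0..1} \<Longrightarrow> \<bar>p s\<bar> \<le> B1" "\<And>s. s \<in> {0..1} \<Longrightarrow> \<bar>p' s\<bar> \<le> B2" by auto
  have B0: "0 \<le> B1" "0 \<le> B2" using B[of 0] by auto
  define N where "N = P \<beta>"
  have N: "N > 0" using N by (simp add: N_def)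
  \<comment> \<open>The summands bound \<open>g\<close>, its derivative and the quotient of
    \<open>g\<^sup>2\<close> by \<open>m\<close> in turn; the 1 ensures positivity.\<close>
  define c where "c = B1 / N + B2 / N + (B1 / N)\<^sup>2 / m + 1"
  show thesis
  proof (rule that[of \<alpha> \<beta> c "\<lambda>s. P s / N" "\<lambda>s. p s / N" "\<lambda>s. p' s / N"])
    show c: "c > 0" using B0 N m by (auto simp: c_def intro!: add_nonneg_pos add_nonneg_nonneg)
    show "((\<lambda>s. P s / N) has_real_derivative p s / N) (at s)" if "s \<in> {0..1}" for s
      by (intro DERIV_cdivide P' that)
    show "((\<lambda>s. p s / N) has_real_derivative p' s / N) (at s)" for s
      by (intro DERIV_cdivide p')
    show "continuous_on UNIV (\<lambda>s. p' s / N)" by (intro continuous_intros contp') (use N in auto)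
    show "0 \<le> p s / N" for s using N by (simp add: p_def)
    show "P s / N = 1" if "s \<in> {\<beta>..1}" for s using P1[OF that] N by (simp add: N_def)
    have le: "B1 / N \<le> c" "B2 / N \<le> c" "(B1 / N)\<^sup>2 / m \<le> c"
      using B0 N m by (auto simp: c_def)
    show "p s / N \<le> c" if "s \<in> {0..1}" for s
      using divide_right_mono[OF order_trans[OF abs_ge_self B(1)[OF that]], of N] N le(1) by simp
    show "\<bar>p' s / N\<bar> \<le> c" if "s \<in> {0..1}" for s
      using divide_right_mono[OF B(2)[OF that], of N] N le(2) by simp
    show "(p s / N)\<^sup>2 \<le> c * f s" if "s \<in> {0..1}" for s
    proof (cases "s \<in> {\<alpha>..\<beta>}")
      case True
      have "(p s / N)\<^sup>2 \<le> (B1 / N)\<^sup>2"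
        using divide_right_mono[OF B(1)[OF that], of N] N
        by (intro power_mono) (auto simp: p_def)
      also have "\<dots> = (B1 / N)\<^sup>2 / m * m" using m by simp
      also have "\<dots> \<le> c * f s" using le(3) fm[OF True] m c by (intro mult_mono) auto
      finally show ?thesis .
    next
      case False
      then have "p s = 0" using p0[of s] by auto
      then show ?thesis using f_nonneg[OF that] c by simp
    qed
  qed (use ab P0 p0 in auto)
qed

lemma real_le_add_inverse_imp_le:
  fixes x A C R0 :: real
  assumes "\<And>R. R \<ge> R0 \<Longrightarrow> x \<le> A + C / R"
  shows "x \<le> A"
proof (rule tendsto_lowerbound)
  have "((\<lambda>R. A + C / R) \<longlongrightarrow> A + 0) at_top"
    by (intro tendsto_add tendsto_const real_tendsto_divide_at_top[OF tendsto_const filterlim_ident])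
  then show "((\<lambda>R. A + C / R) \<longlongrightarrow> A) at_top" by simp
  show "\<forall>\<^sub>F R in at_top. x \<le> A + C / R"
    using eventually_ge_at_top[of R0] by (rule eventually_mono) (rule assms)
qed simp

text \<open>An algebraic weight replaces the exponentials: it covers both half lines at once, and
  through \<open>arctan\<close> its integral has a bound free of \<open>R\<close>.\<close>

lemma integral_inverse_one_plus_square_box:
  assumes "R \<ge> 0" "H \<ge> 0"
  shows "integral (cbox (-R, 0) (R, H)) (\<lambda>p::real \<times> real. 1 / (1 + (fst p)\<^sup>2)) \<le> H * pi"
proof -
  have nz: "1 + x\<^sup>2 \<noteq> 0" for x :: real by (metis add_pos_nonneg less_irrefl zero_le_power2 zero_less_one)
  have "integral (cbox (-R, 0) (R, H)) (\<lambda>p::real \<times> real. 1 / (1 + (fst p)\<^sup>2) + (\<lambda>_. 0) p)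
    = integral {0..H} (\<lambda>y. arctan (fst (R, y)) - arctan (fst (-R, y))) + integral {-R..R} (\<lambda>x. (\<lambda>_. 0) (x, H) - (\<lambda>_. 0) (x, 0))"
  proof (rule integral_divergence_box[where ?X1.0 = "\<lambda>p. arctan (fst p)" and ?X2.0 = "\<lambda>_. 0"])
    show "((\<lambda>x. arctan (fst (x, y))) has_real_derivative 1 / (1 + (fst (x, y))\<^sup>2)) (at x within {- R..R})" for x y :: real
      using DERIV_arctan[of x] by (auto intro: DERIV_subset simp: inverse_eq_divide)
    show "continuous_on (cbox (- R, 0) (R, H)) (\<lambda>p. 1 / (1 + (fst p)\<^sup>2))"
      by (intro continuous_intros) (use nz in auto)
  qed (use assms in auto)
  also have "\<dots> = H * (2 * arctan R)" using assms by (simp add: arctan_minus)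
  also have "\<dots> \<le> H * pi" using assms arctan_ubound[of R] by (intro mult_left_mono) auto
  finally show ?thesis by simp
qed

section \<open>The temperature profile at one fixed time\<close>

locale front =
  fixes bc :: bdry_cond and \<kappa> v0 H U M :: real and f :: "real \<Rightarrow> real"
    and u :: "real \<times> real \<Rightarrow> real \<times> real" and \<theta> :: "real \<times> real \<Rightarrow> real"
  assumes \<kappa>: "\<kappa> > 0" and v0: "v0 > 0" and H: "H > 0"
    and f: "reaction_term f"
    and u_C1: "C1_on (domain bc H) u"
    and div_free: "\<And>p. p \<in> domain bc H \<Longrightarrow> divergence (domain bc H) u p = 0"
    and mean_zero: "\<And>x. integral {0..H} (\<lambda>y. fst (u (x, y))) = 0"
    and u_bc: "flow_bc bc H u"
    and U: "\<And>p. p \<in> domain bc H \<Longrightarrow> norm (u p) \<le> U"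
    and C2: "C2_on (domain bc H) \<theta>"
    and range: "\<And>p. p \<in> domain bc H \<Longrightarrow> 0 \<le> \<theta> p" "\<And>p. p \<in> domain bc H \<Longrightarrow> \<theta> p \<le> 1"
    and \<theta>_bc: "scalar_bc bc H \<theta>"
    and decay: "\<And>x y. (x, y) \<in> domain bc H \<Longrightarrow> x \<ge> 0 \<Longrightarrow> \<theta> (x, y) \<le> M / (1 + x\<^sup>2)"
      "\<And>x y. (x, y) \<in> domain bc H \<Longrightarrow> x \<le> 0 \<Longrightarrow> 1 - \<theta> (x, y) \<le> M / (1 + x\<^sup>2)"
    and \<tau>_nonneg': "\<And>p. p \<in> domain bc H \<Longrightarrow> u p \<bullet> grad (domain bc H) \<theta> p
      \<le> \<kappa> * laplacian (domain bc H) \<theta> p + v0\<^sup>2 / \<kappa> * f (\<theta> p)"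
begin

abbreviation "S \<equiv> domain bc H"
abbreviation "D1 \<equiv> d1 (domain bc H)"
abbreviation "D2 \<equiv> d2 (domain bc H)"
abbreviation "u1 \<equiv> (\<lambda>q. fst (u q))"
abbreviation "u2 \<equiv> (\<lambda>q. snd (u q))"
abbreviation cell :: "real \<Rightarrow> (real \<times> real) set" where "cell R \<equiv> cbox (- R, 0) (R, H)"

definition "F p = v0\<^sup>2 / \<kappa> * f (\<theta> p)"
definition "E p = (D1 \<theta> p)\<^sup>2 + (D2 \<theta> p)\<^sup>2"
text \<open>The time derivative, expressed by the equation through the spatial profile;
  \<open>\<tau>_nonneg'\<close> is monotonicity in time in this form.\<close>

definition "\<tau> p = \<kappa> * (D1 (D1 \<theta>) p + D2 (D2 \<theta>) p) + F p - (u1 p * D1 \<theta> p + u2 p * D2 \<theta> p)"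

lemma \<tau>_nonneg: "p \<in> S \<Longrightarrow> 0 \<le> \<tau> p"
  using \<tau>_nonneg'[of p] by (simp add: \<tau>_def F_def grad_def inner_prod_def laplacian_def)

lemma F_nonneg: "p \<in> S \<Longrightarrow> 0 \<le> F p"
  using reaction_bounds[OF f] range[of p] \<kappa> unfolding F_def
  by (metis atLeastAtMost_iff divide_nonneg_pos mult_nonneg_nonneg zero_le_power2)

lemma E_nonneg: "0 \<le> E p" by (simp add: E_def)

lemma div_free': "p \<in> S \<Longrightarrow> D1 u1 p + D2 u2 p = 0"
  using div_free[of p] by (simp add: divergence_def)

lemma M_pos: "M > 0"
proof -
  have "(0, 0) \<in> S" using strip_subset_domain[of H bc] H by (auto simp: strip_def)
  from decay[OF this] show ?thesis by simp
qed

lemma u_partials_C1: "C1_on S u1" "C1_on S u2"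
  by (intro C1_on_bounded_linear[OF _ u_C1] bounded_linear_intros)+

lemma continuous_facts:
  shows cont_\<theta>: "continuous_on S \<theta>" and cont_D1: "continuous_on S (D1 \<theta>)" and cont_D2: "continuous_on S (D2 \<theta>)"
    and cont_D11: "continuous_on S (D1 (D1 \<theta>))" and cont_D22: "continuous_on S (D2 (D2 \<theta>))"
    and cont_u1: "continuous_on S u1" and cont_u2: "continuous_on S u2"
    and cont_D1u: "continuous_on S (D1 u1)" and cont_D2u: "continuous_on S (D2 u2)"
    and cont_F: "continuous_on S F" and cont_E: "continuous_on S E" and cont_\<tau>: "continuous_on S \<tau>"
proof -
  note S = two_dim_at_points_domain[OF H, of bc]
  note C1 = C2_on_imp_C1_on[OF C2] and P = C2_on_partials_C1_on[OF S C2]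
  show c0: "continuous_on S \<theta>" by (rule C1_on_imp_continuous_on[OF C1])
  show c1: "continuous_on S (D1 \<theta>)" "continuous_on S (D2 \<theta>)" by (rule C1_on_imp_continuous_on[OF P(1)] C1_on_imp_continuous_on[OF P(2)])+
  show c2: "continuous_on S (D1 (D1 \<theta>))" "continuous_on S (D2 (D2 \<theta>))"
    by (rule C1_on_continuous_d1[OF S P(1)] C1_on_continuous_d2[OF S P(2)])+
  show c3: "continuous_on S u1" "continuous_on S u2"
    by (rule C1_on_imp_continuous_on[OF u_partials_C1(1)] C1_on_imp_continuous_on[OF u_partials_C1(2)])+
  show "continuous_on S (D1 u1)" "continuous_on S (D2 u2)"
    by (rule C1_on_continuous_d1[OF S u_partials_C1(1)] C1_on_continuous_d2[OF S u_partials_C1(2)])+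
  obtain cf: "continuous_on {0..1} f" using reaction_bounds[OF f] by metis
  have "continuous_on S (\<lambda>p. f (\<theta> p))"
    by (rule continuous_on_compose2[OF cf c0]) (use range in auto)
  then show c4: "continuous_on S F" unfolding F_def by (intro continuous_intros)
  show "continuous_on S E" unfolding E_def by (intro continuous_intros c1)
  show "continuous_on S \<tau>" unfolding \<tau>_def by (intro continuous_intros c1 c2 c3 c4)
qed

lemma cell_subset: "cell R \<subseteq> S"
  using strip_subset_domain[of H bc] by (auto simp: strip_def cbox_Pair_eq)

lemma integrable_cell: "continuous_on S k \<Longrightarrow> k integrable_on cell R"
  for k :: "real \<times> real \<Rightarrow> real"
  by (rule integrable_continuous) (rule continuous_on_subset[OF _ cell_subset])

lemma \<theta>_slices:
  assumes y: "y \<in> cross_section bc H"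
  shows "((\<lambda>x. \<theta> (x, y)) has_real_derivative D1 \<theta> (x, y)) (at x within A)"
    and "((\<lambda>x. D1 \<theta> (x, y)) has_real_derivative D1 (D1 \<theta>) (x, y)) (at x within A)"
    and "B \<subseteq> cross_section bc H \<Longrightarrow> ((\<lambda>y. \<theta> (x, y)) has_real_derivative D2 \<theta> (x, y)) (at y within B)"
    and "B \<subseteq> cross_section bc H \<Longrightarrow> ((\<lambda>y. D2 \<theta> (x, y)) has_real_derivative D2 (D2 \<theta>) (x, y)) (at y within B)"
  using C2_slices[OF H C2 y, of x] by (auto intro: DERIV_subset has_field_derivative_at_within)

lemma strip_cross_section: "{0..H} \<subseteq> cross_section bc H" by (cases bc) auto

text \<open>The cutoff vanishes to second order at \<open>x = \<plusminus>R\<close>, so that integrations by parts over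
  \<open>cell R\<close> leave no boundary terms there.\<close>

definition "\<zeta> R p = (1 - (fst p)\<^sup>2 / R\<^sup>2)\<^sup>2" for R :: real and p :: "real \<times> real"
definition "\<zeta>x R p = - 4 * fst p / R\<^sup>2 * (1 - (fst p)\<^sup>2 / R\<^sup>2)" for R :: real and p :: "real \<times> real"
definition "\<zeta>xx R p = - 4 / R\<^sup>2 + 12 * (fst p)\<^sup>2 / R^4" for R :: real and p :: "real \<times> real"

text \<open>\<open>G\<close> is the primitive of \<open>g\<close> along \<theta>, so the transport
  term is the divergence of \<open>G\<close> times \<open>u\<close>, and the Laplacian can be moved
  onto \<open>\<zeta> R\<close>, leaving the good term with \<open>E\<close>. The choices
  \<open>(1, 0)\<close> and \<open>(0, 1)\<close> of \<open>(\<alpha>, \<beta>)\<close> give the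
  mass and the energy balance from one computation.\<close>

lemma cutoff_identity:
  fixes \<alpha> \<beta> R :: real
  assumes R: "R > 0"
  defines "g \<equiv> \<lambda>p. \<alpha> + \<beta> * \<theta> p" and "G \<equiv> \<lambda>p. \<alpha> * \<theta> p + \<beta> / 2 * (\<theta> p)\<^sup>2"
  shows "integral (cell R) (\<lambda>p. \<zeta> R p * g p * (\<tau> p - F p)) + \<kappa> * \<beta> * integral (cell R) (\<lambda>p. \<zeta> R p * E p)
    = \<kappa> * integral (cell R) (\<lambda>p. \<zeta>xx R p * G p) + integral (cell R) (\<lambda>p. \<zeta>x R p * u1 p * G p)"
proof -
  note cont = continuous_on_subset[OF cont_\<theta> cell_subset] continuous_on_subset[OF cont_D1 cell_subset]
    continuous_on_subset[OF cont_D2 cell_subset] continuous_on_subset[OF cont_D11 cell_subset]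
    continuous_on_subset[OF cont_D22 cell_subset] continuous_on_subset[OF cont_u1 cell_subset]
    continuous_on_subset[OF cont_u2 cell_subset] continuous_on_subset[OF cont_D1u cell_subset]
    continuous_on_subset[OF cont_D2u cell_subset] continuous_on_subset[OF cont_F cell_subset]
    continuous_on_subset[OF cont_E cell_subset] continuous_on_subset[OF cont_\<tau> cell_subset]
  have c\<zeta>: "continuous_on A (\<zeta> R)" "continuous_on A (\<zeta>x R)" "continuous_on A (\<zeta>xx R)" for A
    unfolding \<zeta>_def \<zeta>x_def \<zeta>xx_def by (intro continuous_intros; use R in simp)+
  have cG: "continuous_on (cell R) G" "continuous_on (cell R) g" unfolding G_def g_def by (intro continuous_intros cont)+
  have d\<zeta>: "((\<lambda>x. \<zeta> R (x, y)) has_real_derivative \<zeta>x R (x, y)) (at x within A)"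
    "((\<lambda>x. \<zeta>x R (x, y)) has_real_derivative \<zeta>xx R (x, y)) (at x within A)" for x y A
    unfolding \<zeta>_def \<zeta>x_def \<zeta>xx_def using R
    by (auto intro!: derivative_eq_intros simp: field_simps power2_eq_square power4_eq_xxxx)
  \<comment> \<open>The field is \<kappa> (\<zeta> g grad \<theta> - G grad \<zeta>) - \<zeta> G u,
    where \<zeta> depends on \<open>x\<close> only; \<open>Y1\<close> and \<open>Y2\<close> are the
    partial derivatives of its components.\<close>
  define X1 where "X1 p = \<kappa> * (\<zeta> R p * g p * D1 \<theta> p - \<zeta>x R p * G p) - \<zeta> R p * G p * u1 p" for p
  define X2 where "X2 p = \<kappa> * (\<zeta> R p * g p * D2 \<theta> p) - \<zeta> R p * G p * u2 p" for p
  define Y1 where "Y1 p = \<kappa> * (\<zeta> R p * g p * D1 (D1 \<theta>) p + \<zeta> R p * \<beta> * (D1 \<theta> p)\<^sup>2 - \<zeta>xx R p * G p)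
     - \<zeta>x R p * G p * u1 p - \<zeta> R p * g p * D1 \<theta> p * u1 p - \<zeta> R p * G p * D1 u1 p" for p
  define Y2 where "Y2 p = \<kappa> * (\<zeta> R p * g p * D2 (D2 \<theta>) p + \<zeta> R p * \<beta> * (D2 \<theta> p)\<^sup>2)
     - \<zeta> R p * g p * D2 \<theta> p * u2 p - \<zeta> R p * G p * D2 u2 p" for p
  have "integral (cell R) (\<lambda>p. Y1 p + Y2 p) =
      integral {0..H} (\<lambda>y. X1 (R, y) - X1 (- R, y)) + integral {- R..R} (\<lambda>x. X2 (x, H) - X2 (x, 0))"
  proof (rule integral_divergence_box)
    fix x y assume xy: "x \<in> {- R..R}" "y \<in> {0..H}"
    then have y: "y \<in> cross_section bc H" using strip_cross_section by blast
    note s = \<theta>_slices(1,2)[OF y] C1_slices(1)[OF H u_partials_C1(1) y] d\<zeta>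
      and s' = \<theta>_slices(3,4)[OF y strip_cross_section] C1_slices(2)[OF H u_partials_C1(2) y strip_cross_section]
    define c where "c = \<zeta> R (x, 0)"
    have z: "\<zeta> R (x, y) = c" for y by (simp add: \<zeta>_def c_def)
    show "((\<lambda>x. X1 (x, y)) has_real_derivative Y1 (x, y)) (at x within {- R..R})"
      unfolding X1_def Y1_def G_def g_def
      by (rule derivative_eq_intros s refl | simp)+ (simp add: algebra_simps power2_eq_square)
    show "((\<lambda>y. X2 (x, y)) has_real_derivative Y2 (x, y)) (at y within {0..H})"
      unfolding X2_def Y2_def G_def g_def z
      by (rule derivative_eq_intros s' refl | simp)+ (simp add: algebra_simps power2_eq_square)
  next
    show "continuous_on (cell R) Y1" "continuous_on (cell R) Y2" unfolding Y1_def Y2_def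
      by (intro continuous_intros cont c\<zeta> cG)+
  qed (use R H in auto)
  moreover have "X1 (R, y) - X1 (- R, y) = 0" for y
    using R by (simp add: X1_def \<zeta>_def \<zeta>x_def)
  \<comment> \<open>Neumann walls carry no flux; in the periodic case the fluxes at the two heights
    are equal.\<close>
  moreover have "X2 (x, H) - X2 (x, 0) = 0" for x
  proof (cases bc)
    case Neumann
    then show ?thesis using u_bc \<theta>_bc by (simp add: X2_def)
  next
    case Periodic
    have "\<theta> (x, H) = \<theta> (x, 0)" "u (x, H) = u (x, 0)" 
      using u_bc \<theta>_bc Periodic by (metis add_0 flow_bc.simps(2) scalar_bc.simps(2))+
    moreover have "D2 \<theta> (x, H) = D2 \<theta> (x, 0)"
    proof -
      have "((\<lambda>y. \<theta> (x, y + H)) has_real_derivative D2 \<theta> (x, H)) (at 0)"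
        using C2_slices(3)[OF H C2, of H x] Periodic DERIV_shift[of "\<lambda>y. \<theta> (x, y)" "D2 \<theta> (x, H)" 0 H] by simp
      moreover have "((\<lambda>y. \<theta> (x, y)) has_real_derivative D2 \<theta> (x, 0)) (at 0)"
        using C2_slices(3)[OF H C2, of 0 x] Periodic by simp
      ultimately show ?thesis using \<theta>_bc Periodic DERIV_unique by simp
    qed
    ultimately show ?thesis by (simp add: X2_def \<zeta>_def g_def G_def)
  qed
  ultimately have "integral (cell R) (\<lambda>p. Y1 p + Y2 p) = 0" by simp
  moreover have "integral (cell R) (\<lambda>p. Y1 p + Y2 p) = integral (cell R) (\<lambda>p. \<zeta> R p * g p * (\<tau> p - F p)
     + \<kappa> * \<beta> * (\<zeta> R p * E p) - \<kappa> * (\<zeta>xx R p * G p) - \<zeta>x R p * u1 p * G p)"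
  proof (rule integral_cong)
    fix p assume "p \<in> cell R"
    then have "D1 u1 p = - D2 u2 p" using div_free'[of p] cell_subset by fastforce
    then show "Y1 p + Y2 p = \<zeta> R p * g p * (\<tau> p - F p)
     + \<kappa> * \<beta> * (\<zeta> R p * E p) - \<kappa> * (\<zeta>xx R p * G p) - \<zeta>x R p * u1 p * G p"
      unfolding Y1_def Y2_def \<tau>_def E_def by (simp add: algebra_simps)
  qed
  moreover have "\<dots> = integral (cell R) (\<lambda>p. \<zeta> R p * g p * (\<tau> p - F p))
     + \<kappa> * \<beta> * integral (cell R) (\<lambda>p. \<zeta> R p * E p) - \<kappa> * integral (cell R) (\<lambda>p. \<zeta>xx R p * G p)
     - integral (cell R) (\<lambda>p. \<zeta>x R p * u1 p * G p)"
    by (subst integral_diff integral_add integral_mult_right;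
        (intro integrable_continuous continuous_intros cont c\<zeta> cG)?)+ simp
  ultimately show ?thesis by linarith
qed

end

lemma abs_integral_le:
  fixes f g :: "'a::euclidean_space \<Rightarrow> real"
  assumes "f integrable_on A" "g integrable_on A" "\<And>x. x \<in> A \<Longrightarrow> \<bar>f x\<bar> \<le> g x"
  shows "\<bar>integral A f\<bar> \<le> integral A g"
  using integral_norm_bound_integral[OF assms(1,2)] assms(3) by simp

context front begin

lemma cutoff_bounds:
  assumes R: "R > 0" and p: "p \<in> cell R"
  shows "0 \<le> \<zeta> R p" "\<zeta> R p \<le> 1" "\<bar>\<zeta>x R p\<bar> \<le> 4 / R" "\<bar>\<zeta>xx R p\<bar> \<le> 8 / R\<^sup>2"
    "\<bar>fst p\<bar> \<le> R / 2 \<Longrightarrow> 1 \<le> 2 * \<zeta> R p"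
proof -
  define s where "s = (fst p)\<^sup>2 / R\<^sup>2"
  have x: "\<bar>fst p\<bar> \<le> R" using p by (auto simp: cbox_Pair_eq)
  then have "(fst p)\<^sup>2 \<le> R\<^sup>2" using R by (metis abs_le_square_iff abs_of_pos)
  then have s: "0 \<le> s" "s \<le> 1" using R by (auto simp: s_def)
  show "0 \<le> \<zeta> R p" by (simp add: \<zeta>_def)
  show "\<zeta> R p \<le> 1" using s by (simp add: \<zeta>_def power_le_one flip: s_def)
  have "\<bar>\<zeta>x R p\<bar> = 4 * \<bar>fst p\<bar> / R\<^sup>2 * (1 - s)"
    using s by (simp add: \<zeta>x_def abs_mult flip: s_def)
  also have "\<dots> \<le> 4 * R / R\<^sup>2 * 1"
    using x s R by (intro mult_mono divide_right_mono) auto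
  also have "\<dots> = 4 / R" using R by (simp add: power2_eq_square)
  finally show "\<bar>\<zeta>x R p\<bar> \<le> 4 / R" .
  have "\<zeta>xx R p = (- 4 + 12 * s) / R\<^sup>2"
    using R by (simp add: \<zeta>xx_def s_def field_simps power2_eq_square power4_eq_xxxx)
  then show "\<bar>\<zeta>xx R p\<bar> \<le> 8 / R\<^sup>2" using s R by (simp add: abs_le_iff divide_right_mono)
  \<comment> \<open>On this half of the cell the cutoff is at least 9/16.\<close>
  assume "\<bar>fst p\<bar> \<le> R / 2"
  then have "(fst p)\<^sup>2 \<le> (R / 2)\<^sup>2" using R by (metis abs_le_square_iff abs_of_pos half_gt_zero)
  then have "s \<le> 1/4" using R by (simp add: s_def field_simps power2_eq_square)
  then have "(3/4)\<^sup>2 \<le> (1 - s)\<^sup>2" by (intro power_mono) auto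
  then have "1 \<le> 2 * (1 - s)\<^sup>2" by (simp add: power2_eq_square)
  then show "1 \<le> 2 * \<zeta> R p" by (simp add: \<zeta>_def flip: s_def)
qed

lemma cutoff_continuous:
  assumes "R > 0" shows "continuous_on A (\<zeta> R)" "continuous_on A (\<zeta>x R)" "continuous_on A (\<zeta>xx R)"
  unfolding \<zeta>_def \<zeta>x_def \<zeta>xx_def by (intro continuous_intros; use assms in simp)+

lemma U_nonneg: "U \<ge> 0"
proof -
  have "(0, 0) \<in> S" using strip_subset_domain[of H bc] H by (auto simp: strip_def)
  from order_trans[OF norm_ge_zero U[OF this]] show ?thesis .
qed

lemma integral_weight_cell:
  assumes "R > 0" shows "integral (cell R) (\<lambda>p. 1 / (1 + (fst p)\<^sup>2)) \<le> H * pi"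
  using integral_inverse_one_plus_square_box[of R H] assms H by simp

lemma weight_continuous: "continuous_on A (\<lambda>p::real \<times> real. 1 / (1 + (fst p)\<^sup>2))"
proof -
  have nz: "1 + x\<^sup>2 \<noteq> 0" for x :: real by (metis add_pos_nonneg less_irrefl zero_le_power2 zero_less_one)
  show ?thesis by (intro continuous_intros) (use nz in auto)
qed

text \<open>Diffusion: \<kappa> times \<open>8 / R\<^sup>2\<close> times the area
  \<open>2 * R * H\<close>. Transport: \<open>4 / R * U * M\<close> times the integral of the
  weight, at most \<open>H * pi\<close>. The common factor \<open>1 / R\<close> is left out.\<close>

definition "err = 16 * \<kappa> * H + 4 * U * M * H * pi"

text \<open>The transport term is of size \<open>1 / R\<close> on a cell of area proportional to
  \<open>R\<close>, so sizes alone give no decay; the approach of \<open>G\<close> to its limits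
  does. The condition \<open>\<alpha> + \<beta> \<le> 1\<close> yields
  \<open>0 \<le> G \<le> \<theta>\<close> and, for the other end, a distance of at most
  \<open>1 - \<theta>\<close> to the limit.\<close>

lemma cutoff_error:
  fixes \<alpha> \<beta> R :: real
  assumes R: "R \<ge> 1" and ab: "\<alpha> \<ge> 0" "\<beta> \<ge> 0" "\<alpha> + \<beta> \<le> 1"
  defines "G \<equiv> \<lambda>p. \<alpha> * \<theta> p + \<beta> / 2 * (\<theta> p)\<^sup>2"
  shows "\<bar>\<kappa> * integral (cell R) (\<lambda>p. \<zeta>xx R p * G p) + integral (cell R) (\<lambda>p. \<zeta>x R p * u1 p * G p)\<bar>
    \<le> err / R"
proof -
  have R0: "R > 0" using R by simp
  note c\<zeta> = cutoff_continuous[OF R0]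
  have cG: "continuous_on (cell R) G" unfolding G_def
    by (intro continuous_intros continuous_on_subset[OF cont_\<theta> cell_subset])
  have cu: "continuous_on (cell R) u1" by (rule continuous_on_subset[OF cont_u1 cell_subset])
  have sq: "(\<theta> p)\<^sup>2 \<le> \<theta> p" if "p \<in> S" for p
    using range[OF that] by (simp add: power2_eq_square mult_left_le)
  have G0: "0 \<le> G p" if "p \<in> S" for p using ab range[OF that] by (simp add: G_def)
  have Gle: "G p \<le> \<theta> p" if "p \<in> S" for p
  proof -
    have "G p \<le> \<alpha> * \<theta> p + \<beta> * \<theta> p"
      using mult_left_mono[OF sq[OF that] ab(2)] mult_nonneg_nonneg[OF ab(2) range(1)[OF that]]
      by (simp add: G_def)
    also have "\<dots> \<le> 1 * \<theta> p" 
      using mult_right_mono[OF ab(3) range(1)[OF that]] by (simp add: algebra_simps)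
    finally show ?thesis by simp
  qed
  have G1: "\<bar>G p - (\<alpha> + \<beta> / 2)\<bar> \<le> 1 - \<theta> p" if "p \<in> S" for p
  proof -
    have "\<beta> * (\<theta> p)\<^sup>2 \<le> \<beta> * 1" using range[OF that] ab by (intro mult_left_mono) (auto intro: power_le_one)
    moreover have "\<alpha> * \<theta> p \<le> \<alpha> * 1" using range[OF that] ab by (intro mult_left_mono) auto
    ultimately have 1: "G p \<le> \<alpha> + \<beta> / 2" by (simp add: G_def)
    have "(\<alpha> + \<beta> / 2) - G p = (1 - \<theta> p) * (\<alpha> + \<beta> * ((1 + \<theta> p) / 2))"
      by (simp add: G_def field_simps power2_eq_square)
    also have "\<dots> \<le> (1 - \<theta> p) * (\<alpha> + \<beta> * 1)"
      using range[OF that] ab by (intro mult_left_mono add_mono) auto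
    also have "\<dots> \<le> (1 - \<theta> p) * 1" using range[OF that] ab by (intro mult_left_mono) auto
    finally show ?thesis using 1 by simp
  qed
  have "\<bar>integral (cell R) (\<lambda>p. \<zeta>xx R p * G p)\<bar> \<le> integral (cell R) (\<lambda>p. 8 / R\<^sup>2)"
  proof (rule abs_integral_le)
    show "(\<lambda>p. \<zeta>xx R p * G p) integrable_on cell R"
      by (intro integrable_continuous continuous_intros c\<zeta> cG)
    fix p assume p: "p \<in> cell R"
    then have pS: "p \<in> S" using cell_subset by blast
    have "\<bar>G p\<bar> \<le> 1" using G0[OF pS] Gle[OF pS] range[OF pS] by simp
    then show "\<bar>\<zeta>xx R p * G p\<bar> \<le> 8 / R\<^sup>2"
      using mult_mono[OF cutoff_bounds(4)[OF R0 p], of "\<bar>G p\<bar>" 1] by (simp add: abs_mult)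
  qed (rule integrable_const)
  also have "\<dots> = 16 * H / R"
    using R0 H by (simp add: content_Pair power2_eq_square field_simps)
  finally have 1: "\<bar>\<kappa> * integral (cell R) (\<lambda>p. \<zeta>xx R p * G p)\<bar> \<le> 16 * \<kappa> * H / R"
    using \<kappa> mult_left_mono[of "\<bar>integral (cell R) (\<lambda>p. \<zeta>xx R p * G p)\<bar>" "16 * H / R" \<kappa>]
    by (simp add: abs_mult mult_ac)
  \<comment> \<open>Left of the origin \<open>G\<close> tends to \<open>\<alpha> + \<beta> / 2\<close>; this part is removed by the zero mean of \<open>u1\<close>.\<close>
  define k where "k p = - 4 * min (fst p) 0 / R\<^sup>2 * (1 - (fst p)\<^sup>2 / R\<^sup>2) * (\<alpha> + \<beta> / 2)" for p :: "real \<times> real"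
  have ck: "continuous_on A k" for A unfolding k_def by (intro continuous_intros) (use R0 in auto)
  have "integral (cell R) (\<lambda>p. k p * u1 p) = integral {-R..R} (\<lambda>x. integral {0..H} (\<lambda>y. k (x, y) * u1 (x, y)))"
    using integral_prod_continuous[of "-R" 0 R H "\<lambda>p. k p * u1 p"] ck cu by (simp add: continuous_on_mult)
  also have "\<dots> = integral {-R..R} (\<lambda>x. k (x, 0) * integral {0..H} (\<lambda>y. u1 (x, y)))"
    by (simp add: k_def)
  also have "\<dots> = 0" using mean_zero by simp
  finally have k0: "integral (cell R) (\<lambda>p. k p * u1 p) = 0" .
  have "\<bar>integral (cell R) (\<lambda>p. \<zeta>x R p * u1 p * G p - k p * u1 p)\<bar>
      \<le> integral (cell R) (\<lambda>p. 4 / R * U * M * (1 / (1 + (fst p)\<^sup>2)))"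
  proof (rule abs_integral_le)
    show "(\<lambda>p. \<zeta>x R p * u1 p * G p - k p * u1 p) integrable_on cell R"
      by (intro integrable_continuous continuous_intros c\<zeta> cG cu ck)
    show "(\<lambda>p. 4 / R * U * M * (1 / (1 + (fst p)\<^sup>2))) integrable_on cell R"
      by (intro integrable_continuous continuous_on_mult continuous_on_const weight_continuous)
    fix p assume p: "p \<in> cell R"
    then have pS: "p \<in> S" using cell_subset by blast
    obtain x y where xy: "p = (x, y)" by (metis surj_pair)
    define J where "J = (if x < 0 then \<alpha> + \<beta> / 2 else 0)"
    have "k p = \<zeta>x R p * J" by (simp add: k_def \<zeta>x_def xy J_def min_def)
    then have "\<zeta>x R p * u1 p * G p - k p * u1 p = \<zeta>x R p * (u1 p * (G p - J))"
      by (simp add: algebra_simps)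
    moreover have "\<bar>\<zeta>x R p * (u1 p * (G p - J))\<bar> \<le> 4 / R * (U * (M / (1 + x\<^sup>2)))"
      unfolding abs_mult
    proof (intro mult_mono cutoff_bounds(3)[OF R0 p])
      show "\<bar>u1 p\<bar> \<le> U" using order_trans[OF norm_fst_le[of "u1 p" "u2 p"]] U[OF pS] by simp
      show "\<bar>G p - J\<bar> \<le> M / (1 + x\<^sup>2)"
        using decay[of x y] Gle[OF pS] G0[OF pS] G1[OF pS] pS by (auto simp: J_def xy)
    qed (use U_nonneg R0 M_pos in auto)
    ultimately show "\<bar>\<zeta>x R p * u1 p * G p - k p * u1 p\<bar> \<le> 4 / R * U * M * (1 / (1 + (fst p)\<^sup>2))"
      by (simp add: xy mult_ac)
  qed
  also have "\<dots> \<le> 4 / R * U * M * (H * pi)"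
    unfolding integral_mult_right
    by (rule mult_left_mono[OF integral_weight_cell[OF R0]]) (use U_nonneg R0 M_pos in simp)
  finally have "\<bar>integral (cell R) (\<lambda>p. \<zeta>x R p * u1 p * G p) - integral (cell R) (\<lambda>p. k p * u1 p)\<bar>
      \<le> 4 * U * M * H * pi / R"
    by (subst integral_diff[symmetric]; (intro integrable_continuous continuous_intros c\<zeta> cG cu ck)?)
       (simp add: mult_ac)
  then have 2: "\<bar>integral (cell R) (\<lambda>p. \<zeta>x R p * u1 p * G p)\<bar> \<le> 4 * U * M * H * pi / R" using k0 by simp
  have "err / R = 16 * \<kappa> * H / R + 4 * U * M * H * pi / R" by (simp add: err_def add_divide_distrib)
  then show ?thesis using 1 2 by linarith
qed

lemma continuous_on_cell: "continuous_on S k \<Longrightarrow> continuous_on (cell R) k"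
  using continuous_on_subset[OF _ cell_subset] .

lemma cell_mono: "r \<le> R \<Longrightarrow> cell r \<subseteq> cell R"
  unfolding cbox_Pair_eq cbox_interval by auto

lemma integral_cell_le_cutoff:
  fixes k :: "real \<times> real \<Rightarrow> real"
  assumes r: "r > 0" and R: "2 * r \<le> R" and c: "continuous_on S k" and k: "\<And>p. p \<in> S \<Longrightarrow> 0 \<le> k p"
  shows "integral (cell r) k \<le> 2 * integral (cell R) (\<lambda>p. \<zeta> R p * k p)"
proof -
  have R0: "R > 0" using r R by simp
  have i: "(\<lambda>p. 2 * (\<zeta> R p * k p)) integrable_on cell A" for A
    by (intro integrable_continuous continuous_intros cutoff_continuous[OF R0] continuous_on_cell c)
  have sub: "cell r \<subseteq> cell R" using r R by (intro cell_mono) simp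
  have "integral (cell r) k \<le> integral (cell r) (\<lambda>p. 2 * (\<zeta> R p * k p))"
  proof (rule integral_le[OF integrable_cell[OF c] i])
    fix p assume p: "p \<in> cell r"
    then have "\<bar>fst p\<bar> \<le> R / 2" using R by (auto simp: cbox_Pair_eq)
    then have "1 \<le> 2 * \<zeta> R p" using cutoff_bounds(5)[OF R0] p sub by blast
    moreover have "0 \<le> k p" using k p cell_subset by blast
    ultimately show "k p \<le> 2 * (\<zeta> R p * k p)"
      using mult_right_mono[of 1 "2 * \<zeta> R p" "k p"] by simp
  qed
  also have "\<dots> \<le> integral (cell R) (\<lambda>p. 2 * (\<zeta> R p * k p))"
  proof (rule integral_subset_le[OF sub i i], intro ballI)
    fix p assume p: "p \<in> cell R"
    then have "0 \<le> k p" using k cell_subset by blast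
    then show "0 \<le> 2 * (\<zeta> R p * k p)" using cutoff_bounds(1)[OF R0 p] by simp
  qed
  finally show ?thesis by simp
qed

lemma mass_identity:
  assumes R: "R \<ge> 1"
  shows "\<bar>integral (cell R) (\<lambda>p. \<zeta> R p * \<tau> p) - integral (cell R) (\<lambda>p. \<zeta> R p * F p)\<bar> \<le> err / R"
proof -
  have R0: "R > 0" using R by simp
  have "integral (cell R) (\<lambda>p. \<zeta> R p * \<tau> p) - integral (cell R) (\<lambda>p. \<zeta> R p * F p)
     = integral (cell R) (\<lambda>p. \<zeta> R p * (1 + 0 * \<theta> p) * (\<tau> p - F p)) + \<kappa> * 0 * integral (cell R) (\<lambda>p. \<zeta> R p * E p)"
    by (subst integral_diff[symmetric]; (intro integrable_continuous continuous_intros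
          cutoff_continuous[OF R0] continuous_on_cell cont_F cont_\<tau>)?) (simp add: algebra_simps)
  then show ?thesis using cutoff_identity[OF R0, of 1 0] cutoff_error[OF R, of 1 0] by simp
qed

text \<open>Monotonicity in time enters here: the term with \<open>- \<theta> * \<tau>\<close> is
  dropped, and \<open>\<theta> * F \<le> F\<close>.\<close>

lemma energy_inequality:
  assumes R: "R \<ge> 1"
  shows "\<kappa> * integral (cell R) (\<lambda>p. \<zeta> R p * E p) \<le> integral (cell R) (\<lambda>p. \<zeta> R p * F p) + err / R"
proof -
  have R0: "R > 0" using R by simp
  note c = cutoff_continuous[OF R0] continuous_on_cell[OF cont_F] continuous_on_cell[OF cont_\<tau>] continuous_on_cell[OF cont_\<theta>]
  have "\<kappa> * integral (cell R) (\<lambda>p. \<zeta> R p * E p)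
      \<le> integral (cell R) (\<lambda>p. - (\<zeta> R p * \<theta> p * (\<tau> p - F p))) + err / R"
    using cutoff_identity[OF R0, of 0 1] cutoff_error[OF R, of 0 1] by simp
  also have "integral (cell R) (\<lambda>p. - (\<zeta> R p * \<theta> p * (\<tau> p - F p))) \<le> integral (cell R) (\<lambda>p. \<zeta> R p * F p)"
  proof (rule integral_le)
    fix p assume p: "p \<in> cell R"
    then have pS: "p \<in> S" using cell_subset by blast
    have "- (\<theta> p * (\<tau> p - F p)) \<le> \<theta> p * F p" using \<tau>_nonneg[OF pS] range[OF pS] by (simp add: algebra_simps)
    also have "\<dots> \<le> F p" using range[OF pS] F_nonneg[OF pS] by (simp add: mult_left_le_one_le)
    finally show "- (\<zeta> R p * \<theta> p * (\<tau> p - F p)) \<le> \<zeta> R p * F p"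
      using mult_left_mono[OF _ cutoff_bounds(1)[OF R0 p]] by (simp add: mult.assoc flip: mult_minus_right)
  qed (intro integrable_continuous continuous_intros c)+
  finally show ?thesis by simp
qed

text \<open>\<open>f\<close> is Lipschitz and vanishes at both ends, so it is small wherever
  \<theta> is near 0 or near 1. This makes the total reaction finite.\<close>

lemma F_weight_bound:
  obtains B where "B \<ge> 0" "\<And>p. p \<in> S \<Longrightarrow> F p \<le> B * (1 / (1 + (fst p)\<^sup>2))"
proof -
  obtain Lf where Lf: "Lf \<ge> 0" "\<And>s t. s \<in> {0..1} \<Longrightarrow> t \<in> {0..1} \<Longrightarrow> \<bar>f s - f t\<bar> \<le> Lf * \<bar>s - t\<bar>"
    using reaction_bounds[OF f] by metis
  have f01: "f 0 = 0" "f 1 = 0" using f by (auto simp: reaction_term_def)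
  have k: "v0\<^sup>2 / \<kappa> \<ge> 0" using \<kappa> by simp
  have "F p \<le> v0\<^sup>2 / \<kappa> * (Lf * M) * (1 / (1 + (fst p)\<^sup>2))" if p: "p \<in> S" for p
  proof -
    obtain x y where xy: "p = (x, y)" by (metis surj_pair)
    have "f (\<theta> p) \<le> Lf * (M / (1 + x\<^sup>2))"
    proof (cases "x \<ge> 0")
      case True
      have "f (\<theta> p) \<le> Lf * \<theta> p" using Lf(2)[of "\<theta> p" 0] range[OF p] by (simp add: f01)
      also have "\<dots> \<le> Lf * (M / (1 + x\<^sup>2))" using decay(1)[of x y] p True Lf(1) by (intro mult_left_mono) (auto simp: xy)
      finally show ?thesis .
    next
      case False
      have "f (\<theta> p) \<le> Lf * (1 - \<theta> p)" using Lf(2)[of "\<theta> p" 1] range[OF p] by (simp add: f01)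
      also have "\<dots> \<le> Lf * (M / (1 + x\<^sup>2))" using decay(2)[of x y] p False Lf(1) by (intro mult_left_mono) (auto simp: xy)
      finally show ?thesis .
    qed
    from mult_left_mono[OF this k] show ?thesis by (simp add: F_def xy mult_ac)
  qed
  then show thesis
    using that[OF mult_nonneg_nonneg[OF k mult_nonneg_nonneg[OF Lf(1) less_imp_le[OF M_pos]]]] by blast
qed

lemma err_nonneg: "err \<ge> 0"
  using \<kappa> H U_nonneg M_pos by (auto simp: err_def intro!: add_nonneg_nonneg mult_nonneg_nonneg)

definition "Q = integral (strip H) \<tau>"

text \<open>Truncated integrals of \<tau> are bounded through the mass balance by those of
  \<open>F\<close>; as \<open>\<tau> \<ge> 0\<close>, monotone convergence yields integrability. The
  bound depends on \<open>M\<close> and serves only to show that \<open>Q\<close> is a genuine,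
  finite integral.\<close>

lemma \<tau>_integrable: "\<tau> integrable_on strip H"
  and \<tau>_cell_le: "integral (cell R) \<tau> \<le> Q"
proof -
  obtain B where B: "B \<ge> 0" "\<And>p. p \<in> S \<Longrightarrow> F p \<le> B * (1 / (1 + (fst p)\<^sup>2))" using F_weight_bound by blast
  have bnd: "integral (cell r) \<tau> \<le> 2 * (B * (H * pi) + err)" if r: "r \<ge> 1" for r
  proof -
    define R where "R = 2 * r"
    have R: "R \<ge> 1" "R > 0" using r by (auto simp: R_def)
    have "integral (cell R) (\<lambda>p. \<zeta> R p * F p) \<le> integral (cell R) (\<lambda>p. B * (1 / (1 + (fst p)\<^sup>2)))"
    proof (rule integral_le)
      show "(\<lambda>p. \<zeta> R p * F p) integrable_on cell R"
        by (intro integrable_continuous continuous_intros cutoff_continuous[OF R(2)] continuous_on_cell cont_F)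
      show "(\<lambda>p. B * (1 / (1 + (fst p)\<^sup>2))) integrable_on cell R"
        by (intro integrable_continuous continuous_on_mult continuous_on_const weight_continuous)
      fix p assume p: "p \<in> cell R"
      then have pS: "p \<in> S" using cell_subset by blast
      have "\<zeta> R p * F p \<le> 1 * F p" by (intro mult_right_mono cutoff_bounds(2)[OF R(2) p] F_nonneg[OF pS])
      then show "\<zeta> R p * F p \<le> B * (1 / (1 + (fst p)\<^sup>2))" using B(2)[OF pS] by simp
    qed
    also have "\<dots> \<le> B * (H * pi)"
      unfolding integral_mult_right by (rule mult_left_mono[OF integral_weight_cell[OF R(2)] B(1)])
    finally have "integral (cell R) (\<lambda>p. \<zeta> R p * \<tau> p) \<le> B * (H * pi) + err / R"
      using mass_identity[OF R(1)] by linarith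
    moreover have "err / R \<le> err" using R err_nonneg by (simp add: divide_le_eq mult_left_le_one_le mult_le_cancel_left1)
    moreover have "integral (cell r) \<tau> \<le> 2 * integral (cell R) (\<lambda>p. \<zeta> R p * \<tau> p)"
      by (rule integral_cell_le_cutoff[OF _ _ cont_\<tau> \<tau>_nonneg]) (use r in \<open>auto simp: R_def\<close>)
    ultimately show ?thesis by argo
  qed
  define k where "k n p = (if p \<in> cell (real n) then \<tau> p else 0)" for n :: nat and p
  have cell_strip: "cell r \<subseteq> strip H" for r by (auto simp: strip_def cbox_Pair_eq)
  have k_int: "integral (strip H) (k n) = integral (cell (real n)) \<tau>" and k_intble: "k n integrable_on strip H" for n
    using has_integral_restrict[OF cell_strip[of "real n"], of \<tau>]
      integrable_integral[OF integrable_cell[OF cont_\<tau>, of "real n"]]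
    unfolding k_def by (auto simp: integrable_on_def intro: integral_unique)
  have mono: "integral (cell r) \<tau> \<le> integral (cell R) \<tau>" if "r \<le> R" for r R
    by (rule integral_subset_le[OF cell_mono[OF that] integrable_cell[OF cont_\<tau>] integrable_cell[OF cont_\<tau>]])
       (use \<tau>_nonneg cell_subset in blast)
  have "\<tau> integrable_on strip H \<and> (\<lambda>n. integral (strip H) (k n)) \<longlonglongrightarrow> integral (strip H) \<tau>"
  proof (rule monotone_convergence_increasing)
    show "k n integrable_on strip H" for n by (rule k_intble)
    show "k n p \<le> k (Suc n) p" if "p \<in> strip H" for n p
      using that strip_subset_domain[of H bc] cell_mono[of "real n" "real (Suc n)"] \<tau>_nonneg[of p]
      by (auto simp: k_def)
    show "(\<lambda>n. k n p) \<longlonglongrightarrow> \<tau> p" if "p \<in> strip H" for p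
    proof (rule tendsto_eventually)
      obtain N :: nat where N: "\<bar>fst p\<bar> \<le> real N" using real_arch_simple by blast
      show "\<forall>\<^sub>F n in sequentially. k n p = \<tau> p"
        using eventually_ge_at_top[of N]
        by eventually_elim (use N that in \<open>auto simp: k_def strip_def cbox_Pair_eq\<close>)
    qed
    show "bounded (Set.range (\<lambda>n. integral (strip H) (k n)))"
    proof (rule boundedI[of _ "2 * (B * (H * pi) + err)"])
      fix z assume "z \<in> Set.range (\<lambda>n. integral (strip H) (k n))"
      then obtain n where z: "z = integral (cell (real n)) \<tau>" by (auto simp: k_int)
      have "0 \<le> z" unfolding z
        by (rule Henstock_Kurzweil_Integration.integral_nonneg[OF integrable_cell[OF cont_\<tau>]])
           (use \<tau>_nonneg cell_subset in blast)
      moreover have "z \<le> 2 * (B * (H * pi) + err)"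
        unfolding z using mono[of "real n" "max 1 (real n)"] bnd[of "max 1 (real n)"] by simp
      ultimately show "norm z \<le> 2 * (B * (H * pi) + err)" by simp
    qed
  qed
  then show i: "\<tau> integrable_on strip H" by blast
  show "integral (cell R) \<tau> \<le> Q" unfolding Q_def
    by (rule integral_subset_le[OF cell_strip integrable_cell[OF cont_\<tau>] i])
       (use \<tau>_nonneg strip_subset_domain in blast)
qed

lemma Q_nonneg: "Q \<ge> 0"
  unfolding Q_def
  by (rule Henstock_Kurzweil_Integration.integral_nonneg[OF \<tau>_integrable])
     (use \<tau>_nonneg strip_subset_domain in blast)

lemma cutoff_F_le:
  assumes R: "R \<ge> 1" shows "integral (cell R) (\<lambda>p. \<zeta> R p * F p) \<le> Q + err / R"
proof -
  have R0: "R > 0" using R by simp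
  have "integral (cell R) (\<lambda>p. \<zeta> R p * \<tau> p) \<le> integral (cell R) \<tau>"
  proof (rule integral_le[OF _ integrable_cell[OF cont_\<tau>]])
    show "(\<lambda>p. \<zeta> R p * \<tau> p) integrable_on cell R"
      by (intro integrable_continuous continuous_intros cutoff_continuous[OF R0] continuous_on_cell cont_\<tau>)
    show "\<zeta> R p * \<tau> p \<le> \<tau> p" if "p \<in> cell R" for p
      using mult_right_mono[OF cutoff_bounds(2)[OF R0 that], of "\<tau> p"] \<tau>_nonneg[of p] cell_subset that by auto
  qed
  then show ?thesis using mass_identity[OF R] \<tau>_cell_le[of R] by linarith
qed

text \<open>\<open>r\<close> is fixed while \<open>R\<close> tends to infinity, which removes
  \<open>err / R\<close>; the factor 2 comes from \<open>1 \<le> 2 * \<zeta> R p\<close> on the half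
  cell.\<close>

lemma F_cell_le: "integral (cell r) F \<le> 2 * Q"
proof -
  have *: "integral (cell r) F \<le> 2 * Q" if r: "r > 0" for r
  proof (rule real_le_add_inverse_imp_le[where ?R0.0 = "max 1 (2 * r)" and C = "2 * err"])
    fix R assume R: "max 1 (2 * r) \<le> R"
    have "integral (cell r) F \<le> 2 * integral (cell R) (\<lambda>p. \<zeta> R p * F p)"
      by (rule integral_cell_le_cutoff[OF r _ cont_F F_nonneg]) (use R in auto)
    then show "integral (cell r) F \<le> 2 * Q + 2 * err / R" using cutoff_F_le[of R] R by simp
  qed
  moreover have "integral (cell r) F \<le> integral (cell (max r 1)) F"
    by (rule integral_subset_le[OF cell_mono[OF max.cobounded1] integrable_cell[OF cont_F] integrable_cell[OF cont_F]])
       (use F_nonneg cell_subset in blast)+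
  moreover have "0 < max r 1" by simp
  ultimately show ?thesis using *[of "max r 1"] by linarith
qed

lemma E_cell_le: "\<kappa> * integral (cell r) E \<le> 2 * Q"
proof -
  have *: "\<kappa> * integral (cell r) E \<le> 2 * Q" if r: "r > 0" for r
  proof (rule real_le_add_inverse_imp_le[where ?R0.0 = "max 1 (2 * r)" and C = "4 * err"])
    fix R assume R: "max 1 (2 * r) \<le> R"
    have "integral (cell r) E \<le> 2 * integral (cell R) (\<lambda>p. \<zeta> R p * E p)"
      by (rule integral_cell_le_cutoff[OF r _ cont_E E_nonneg]) (use R in auto)
    then have "\<kappa> * integral (cell r) E \<le> \<kappa> * (2 * integral (cell R) (\<lambda>p. \<zeta> R p * E p))"
      using \<kappa> by simp
    moreover have "4 * err / R = 4 * (err / R)" by simp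
    ultimately show "\<kappa> * integral (cell r) E \<le> 2 * Q + 4 * err / R"
      using energy_inequality[of R] cutoff_F_le[of R] R by simp
  qed
  moreover have "integral (cell r) E \<le> integral (cell (max r 1)) E"
    by (rule integral_subset_le[OF cell_mono[OF max.cobounded1] integrable_cell[OF cont_E] integrable_cell[OF cont_E]])
       (use E_nonneg in blast)
  then have "\<kappa> * integral (cell r) E \<le> \<kappa> * integral (cell (max r 1)) E" using \<kappa> by simp
  moreover have "0 < max r 1" by simp
  ultimately show ?thesis using *[of "max r 1"] by linarith
qed

lemma far_field:
  assumes "0 < \<alpha>" "\<beta> < 1"
  obtains X where "X > 0" "\<And>x y. (x, y) \<in> S \<Longrightarrow> x \<ge> X \<Longrightarrow> \<theta> (x, y) < \<alpha>"
    "\<And>x y. (x, y) \<in> S \<Longrightarrow> x \<le> - X \<Longrightarrow> \<beta> < \<theta> (x, y)"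
proof -
  define e where "e = min \<alpha> (1 - \<beta>)"
  have e: "e > 0" "e \<le> \<alpha>" "e \<le> 1 - \<beta>" using assms by (auto simp: e_def)
  define X where "X = M / e + 1"
  have X: "X \<ge> 1" using M_pos e by (simp add: X_def)
  have small: "M / (1 + x\<^sup>2) < e" if "\<bar>x\<bar> \<ge> X" for x
  proof -
    have "M / e < X" by (simp add: X_def)
    also have "X \<le> \<bar>x\<bar>" by (rule that)
    also have "\<bar>x\<bar> \<le> x\<^sup>2" using self_le_power[of "\<bar>x\<bar>" 2] that X by simp
    finally have "M < e * (1 + x\<^sup>2)" using e by (simp add: field_simps)
    moreover have "1 + x\<^sup>2 > 0" by (metis add_pos_nonneg zero_le_power2 zero_less_one)
    ultimately show ?thesis by (simp add: pos_divide_less_eq)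
  qed
  show thesis
  proof (rule that[of X])
    show "\<theta> (x, y) < \<alpha>" if "(x, y) \<in> S" "x \<ge> X" for x y
      using decay(1)[OF that(1)] small[of x] that X e by simp
    show "\<beta> < \<theta> (x, y)" if "(x, y) \<in> S" "x \<le> - X" for x y
      using decay(2)[OF that(1)] small[of x] that X e by simp
  qed (use X in simp)
qed

text \<open>The density dominating every term of the equation tested in a tube. Its total is at most
  \<open>5 * Q\<close>: one \<open>Q\<close> from \<tau> and two each from \<open>F\<close> and
  \<open>\<kappa> * E\<close>.\<close>

definition "n p = \<tau> p + F p + \<kappa> * E p"

lemma cont_n: "continuous_on S n"
  unfolding n_def by (intro continuous_intros cont_\<tau> cont_F cont_E)

lemma n_nonneg: "p \<in> S \<Longrightarrow> 0 \<le> n p"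
  using \<tau>_nonneg[of p] F_nonneg[of p] E_nonneg[of p] \<kappa> by (simp add: n_def)

lemma n_cell_le: "integral (cell r) n \<le> 5 * Q"
proof -
  have "integral (cell r) n = integral (cell r) \<tau> + integral (cell r) F + \<kappa> * integral (cell r) E"
    unfolding n_def using integrable_cell[OF cont_\<tau>, of r] integrable_cell[OF cont_F, of r]
      integrable_cell[OF cont_E, of r]
    by (simp add: integral_add integrable_add integrable_on_mult_right)
  then show ?thesis using \<tau>_cell_le[of r] F_cell_le[of r] E_cell_le[of r] by simp
qed

text \<open>Passing to the extended nonnegative integral lets tubes, translates and sums be handled
  without integrability conditions.\<close>

lemma nn_integral_n_strip: "(\<integral>\<^sup>+ p. ennreal (n p) * indicator (strip H) p \<partial>lborel) \<le> ennreal (5 * Q)"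
proof -
  define k where "k i p = ennreal (indicator (cell (real i)) p *\<^sub>R n p)" for i :: nat and p
  have i: "integrable lborel (\<lambda>p. indicator (cell (real i)) p *\<^sub>R n p)" for i :: nat
    by (rule borel_integrable_compact[OF compact_cbox continuous_on_cell[OF cont_n]])
  have pos: "0 \<le> indicator (cell r) p *\<^sub>R n p" for r p
    using n_nonneg[of p] cell_subset[of r] by (auto simp: indicator_def)
  have k: "(\<integral>\<^sup>+ p. k i p \<partial>lborel) \<le> ennreal (5 * Q)" for i
  proof -
    have "(\<integral>\<^sup>+ p. k i p \<partial>lborel) = ennreal (\<integral>p. indicator (cell (real i)) p *\<^sub>R n p \<partial>lborel)"
      unfolding k_def by (rule nn_integral_eq_integral[OF i AE_I2]) (rule pos)
    also have "(\<integral>p. indicator (cell (real i)) p *\<^sub>R n p \<partial>lborel) = integral (cell (real i)) n"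
      using set_borel_integral_eq_integral(2)[of "cell (real i)" n] i
      by (simp add: set_integrable_def set_lebesgue_integral_def)
    finally show ?thesis using n_cell_le[of "real i"] by (simp add: ennreal_leI)
  qed
  have cell_strip: "p \<in> cell r \<longleftrightarrow> p \<in> strip H \<and> \<bar>fst p\<bar> \<le> r" for p r
    by (cases p) (auto simp: strip_def cbox_Pair_eq)
  have "ennreal (n p) * indicator (strip H) p = (SUP i. k i p)" for p
  proof (cases "p \<in> strip H")
    case True
    obtain N :: nat where N: "\<bar>fst p\<bar> \<le> real N" using real_arch_simple by blast
    have "k i p \<le> ennreal (n p)" for i by (auto simp: k_def indicator_def)
    moreover have "k N p = ennreal (n p)" using N True by (simp add: k_def cell_strip)
    ultimately have "(SUP i. k i p) = ennreal (n p)" by (intro antisym SUP_least) (metis SUP_upper UNIV_I)+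
    then show ?thesis using True by simp
  next
    case False
    then show ?thesis by (simp add: k_def cell_strip)
  qed
  then have "(\<integral>\<^sup>+ p. ennreal (n p) * indicator (strip H) p \<partial>lborel) = (\<integral>\<^sup>+ p. (SUP i. k i p) \<partial>lborel)" by simp
  also have "\<dots> = (SUP i. \<integral>\<^sup>+ p. k i p \<partial>lborel)"
  proof (rule nn_integral_monotone_convergence_SUP)
    show "incseq k"
    proof (intro incseq_SucI le_funI)
      fix i p
      show "k i p \<le> k (Suc i) p" unfolding k_def
        by (rule ennreal_leI) (use pos[of "real (Suc i)" p] in \<open>auto simp: indicator_def cell_strip simp del: of_nat_Suc\<close>)
    qed
    show "k i \<in> borel_measurable lborel" for i
      unfolding k_def using borel_measurable_integrable[OF i] by simp
  qed
  also have "\<dots> \<le> ennreal (5 * Q)" by (rule SUP_least) (rule k)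
  finally show ?thesis .
qed

lemma n_indicator_measurable:
  assumes "open A" "A \<subseteq> S"
  shows "(\<lambda>p. ennreal (n p) * indicator A p) \<in> borel_measurable lborel"
proof -
  have "(\<lambda>p. indicator A p *\<^sub>R n p) \<in> borel_measurable borel"
    by (rule borel_measurable_continuous_on_indicator[OF _ continuous_on_subset[OF cont_n assms(2)]])
       (use assms(1) in auto)
  then have "(\<lambda>p. ennreal (indicator A p *\<^sub>R n p)) \<in> borel_measurable lborel" by simp
  moreover have "(\<lambda>p. ennreal (indicator A p *\<^sub>R n p)) = (\<lambda>p. ennreal (n p) * indicator A p)"
    by (rule ext) (simp add: indicator_def)
  ultimately show ?thesis by simp
qed

text \<open>Expand the square of \<open>v0 * gs / sqrt \<kappa> - sqrt \<kappa> * d\<close>; the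
  scaling \<open>v0\<^sup>2 / \<kappa>\<close> in \<open>F\<close> is exactly the one that
  matches.\<close>

lemma young_reaction_diffusion:
  assumes "gs\<^sup>2 \<le> c * f (\<theta> p)" "d\<^sup>2 \<le> E p" "gs \<ge> 0" "d \<ge> 0"
  shows "v0 * (gs * d) \<le> (c * F p + \<kappa> * E p) / 2"
proof -
  have "0 \<le> (v0 * gs / sqrt \<kappa> - sqrt \<kappa> * d)\<^sup>2" by simp
  also have "\<dots> = v0\<^sup>2 * gs\<^sup>2 / \<kappa> + \<kappa> * d\<^sup>2 - 2 * (v0 * (gs * d))"
    using \<kappa> by (simp add: power2_diff power_mult_distrib power_divide)
  finally have "2 * (v0 * (gs * d)) \<le> v0\<^sup>2 * gs\<^sup>2 / \<kappa> + \<kappa> * d\<^sup>2" by simp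
  moreover have "v0\<^sup>2 * gs\<^sup>2 / \<kappa> \<le> c * F p"
    using mult_left_mono[OF assms(1), of "v0\<^sup>2 / \<kappa>"] \<kappa> by (simp add: F_def mult_ac)
  moreover have "\<kappa> * d\<^sup>2 \<le> \<kappa> * E p" using assms(2) \<kappa> by simp
  ultimately show ?thesis by simp
qed

lemma speed_lower_bound:
  assumes ab: "0 < \<alpha>" "\<alpha> < \<beta>" "\<beta> < 1" "c > 0"
    and G: "\<And>s. s \<in> {0..1} \<Longrightarrow> (G has_real_derivative g s) (at s)" "continuous_on {0..1} g"
      "\<And>s. s \<in> {0..\<alpha>} \<Longrightarrow> G s = 0" "\<And>s. s \<in> {\<beta>..1} \<Longrightarrow> G s = 1"
    and g: "\<And>s. 0 \<le> g s" "\<And>s. s \<in> {0..1} \<Longrightarrow> (g s)\<^sup>2 \<le> c * f s"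
  shows "v0 * H \<le> (c + 1) * Q"
proof -
  obtain X where X: "X > 0" "\<And>x y. (x, y) \<in> S \<Longrightarrow> x \<ge> X \<Longrightarrow> \<theta> (x, y) < \<alpha>"
    "\<And>x y. (x, y) \<in> S \<Longrightarrow> x \<le> - X \<Longrightarrow> \<beta> < \<theta> (x, y)" using far_field[OF ab(1,3)] by metis
  have cg: "continuous_on S (\<lambda>p. g (\<theta> p))"
    by (rule continuous_on_compose2[OF G(2) cont_\<theta>]) (use range in auto)
  have cgd: "continuous_on S (\<lambda>p. g (\<theta> p) * D1 \<theta> p)" by (intro continuous_intros cg cont_D1)
  \<comment> \<open>With zero second component this is the fundamental theorem along horizontal
    lines; \<open>X\<close> lies beyond the transition region, where \<open>G\<close> has already
    reached 0 and 1.\<close>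
  have "integral (cell X) (\<lambda>p. g (\<theta> p) * D1 \<theta> p + (\<lambda>_. 0) p)
    = integral {0..H} (\<lambda>y. G (\<theta> (X, y)) - G (\<theta> (- X, y))) + integral {- X..X} (\<lambda>x. (\<lambda>_. 0) (x, H) - (\<lambda>_. 0) (x, 0))"
  proof (rule integral_divergence_box[where ?X1.0 = "\<lambda>p. G (\<theta> p)" and ?X2.0 = "\<lambda>_. 0"])
    fix x y assume "x \<in> {- X..X}" "y \<in> {0..H}"
    then have y: "y \<in> cross_section bc H" using strip_cross_section by blast
    then have "(x, y) \<in> S" by (simp add: domain_eq)
    then show "((\<lambda>x. G (\<theta> (x, y))) has_real_derivative g (\<theta> (x, y)) * D1 \<theta> (x, y)) (at x within {- X..X})"
      using DERIV_chain2[OF G(1) \<theta>_slices(1)[OF y]] range by auto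
  qed (use X H cgd continuous_on_cell in auto)
  also have "\<dots> = integral {0..H} (\<lambda>y. - 1)"
  proof -
    have "G (\<theta> (X, y)) - G (\<theta> (- X, y)) = - 1" if y: "y \<in> {0..H}" for y
    proof -
      have S: "(x, y) \<in> S" for x using y strip_subset_domain[of H bc] by (auto simp: strip_def)
      have "G (\<theta> (X, y)) = 0" using X(2)[OF S, of X] range[OF S[of X]] by (intro G) auto
      moreover have "G (\<theta> (- X, y)) = 1" using X(3)[OF S, of "- X"] range[OF S[of "- X"]] by (intro G) auto
      ultimately show ?thesis by simp
    qed
    then have "integral {0..H} (\<lambda>y. G (\<theta> (X, y)) - G (\<theta> (- X, y))) = integral {0..H} (\<lambda>y. - 1)"
      by (rule Henstock_Kurzweil_Integration.integral_cong)
    then show ?thesis by (simp only: diff_self integral_0 add_0_right)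
  qed
  also have "\<dots> = - H" using H by simp
  finally have "H = \<bar>integral (cell X) (\<lambda>p. g (\<theta> p) * D1 \<theta> p)\<bar>" using H by simp
  then have "v0 * H = \<bar>integral (cell X) (\<lambda>p. v0 * (g (\<theta> p) * D1 \<theta> p))\<bar>" using v0 by (simp add: abs_mult)
  also have "\<dots> \<le> integral (cell X) (\<lambda>p. (c * F p + \<kappa> * E p) / 2)"
  proof (rule abs_integral_le)
    show "(\<lambda>p. v0 * (g (\<theta> p) * D1 \<theta> p)) integrable_on cell X"
      by (intro integrable_cell continuous_on_mult continuous_on_const cgd)
    show "(\<lambda>p. (c * F p + \<kappa> * E p) / 2) integrable_on cell X"
      by (intro integrable_cell continuous_on_divide continuous_on_add continuous_on_mult
          continuous_on_const cont_F cont_E) simp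
    fix p assume "p \<in> cell X"
    then have p: "p \<in> S" using cell_subset by blast
    have "v0 * (g (\<theta> p) * \<bar>D1 \<theta> p\<bar>) \<le> (c * F p + \<kappa> * E p) / 2"
    proof (rule young_reaction_diffusion[OF _ _ g(1) abs_ge_zero])
      show "(g (\<theta> p))\<^sup>2 \<le> c * f (\<theta> p)" using range[OF p] by (intro g(2)) simp
    qed (simp add: E_def)
    then show "\<bar>v0 * (g (\<theta> p) * D1 \<theta> p)\<bar> \<le> (c * F p + \<kappa> * E p) / 2"
      using v0 g(1) by (simp add: abs_mult)
  qed
  also have "\<dots> = (c * integral (cell X) F + \<kappa> * integral (cell X) E) / 2"
    using integrable_cell[OF cont_F, of X] integrable_cell[OF cont_E, of X]
    by (simp add: integral_add integrable_on_mult_right)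
  also have "\<dots> \<le> (c * (2 * Q) + 2 * Q) / 2"
    using F_cell_le[of X] E_cell_le[of X] ab(4) by (intro divide_right_mono add_mono mult_left_mono) auto
  finally show ?thesis by (simp add: algebra_simps)
qed

end

section \<open>Geometry of a tube\<close>

text \<open>The primitive of the closed form - u2 dx + u1 dy on a rectangle. A total derivative is
  required because the function is later composed with the chart of a tube; it follows from the two
  partial derivatives and the continuity of \<open>u1\<close>.\<close>

lemma stream_function_exists:
  fixes u1 u2 p :: "real \<times> real \<Rightarrow> real"
  assumes ab: "a < a'" "b < b'"
    and u1: "\<And>x y. x \<in> {a..a'} \<Longrightarrow> y \<in> {b..b'} \<Longrightarrow> ((\<lambda>x. u1 (x, y)) has_real_derivative p (x, y)) (at x within {a..a'})"
    and u2: "\<And>x y. x \<in> {a..a'} \<Longrightarrow> y \<in> {b..b'} \<Longrightarrow> ((\<lambda>y. u2 (x, y)) has_real_derivative - p (x, y)) (at y within {b..b'})"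
    and c: "continuous_on ({a..a'} \<times> {b..b'}) u1" "continuous_on ({a..a'} \<times> {b..b'}) u2"
      "continuous_on ({a..a'} \<times> {b..b'}) p"
  obtains \<psi> where "\<And>x y. x \<in> {a..a'} \<Longrightarrow> y \<in> {b..b'} \<Longrightarrow>
    (\<psi> has_derivative (\<lambda>v. fst v * - u2 (x, y) + snd v * u1 (x, y))) (at (x, y) within {a..a'} \<times> {b..b'})"
proof -
  define \<psi>0 where "\<psi>0 x y = integral {b..y} (\<lambda>s. u1 (x, s)) - integral {a..x} (\<lambda>s. u2 (s, b))" for x y
  have cy: "continuous_on {b..b'} (\<lambda>s. g (x, s))" if "continuous_on ({a..a'} \<times> {b..b'}) g" "x \<in> {a..a'}"
    for g :: "real \<times> real \<Rightarrow> real" and x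
    by (rule continuous_on_compose2[OF that(1)]) (use that in \<open>auto intro!: continuous_intros\<close>)
  have cx: "continuous_on {a..a'} (\<lambda>s. g (s, y))" if "continuous_on ({a..a'} \<times> {b..b'}) g" "y \<in> {b..b'}"
    for g :: "real \<times> real \<Rightarrow> real" and y
    by (rule continuous_on_compose2[OF that(1)]) (use that in \<open>auto intro!: continuous_intros\<close>)
  have "((\<lambda>(x, y). \<psi>0 x y) has_derivative (\<lambda>v. fst v * - u2 (x, y) + snd v * u1 (x, y)))
      (at (x, y) within {a..a'} \<times> {b..b'})" if x: "x \<in> {a..a'}" and y: "y \<in> {b..b'}" for x y
  proof -
    have sub: "{b..y} \<subseteq> {b..b'}" using y by auto
    \<comment> \<open>The \<open>x\<close>-derivative falls on \<open>u1\<close> under the integral;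
      since \<open>p\<close> is also minus the \<open>y\<close>-derivative of \<open>u2\<close>, the
      result integrates to boundary values of \<open>u2\<close>.\<close>
    have 1: "((\<lambda>x. integral (cbox b y) (\<lambda>s. u1 (x, s))) has_real_derivative integral (cbox b y) (\<lambda>s. p (x, s)))
        (at x within {a..a'})"
    proof (rule leibniz_rule_field_derivative[where fx = "\<lambda>x s. p (x, s)"])
      show "((\<lambda>x. u1 (x, t)) has_field_derivative p (x, t)) (at x within {a..a'})"
        if "x \<in> {a..a'}" "t \<in> cbox b y" for x t using u1[of x t] that sub by auto
      show "(\<lambda>s. u1 (x, s)) integrable_on cbox b y" if "x \<in> {a..a'}" for x
        using continuous_on_subset[OF cy[OF c(1) that] sub] by (auto intro: integrable_continuous_real)
      show "continuous_on ({a..a'} \<times> cbox b y) (\<lambda>(x, t). p (x, t))"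
        using continuous_on_subset[OF c(3) Sigma_mono[OF subset_refl sub]] by (simp add: box_real)
    qed (use x in auto)
    have "((\<lambda>s. p (x, s)) has_integral (- u2 (x, y) - (- u2 (x, b)))) {b..y}"
    proof (rule fundamental_theorem_of_calculus)
      fix s assume s: "s \<in> {b..y}"
      have "((\<lambda>s. - u2 (x, s)) has_real_derivative - (- p (x, s))) (at s within {b..b'})"
        by (rule DERIV_minus[OF u2]) (use s x sub in auto)
      then show "((\<lambda>s. - u2 (x, s)) has_vector_derivative p (x, s)) (at s within {b..y})"
        using DERIV_subset[OF _ sub] by (auto simp: has_real_derivative_iff_has_vector_derivative)
    qed (use y in simp)
    then have 2: "integral (cbox b y) (\<lambda>s. p (x, s)) = u2 (x, b) - u2 (x, y)" by (simp add: integral_unique)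
    have 3: "((\<lambda>x. integral {a..x} (\<lambda>s. u2 (s, b))) has_real_derivative u2 (x, b)) (at x within {a..a'})"
      by (rule integral_has_real_derivative[OF cx[OF c(2)] x]) (use ab in auto)
    have \<psi>x: "((\<lambda>x. \<psi>0 x y) has_real_derivative (u2 (x, b) - u2 (x, y)) - u2 (x, b)) (at x within {a..a'})"
      unfolding \<psi>0_def using DERIV_diff[OF 1[unfolded 2] 3] by simp
    have fx: "((\<lambda>x. \<psi>0 x y) has_derivative (\<lambda>h. h * - u2 (x, y))) (at x within {a..a'})"
    proof -
      have "(\<lambda>h. h * - u2 (x, y)) = (*) ((u2 (x, b) - u2 (x, y)) - u2 (x, b))"
        by (rule ext) (simp add: algebra_simps)
      then show ?thesis
using \<psi>x unfolding has_field_derivative_def by simp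
    qed
    have fy: "((\<lambda>y. \<psi>0 x y) has_derivative blinfun_apply (u1 (x, y) *\<^sub>R id_blinfun)) (at y within {b..b'})"
      if "x \<in> {a..a'}" "y \<in> {b..b'}" for x y
    proof -
      have "((\<lambda>y. \<psi>0 x y) has_real_derivative u1 (x, y) - 0) (at y within {b..b'})"
        unfolding \<psi>0_def
        by (intro DERIV_diff DERIV_const integral_has_real_derivative[OF cy[OF c(1)]] that)
      moreover have "blinfun_apply (u1 (x, y) *\<^sub>R id_blinfun) = (*) (u1 (x, y))"
        by (rule ext) (simp add: scaleR_blinfun.rep_eq)
      ultimately show ?thesis by (simp add: has_field_derivative_def)
    qed
    have "continuous (at (x, y) within {a..a'} \<times> {b..b'}) (\<lambda>q. u1 q *\<^sub>R (id_blinfun :: real \<Rightarrow>\<^sub>L real))"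
      using c(1) x y by (intro continuous_intros) (auto simp: continuous_on_eq_continuous_within)
    then have "((\<lambda>(x, y). \<psi>0 x y) has_derivative (\<lambda>(tx, ty). tx * - u2 (x, y) + blinfun_apply (u1 (x, y) *\<^sub>R id_blinfun) ty))
      (at (x, y) within {a..a'} \<times> {b..b'})"
      by (intro has_derivative_partialsI[OF fx fy]) (use y in \<open>auto simp: case_prod_unfold\<close>)
    then show ?thesis by (simp add: scaleR_blinfun.rep_eq case_prod_unfold mult.commute[of "u1 (x, y)"])
  qed
  then show thesis by (rule that)
qed

section \<open>The coordinate chart of a single tube\<close>

locale stream_tube =
  fixes bc :: bdry_cond and H K :: real and u :: "real \<times> real \<Rightarrow> real \<times> real" and D :: tube
  assumes H: "H > 0" and K: "K > 0"
    and u_C1: "C1_on (domain bc H) u"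
    and div_free: "\<And>p. p \<in> domain bc H \<Longrightarrow> divergence (domain bc H) u p = 0"
    and sc: "stream_coords (domain bc H) u D"
    and mb: "metric_bounds K D"
    and disj: "\<And>k. k \<in> lattice_shifts bc \<Longrightarrow> k \<noteq> 0 \<Longrightarrow>
      open_tube D \<inter> (\<lambda>(x, y). (x, y + of_int k * H)) ` open_tube D = {}"
begin

abbreviation "c \<equiv> centre D"
abbreviation "h \<equiv> hwidth D"
abbreviation "P \<equiv> param D"
abbreviation "OT \<equiv> open_tube D"
abbreviation "CR \<equiv> coord_range D"

text \<open>On the open strip \<open>CI\<close> derivatives within the closed range are ordinary
  ones. The cutoff will live on \<open>half\<close>, which keeps the distance \<open>h / 2\<close>
  from the bounding values of \<rho>.\<close>

definition "CI = {c - h<..<c + h} \<times> (UNIV :: real set)"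
definition "half = {c - h/2..c + h/2}"

lemma h: "h > 0" and region_subset: "region D \<subseteq> domain bc H"
  and bij: "bij_betw (coords D) (region D) CR"
  and coords_C2: "C2_on (region D) (coords D)" and P_C2: "C2_on CR P"
  and level_streamline: "r \<in> rho_range D \<Longrightarrow> streamline (domain bc H) u {p \<in> region D. fst (coords D p) = r}"
  and streamline_onto: "streamline (domain bc H) u \<Gamma> \<Longrightarrow> \<Gamma> \<subseteq> region D \<Longrightarrow> fst ` \<Gamma> = UNIV"
  using sc unfolding stream_coords_def by auto

lemma P_coords: "p \<in> region D \<Longrightarrow> P (coords D p) = p"
  using bij unfolding param_def bij_betw_def by (simp add: inv_into_f_f)

lemma coords_P: "q \<in> CR \<Longrightarrow> coords D (P q) = q"
  using bij unfolding param_def bij_betw_def by (simp add: f_inv_into_f)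

lemma P_region: "q \<in> CR \<Longrightarrow> P q \<in> region D"
  using bij unfolding param_def bij_betw_def by (simp add: inv_into_into)

lemma P_inj: "inj_on P CR"
  by (metis coords_P inj_onI)

lemma CI_CR: "CI \<subseteq> CR" by (auto simp: CI_def coord_range_def rho_range_def)

lemma open_CI: "open CI" unfolding CI_def by (intro open_Times) auto

lemma half_CI: "half \<times> UNIV \<subseteq> CI" using h by (auto simp: half_def CI_def)

lemma O_region: "OT \<subseteq> region D" by (auto simp: open_tube_def)

lemma coords_CR: "p \<in> region D \<Longrightarrow> coords D p \<in> CR"
  using bij by (auto simp: bij_betw_def)

lemma coords_CI: "p \<in> OT \<Longrightarrow> coords D p \<in> CI"
  by (auto simp: open_tube_def CI_def mem_Times_iff)

lemma P_O: "q \<in> CI \<Longrightarrow> P q \<in> OT"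
  using CI_CR coords_P[of q] P_region[of q] by (auto simp: open_tube_def CI_def)

lemma O_eq: "OT = P ` CI"
proof
  show "OT \<subseteq> P ` CI"
  proof
    fix p assume p: "p \<in> OT"
    then have "p \<in> region D" using O_region by blast
    then show "p \<in> P ` CI" using P_coords[of p] coords_CI[OF p] by (metis imageI)
  qed
qed (use P_O in blast)

lemma two_dim_CR: "two_dim_at_points CR"
  unfolding coord_range_def rho_range_def
  by (rule two_dim_at_points_Times) (use h in \<open>auto simp: islimpt_Icc islimpt_UNIV\<close>)

abbreviation "P1 \<equiv> (\<lambda>q. fst (P q))"
abbreviation "P2 \<equiv> (\<lambda>q. snd (P q))"

lemma P12_C1: "C1_on CR P1" "C1_on CR P2"
  by (intro C1_on_bounded_linear[OF _ C2_on_imp_C1_on[OF P_C2]] bounded_linear_intros)+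

definition "P\<rho> q = (d1 CR P1 q, d1 CR P2 q)"
definition "P\<xi> q = (d2 CR P1 q, d2 CR P2 q)"
definition "DP q v = fst v *\<^sub>R P\<rho> q + snd v *\<^sub>R P\<xi> q"

lemma P_deriv_within: "q \<in> CR \<Longrightarrow> (P has_derivative DP q) (at q within CR)"
proof -
  assume q: "q \<in> CR"
  have "((\<lambda>q. (P1 q, P2 q)) has_derivative (\<lambda>v. (fst v * d1 CR P1 q + snd v * d2 CR P1 q,
      fst v * d1 CR P2 q + snd v * d2 CR P2 q))) (at q within CR)"
    by (intro has_derivative_Pair C1_on_has_derivative[OF two_dim_CR] P12_C1 q)
  then show ?thesis by (simp add: DP_def[abs_def] P\<rho>_def P\<xi>_def)
qed

lemma P_deriv: "q \<in> CI \<Longrightarrow> (P has_derivative DP q) (at q)"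
  using P_deriv_within[of q] CI_CR open_CI at_within_open_subset[of q CI CR] by auto

lemma P_cont: "continuous_on CR P"
  using P_deriv_within has_derivative_continuous_on by blast

lemma P\<rho>_cont: "continuous_on CR P\<rho>" and P\<xi>_cont: "continuous_on CR P\<xi>"
  unfolding P\<rho>_def P\<xi>_def
  by (intro continuous_on_Pair C1_on_continuous_d1[OF two_dim_CR] C1_on_continuous_d2[OF two_dim_CR] P12_C1)+

lemma frechet_P: "q \<in> CR \<Longrightarrow> frechet_derivative P (at q within CR) = DP q"
  by (rule frechet_derivative_unique_within[OF frechet_derivative_works[THEN iffD1, OF differentiableI[OF P_deriv_within]] P_deriv_within])
     (use two_dim_CR in \<open>auto simp: two_dim_at_points_def\<close>)

lemma metric: "q \<in> CR \<Longrightarrow> (norm (DP q v))\<^sup>2 = (E1 D q)\<^sup>2 * (fst v)\<^sup>2 + (E2 D q)\<^sup>2 * (snd v)\<^sup>2"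
  and E1_ge: "q \<in> CR \<Longrightarrow> 1 / K \<le> E1 D q" and E2_ge: "q \<in> CR \<Longrightarrow> 1 / K \<le> E2 D q"
  using mb[unfolded metric_bounds_def, rule_format, of q] frechet_P[of q] by (cases v; simp)+

lemma E_pos: "q \<in> CR \<Longrightarrow> E1 D q > 0" "q \<in> CR \<Longrightarrow> E2 D q > 0"
  using E1_ge E2_ge K by (meson less_le_trans zero_less_divide_1_iff)+

lemma norm_P\<rho>: "q \<in> CR \<Longrightarrow> norm (P\<rho> q) = E1 D q"
  using metric[of q "(1, 0)"] E_pos[of q] by (simp add: DP_def)

lemma norm_P\<xi>: "q \<in> CR \<Longrightarrow> norm (P\<xi> q) = E2 D q"
  using metric[of q "(0, 1)"] E_pos[of q] by (simp add: DP_def)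

lemma orthogonal: "q \<in> CR \<Longrightarrow> P\<rho> q \<bullet> P\<xi> q = 0"
proof -
  assume q: "q \<in> CR"
  have "(norm (P\<rho> q + P\<xi> q))\<^sup>2 = (norm (P\<rho> q))\<^sup>2 + (norm (P\<xi> q))\<^sup>2"
    using metric[OF q, of "(1, 1)"] by (simp add: DP_def norm_P\<rho>[OF q] norm_P\<xi>[OF q])
  then show ?thesis by (simp add: power2_norm_eq_inner inner_add inner_commute)
qed

definition "J q = fst (P\<rho> q) * snd (P\<xi> q) - snd (P\<rho> q) * fst (P\<xi> q)"

text \<open>Lagrange's identity for the two tangent vectors, whose inner product vanishes.\<close>

lemma J_square: "q \<in> CR \<Longrightarrow> (J q)\<^sup>2 = (E1 D q * E2 D q)\<^sup>2"
proof -
  assume q: "q \<in> CR"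
  have "(J q)\<^sup>2 + (P\<rho> q \<bullet> P\<xi> q)\<^sup>2 = (norm (P\<rho> q))\<^sup>2 * (norm (P\<xi> q))\<^sup>2"
    unfolding power2_norm_eq_inner
    by (simp add: J_def inner_prod_def) (simp add: power2_eq_square algebra_simps)
  then show ?thesis using q by (simp add: orthogonal norm_P\<rho> norm_P\<xi> power_mult_distrib)
qed

text \<open>The lower bounds on \<open>E1\<close> and \<open>E2\<close> say that \<open>P\<close>
  stretches every vector by a factor of at least \<open>1 / K\<close>; inverted, the coordinates are
  Lipschitz with constant \<open>K\<close> on convex parts of the tube.\<close>

lemma expansion: assumes q: "q \<in> CR" shows "norm v \<le> K * norm (DP q v)"
proof -
  have "(1 / K)\<^sup>2 \<le> (E1 D q)\<^sup>2" "(1 / K)\<^sup>2 \<le> (E2 D q)\<^sup>2"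
    using E1_ge[OF q] E2_ge[OF q] K by (auto intro!: power_mono)
  then have "(1 / K)\<^sup>2 * (fst v)\<^sup>2 + (1 / K)\<^sup>2 * (snd v)\<^sup>2 \<le> (norm (DP q v))\<^sup>2"
    unfolding metric[OF q] by (intro add_mono mult_right_mono) auto
  moreover have "(1 / K)\<^sup>2 * (fst v)\<^sup>2 + (1 / K)\<^sup>2 * (snd v)\<^sup>2 = (norm v / K)\<^sup>2"
    by (simp add: norm_prod_def power_divide add_divide_distrib)
  ultimately have "norm v / K \<le> norm (DP q v)" by (metis norm_ge_zero power2_le_imp_le)
  then show ?thesis using K by (simp add: field_simps)
qed

text \<open>Invariance of domain. Being open in the plane, the tube lies off the walls, so
  derivatives inside it are never one-sided.\<close>

lemma open_O: "open OT"
  unfolding O_eq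
  by (rule invariance_of_domain[OF continuous_on_subset[OF P_cont CI_CR] open_CI inj_on_subset[OF P_inj CI_CR]])

definition "DC p = frechet_derivative (coords D) (at p)"

lemma coords_deriv: assumes p: "p \<in> OT" shows "(coords D has_derivative DC p) (at p)"
proof -
  obtain A where "(coords D has_derivative A) (at p within region D)"
    using coords_C2 p O_region unfolding C2_on_def by blast
  moreover have "at p within region D = at p"
    by (rule at_within_open_subset[OF p open_O O_region])
  ultimately show ?thesis unfolding DC_def
    using frechet_derivative_works differentiableI by metis
qed

lemma DP_DC: assumes p: "p \<in> OT" shows "DP (coords D p) (DC p w) = w"
proof -
  have "((\<lambda>p. P (coords D p)) has_derivative (\<lambda>w. DP (coords D p) (DC p w))) (at p)"
    by (rule has_derivative_compose[OF coords_deriv[OF p] P_deriv[OF coords_CI[OF p]]])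
  moreover have "((\<lambda>p. P (coords D p)) has_derivative (\<lambda>w. w)) (at p)"
    by (rule has_derivative_transform_within_open[OF has_derivative_ident open_O p])
       (use P_coords O_region in auto)
  ultimately show ?thesis using has_derivative_unique by metis
qed

lemma norm_DC: assumes p: "p \<in> OT" shows "norm (DC p w) \<le> K * norm w"
  using expansion[of "coords D p" "DC p w"] DP_DC[OF p] coords_CI[OF p] CI_CR by auto

lemma coords_Lipschitz:
  assumes C: "convex C" "C \<subseteq> OT" and p: "p \<in> C" "p' \<in> C"
  shows "norm (coords D p - coords D p') \<le> K * norm (p - p')"
proof (rule differentiable_bound[OF C(1)])
  show "(coords D has_derivative DC x) (at x within C)" if "x \<in> C" for x
    using coords_deriv that C has_derivative_at_withinI by blast
  show "onorm (DC x) \<le> K" if "x \<in> C" for x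
    using norm_DC[of x] that C by (intro onorm_le) auto
qed (use p in auto)

text \<open>Take the largest ball around \<open>p\<close> inside the tube. It is convex, so the
  coordinates are Lipschitz on it; if its radius \<open>r\<close> were below \<open>d / K\<close>,
  it would lie in the image of a compact ball contained in \<open>CI\<close>. That image is closed,
  hence contains the boundary point \<open>p'\<close> of the ball, which is outside the
  tube.\<close>

lemma ball_in_tube:
  assumes p: "p \<in> region D" and d: "d > 0" "\<bar>fst (coords D p) - c\<bar> \<le> h - d"
  shows "ball p (d / K) \<subseteq> OT"
proof (rule ccontr)
  assume not: "\<not> ball p (d / K) \<subseteq> OT"
  have pO: "p \<in> OT" using p d by (auto simp: open_tube_def abs_le_iff)
  obtain p' where p': "p' \<in> - OT" "\<And>y. y \<in> - OT \<Longrightarrow> dist p p' \<le> dist p y"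
    using distance_attains_inf[of "- OT" p] open_O not by auto
  define r where "r = dist p p'"
  have r: "r > 0" using pO p' by (auto simp: r_def)
  have rd: "r < d / K" using not p'(2) unfolding r_def by (meson ComplI mem_ball order_le_less_trans subsetI)
  have sub: "ball p r \<subseteq> OT" using p'(2) by (force simp: r_def)
  define B where "B = cball (coords D p) (K * r)"
  have Kr: "K * r < d" using rd K by (simp add: field_simps)
  have BC: "B \<subseteq> CI"
  proof
    fix q assume "q \<in> B"
    then have "dist (fst q) (fst (coords D p)) \<le> K * r"
      by (metis B_def dist_commute dist_fst_le mem_cball order_trans)
    then have "\<bar>fst q - c\<bar> < h" using d(2) Kr by (simp add: dist_real_def)
    then show "q \<in> CI" by (auto simp: CI_def mem_Times_iff abs_less_iff)
  qed
  have "ball p r \<subseteq> P ` B"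
  proof
    fix z assume z: "z \<in> ball p r"
    then have zO: "z \<in> OT" using sub by blast
    have "norm (coords D p - coords D z) \<le> K * norm (p - z)"
      by (rule coords_Lipschitz[OF convex_ball sub _ z]) (use r in simp)
    also have "\<dots> \<le> K * r" using z K by (simp add: dist_norm)
    finally have "coords D z \<in> B" by (simp add: B_def dist_norm)
    then show "z \<in> P ` B" using P_coords[of z] zO O_region by force
  qed
  moreover have "compact (P ` B)"
    unfolding B_def by (intro compact_continuous_image continuous_on_subset[OF P_cont] compact_cball)
      (use BC CI_CR B_def in blast)
  then have "closed (P ` B)" by (rule compact_imp_closed)
  ultimately have "closure (ball p r) \<subseteq> P ` B" by (rule closure_minimal)
  then have "p' \<in> P ` B" using r by (auto simp: r_def)
  then show False using P_O BC p'(1) by blast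
qed

definition "core = {p \<in> OT. fst (coords D p) \<in> half}"

lemma core_eq: "core = P ` (half \<times> UNIV)"
proof
  show "core \<subseteq> P ` (half \<times> UNIV)"
  proof
    fix p assume p: "p \<in> core"
    then have "p \<in> region D" using O_region by (auto simp: core_def)
    then have "P (coords D p) = p" by (rule P_coords)
    then show "p \<in> P ` (half \<times> UNIV)" using p unfolding core_def
      by (intro image_eqI[of _ P "coords D p"]) (auto simp: mem_Times_iff)
  qed
  show "P ` (half \<times> UNIV) \<subseteq> core"
    using half_CI P_O coords_P CI_CR by (auto simp: core_def) (metis coords_P fst_conv subsetD SigmaI UNIV_I)
qed

lemma core_ball: assumes "p \<in> core" shows "ball p (h / 2 / K) \<subseteq> OT"
proof (rule ball_in_tube)
  show "p \<in> region D" using assms O_region by (auto simp: core_def)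
  show "\<bar>fst (coords D p) - c\<bar> \<le> h - h / 2" 
    using assms unfolding core_def half_def by (simp add: abs_le_iff) argo
qed (use h in simp)

lemma coords_cont: "continuous_on OT (coords D)"
  using coords_deriv has_derivative_continuous_on has_derivative_at_withinI by blast

text \<open>The coordinate strip is unbounded in \<xi>, so compactness does not help. Balls of a
  radius common to all points of the core lie in the tube; hence a limit stays in the open tube,
  where the coordinates are continuous.\<close>

lemma closed_core: "closed core"
  unfolding closed_sequential_limits
proof (intro allI impI, elim conjE)
  fix x l assume x: "\<forall>n. x n \<in> core" and l: "x \<longlonglongrightarrow> l"
  have "h / 2 / K > 0" using h K by simp
  then obtain n where "dist (x n) l < h / 2 / K"
    using l unfolding lim_sequentially by blast
  then have lO: "l \<in> OT" using core_ball[of "x n"] x by auto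
  then have "isCont (coords D) l"
    using coords_deriv has_derivative_continuous by blast
  then have "(\<lambda>n. fst (coords D (x n))) \<longlonglongrightarrow> fst (coords D l)"
    using tendsto_fst[OF isCont_tendsto_compose[OF _ l]] by blast
  moreover have "\<forall>n. fst (coords D (x n)) \<in> half" using x by (auto simp: core_def)
  moreover have "closed half" by (simp add: half_def)
  ultimately have "fst (coords D l) \<in> half" by (meson closed_sequentially)
  then show "l \<in> core" using lO by (simp add: core_def)
qed

text \<open>Distinct points of the core that are far apart in the \<open>\<xi>\<close> coordinate carry disjoint balls of a
  fixed radius, also modulo the period; so only finitely many fit over a bounded range of \<open>x\<close>.\<close>

lemma proper:
  obtains \<Xi> where "\<Xi> > 0" "\<And>\<rho> \<xi>. \<rho> \<in> half \<Longrightarrow> \<bar>\<xi>\<bar> \<ge> \<Xi> \<Longrightarrow> \<bar>P1 (\<rho>, \<xi>)\<bar> > X"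
proof (rule ccontr)
  assume not: "\<not> thesis"
  have "\<exists>q. fst q \<in> half \<and> \<bar>snd q\<bar> \<ge> real n \<and> \<bar>P1 q\<bar> \<le> X" for n
  proof (rule ccontr)
    assume none: "\<not> ?thesis"
    have "\<bar>P1 (\<rho>, \<xi>)\<bar> > X" if "\<rho> \<in> half" "\<bar>\<xi>\<bar> \<ge> real n + 1" for \<rho> \<xi>
    proof (rule ccontr)
      assume "\<not> \<bar>P1 (\<rho>, \<xi>)\<bar> > X"
      then have "fst (\<rho>, \<xi>) \<in> half \<and> \<bar>snd (\<rho>, \<xi>)\<bar> \<ge> real n \<and> \<bar>P1 (\<rho>, \<xi>)\<bar> \<le> X" using that by auto
      then show False using none by blast
    qed
    then show False using not that[of "real n + 1"] by auto
  qed
  then obtain q where q: "\<And>n. fst (q n) \<in> half" "\<And>n. \<bar>snd (q n)\<bar> \<ge> real n" "\<And>n. \<bar>P1 (q n)\<bar> \<le> X"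
    by metis
  define p where "p n = P (q n)" for n
  have pcore: "p n \<in> core" for n unfolding p_def core_eq
    by (rule imageI) (simp add: mem_Times_iff q(1))
  have cp: "coords D (p n) = q n" for n unfolding p_def
  proof (rule coords_P)
    have "q n \<in> half \<times> UNIV" using q(1)[of n] by (simp add: mem_Times_iff)
    then show "q n \<in> CR" by (rule subsetD[OF subset_trans[OF half_CI CI_CR]])
  qed
  have pO: "p n \<in> OT" for n using pcore by (simp add: core_def)
  have "\<exists>k\<in>lattice_shifts bc. snd (p n) + of_int k * H \<in> {0..H}" for n
  proof (cases bc)
    case Neumann
    then have "p n \<in> strip H" using pO[of n] O_region region_subset by auto
    then show ?thesis using Neumann by (auto simp: strip_def mem_Times_iff)
  next
    case Periodic
    then show ?thesis using period_representative[OF H, of "snd (p n)"] by auto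
  qed
  then obtain k where k: "\<And>n. k n \<in> lattice_shifts bc" "\<And>n. snd (p n) + of_int (k n) * H \<in> {0..H}" by metis
  \<comment> \<open>The points moved into one period cell, hence into a compact rectangle.\<close>
  define r where "r n = (fst (p n), snd (p n) + of_int (k n) * H)" for n
  have "r n \<in> {-X..X} \<times> {0..H}" for n using k(2)[of n] q(3)[of n] by (auto simp: r_def p_def)
  moreover have "compact ({-X..X} \<times> {0..H})" by (intro compact_Times compact_Icc)
  ultimately obtain l s where ls: "strict_mono (s :: nat \<Rightarrow> nat)" "(r \<circ> s) \<longlonglongrightarrow> l"
    unfolding compact_def by metis
  define e where "e = h / 2 / K"
  have e: "e > 0" using h K by (simp add: e_def)
  have "Cauchy (r \<circ> s)" using ls(2) LIMSEQ_imp_Cauchy by blast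
  then obtain N where N: "\<And>m n. m \<ge> N \<Longrightarrow> n \<ge> N \<Longrightarrow> dist (r (s m)) (r (s n)) < e"
    using e unfolding Cauchy_def by (metis comp_apply)
  have bound: "\<bar>snd (q (s m))\<bar> \<le> \<bar>snd (q (s N))\<bar> + K * e" if m: "m \<ge> N" for m
  proof -
    \<comment> \<open>The difference of the two reductions brings \<open>p (s m)\<close> next to
      \<open>p (s N)\<close>; were it nonzero, the tube would meet a translate of itself.\<close>
    define j where "j = k (s m) - k (s N)"
    have j: "j \<in> lattice_shifts bc" using k(1)[of "s m"] k(1)[of "s N"] by (cases bc) (auto simp: j_def)
    define z where "z = (fst (p (s m)), snd (p (s m)) + of_int j * H)"
    have "dist z (p (s N)) = dist (r (s m)) (r (s N))"
      by (simp add: z_def r_def j_def dist_Pair_Pair dist_real_def algebra_simps prod_eq_iff dist_prod_def)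
    then have zb: "z \<in> ball (p (s N)) e" using N[OF m order_refl] by (simp add: dist_commute)
    then have zO: "z \<in> OT" using core_ball[OF pcore[of "s N"]] by (auto simp: e_def)
    have "z \<in> (\<lambda>(x, y). (x, y + of_int j * H)) ` OT"
      by (rule image_eqI[of _ _ "p (s m)"]) (auto simp: z_def split_beta pO)
    then have "j = 0" using disj[OF j] zO by blast
    then have z: "z = p (s m)" by (simp add: z_def)
    have "norm (coords D (p (s m)) - coords D (p (s N))) \<le> K * norm (p (s m) - p (s N))"
      by (rule coords_Lipschitz[of "ball (p (s N)) e"])
         (use zb z core_ball[OF pcore[of "s N"]] e in \<open>auto simp: e_def\<close>)
    also have "\<dots> \<le> K * e" using zb z K by (simp add: dist_norm norm_minus_commute)
    finally have "norm (q (s m) - q (s N)) \<le> K * e" by (simp add: cp)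
    moreover have "\<bar>snd (q (s m)) - snd (q (s N))\<bar> \<le> norm (q (s m) - q (s N))"
      by (metis norm_snd_le prod.collapse real_norm_def snd_diff)
    ultimately show ?thesis by linarith
  qed
  \<comment> \<open>The second coordinates stay bounded along the subsequence, although the
    \<open>n\<close>-th one has modulus at least \<open>n\<close>.\<close>
  obtain m :: nat where m: "\<bar>snd (q (s N))\<bar> + K * e < real m" using reals_Archimedean2 by blast
  have "real m \<le> real (s (max m N))" using seq_suble[OF ls(1), of "max m N"] by simp
  also have "\<dots> \<le> \<bar>snd (q (s (max m N)))\<bar>" by (rule q(2))
  finally show False using bound[of "max m N"] m by simp
qed

end

section \<open>Flux through a tube\<close>

definition to_pair :: "real^2 \<Rightarrow> real \<times> real" where "to_pair v = (v $ 1, v $ 2)"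
definition of_pair :: "real \<times> real \<Rightarrow> real^2" where "of_pair p = (\<chi> i. if i = 1 then fst p else snd p)"

lemma of_pair_nth: "of_pair p $ 1 = fst p" "of_pair p $ 2 = snd p"
  by (simp_all add: of_pair_def)

lemma to_pair_of_pair: "to_pair (of_pair p) = p"
  by (simp add: to_pair_def of_pair_nth)

lemma of_pair_to_pair: "of_pair (to_pair v) = v"
  by (simp add: vec_eq_iff forall_2 of_pair_nth) (simp add: to_pair_def)

lemma bounded_linear_to_pair: "bounded_linear to_pair"
  unfolding to_pair_def by (intro bounded_linear_Pair bounded_linear_vec_nth)

lemma bounded_linear_of_pair: "bounded_linear of_pair"
proof -
  have "linear of_pair"
    by (rule linearI) (simp_all add: vec_eq_iff forall_2 of_pair_nth)
  then show ?thesis by (simp add: linear_conv_bounded_linear)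
qed

lemma to_pair_cbox: "to_pair ` cbox u v = cbox (to_pair u) (to_pair v)"
proof -
  have "p \<in> to_pair ` cbox u v" if "p \<in> cbox (to_pair u) (to_pair v)" for p
    by (rule image_eqI[of _ _ "of_pair p"])
       (use that in \<open>auto simp: to_pair_of_pair mem_box_cart forall_2 of_pair_nth to_pair_def cbox_Pair_eq\<close>)
  then show ?thesis by (auto simp: mem_box_cart forall_2 to_pair_def cbox_Pair_eq)
qed

lemma of_pair_cbox: "of_pair ` cbox a b = cbox (of_pair a) (of_pair b)"
proof -
  have "of_pair ` cbox a b = of_pair ` (to_pair ` cbox (of_pair a) (of_pair b))"
    by (simp add: to_pair_cbox to_pair_of_pair)
  then show ?thesis by (simp add: image_image of_pair_to_pair)
qed

lemma content_to_pair: "measure lborel (to_pair ` cbox u v) = measure lborel (cbox u v)"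
proof (cases "cbox u v = {}")
  case False
  then obtain x where "x \<in> cbox u v" by blast
  then have le: "u $ 1 \<le> v $ 1" "u $ 2 \<le> v $ 2"
    by (auto simp: mem_box_cart intro: order_trans)
  then show ?thesis
    unfolding to_pair_cbox content_cbox_cart[OF False] to_pair_def content_Pair
    by (simp add: UNIV_2)
qed simp

lemma has_integral_of_pair:
  fixes f :: "real \<times> real \<Rightarrow> real"
  assumes A: "compact A" and f: "(f has_integral i) A"
  shows "((\<lambda>v. f (to_pair v)) has_integral i) (of_pair ` A)"
proof -
  obtain a b where ab: "A \<subseteq> cbox a b" using compact_imp_bounded[OF A] bounded_subset_cbox_symmetric by blast
  have "((\<lambda>x. if x \<in> A then f x else 0) has_integral i) (cbox a b)" using f ab by simp
  then have "((\<lambda>v. if to_pair v \<in> A then f (to_pair v) else 0) has_integral (1 / 1) *\<^sub>R i) (of_pair ` cbox a b)"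
  proof (rule has_integral_twiddle[where g = to_pair and h = of_pair and r = 1, rotated -1])
    show "\<exists>w z. to_pair ` cbox u v = cbox w z" for u v using to_pair_cbox by blast
    show "\<exists>w z. of_pair ` cbox u v = cbox w z" for u v using of_pair_cbox by blast
  qed (auto simp: of_pair_to_pair to_pair_of_pair content_to_pair intro: linear_continuous_at bounded_linear_to_pair)
  moreover have "to_pair v \<in> A \<longleftrightarrow> v \<in> of_pair ` A" for v
    by (metis image_iff of_pair_to_pair to_pair_of_pair)
  ultimately have "((\<lambda>v. if v \<in> of_pair ` A then f (to_pair v) else 0) has_integral i) (of_pair ` cbox a b)"
    by simp
  then show ?thesis by (rule iffD1[OF has_integral_restrict[OF image_mono[OF ab]]])
qed

lemma absolutely_integrable_on_compact:
  fixes f :: "'a::euclidean_space \<Rightarrow> 'b::euclidean_space"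
  assumes "compact A" "continuous_on A f"
  shows "f absolutely_integrable_on A"
proof -
  have "set_integrable lborel A f"
    unfolding set_integrable_def by (rule borel_integrable_compact[OF assms])
  then show ?thesis
    unfolding set_integrable_def by (simp add: integrable_completion borel_measurable_integrable)
qed

text \<open>The general theorem concerns maps between Cartesian spaces, so arguments and values are
  carried over to \<open>real^2\<close> and \<open>real^1\<close> by linear bijections that preserve
  the content of boxes. Compactness of \<open>C\<close> and continuity provide all
  integrability.\<close>

lemma change_of_variables_plane:
  fixes g :: "real \<times> real \<Rightarrow> real \<times> real" and k :: "real \<times> real \<Rightarrow> real"
  assumes C: "compact C" and g: "\<And>x. x \<in> C \<Longrightarrow> (g has_derivative g' x) (at x within C)"
    and inj: "inj_on g C" and k: "continuous_on (g ` C) k"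
    and jac: "\<And>x. x \<in> C \<Longrightarrow> j x = fst (g' x (1, 0)) * snd (g' x (0, 1)) - snd (g' x (1, 0)) * fst (g' x (0, 1))"
    and cj: "continuous_on C j"
  shows "integral (g ` C) k = integral C (\<lambda>x. \<bar>j x\<bar> * k (g x))"
proof -
  define C2 where "C2 = of_pair ` C"
  define g2 where "g2 v = of_pair (g (to_pair v))" for v
  define g2' where "g2' v w = of_pair (g' (to_pair v) (to_pair w))" for v w
  define k2 :: "real^2 \<Rightarrow> real^1" where "k2 v = vec (k (to_pair v))" for v
  have cg: "continuous_on C g" using g has_derivative_continuous_on by blast
  have cgC: "compact (g ` C)" by (rule compact_continuous_image[OF cg C])
  have i: "(\<lambda>x. \<bar>j x\<bar> * k (g x)) integrable_on C" "k integrable_on g ` C"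
    by (intro set_lebesgue_integral_eq_integral(1) absolutely_integrable_on_compact C cgC k
        continuous_on_mult continuous_on_rabs cj continuous_on_compose2[OF k cg] subset_refl)+
  have cof: "continuous_on A of_pair" for A by (rule linear_continuous_on[OF bounded_linear_of_pair])
  have cto: "continuous_on A to_pair" for A by (rule linear_continuous_on[OF bounded_linear_to_pair])
  have C2: "compact C2" unfolding C2_def by (rule compact_continuous_image[OF cof C])
  have img: "g2 ` C2 = of_pair ` (g ` C)"
    by (simp add: C2_def g2_def image_image to_pair_of_pair)
  have der: "(g2 has_derivative g2' v) (at v within C2)" if "v \<in> C2" for v
  proof -
    have vC: "to_pair v \<in> C" using that by (auto simp: C2_def to_pair_of_pair)
    have im: "to_pair ` C2 = C" by (simp add: C2_def image_image to_pair_of_pair)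
    have "(to_pair has_derivative to_pair) (at v within C2)"
      using bounded_linear_to_pair by (rule bounded_linear_imp_has_derivative)
    then have "((\<lambda>v. g (to_pair v)) has_derivative (\<lambda>w. g' (to_pair v) (to_pair w))) (at v within C2)"
      by (rule has_derivative_in_compose[where g = g]) (use g[OF vC] im in simp)
    then show ?thesis unfolding g2_def g2'_def[abs_def]
      by (rule bounded_linear.has_derivative[OF bounded_linear_of_pair])
  qed
  have inj2: "inj_on g2 C2"
    using inj unfolding C2_def g2_def inj_on_def by (metis (no_types, lifting) image_iff to_pair_of_pair)
  have det: "det (matrix (g2' v)) = j (to_pair v)" if "v \<in> C2" for v
  proof -
    have vC: "to_pair v \<in> C" using that by (auto simp: C2_def to_pair_of_pair)
    have "to_pair (axis 1 1) = (1, 0)" "to_pair (axis 2 1) = (0, 1)" by (simp_all add: to_pair_def axis_def)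
    then show ?thesis unfolding jac[OF vC]
      by (simp add: det_2 matrix_def g2'_def of_pair_nth mult.commute)
  qed
  have "(k2 has_integral vec (integral (g ` C) k)) (of_pair ` (g ` C))"
    using has_integral_of_pair[OF cgC integrable_integral[OF i(2)]]
    unfolding k2_def by (subst has_integral_componentwise_iff) (auto simp: Basis_vec_def inner_axis)
  then have int2: "integral (g2 ` C2) k2 = vec (integral (g ` C) k)" unfolding img by (rule integral_unique)
  have abs2: "k2 absolutely_integrable_on g2 ` C2"
  proof (rule absolutely_integrable_on_compact)
    show "compact (g2 ` C2)" using compact_continuous_image[OF cof cgC] by (simp add: img)
    show "continuous_on (g2 ` C2) k2"
      unfolding k2_def vec_def img
      by (intro continuous_on_vec_lambda continuous_on_compose2[OF k cto]) (auto simp: to_pair_of_pair)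
  qed
  have "integral C2 (\<lambda>v. \<bar>det (matrix (g2' v))\<bar> *\<^sub>R k2 (g2 v)) = vec (integral (g ` C) k)"
    using has_absolute_integral_change_of_variables_compact[OF C2 der inj2, of k2 "vec (integral (g ` C) k)"]
      abs2 int2 by simp
  also have "integral C2 (\<lambda>v. \<bar>det (matrix (g2' v))\<bar> *\<^sub>R k2 (g2 v))
      = integral C2 (\<lambda>v. vec (\<bar>j (to_pair v)\<bar> * k (g (to_pair v))) :: real^1)"
    by (rule integral_cong) (simp add: det k2_def g2_def to_pair_of_pair vec_eq_iff)
  also have "\<dots> = vec (integral C (\<lambda>x. \<bar>j x\<bar> * k (g x)))"
  proof (rule integral_unique)
    show "((\<lambda>v. vec (\<bar>j (to_pair v)\<bar> * k (g (to_pair v))) :: real^1) has_integral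
        vec (integral C (\<lambda>x. \<bar>j x\<bar> * k (g x)))) C2"
      using has_integral_of_pair[OF C integrable_integral[OF i(1)]]
      unfolding C2_def by (subst has_integral_componentwise_iff) (auto simp: Basis_vec_def inner_axis)
  qed
  finally show ?thesis by (simp add: vec_eq_iff)
qed

text \<open>An intermediate value argument, used for the ends of a tube, for the Jacobian and for
  the flux.\<close>

lemma connected_abs_greater_imp_sign:
  fixes g :: "'a::topological_space \<Rightarrow> real"
  assumes "connected A" "continuous_on A g" "\<And>a. a \<in> A \<Longrightarrow> \<bar>g a\<bar> > X" "X \<ge> 0"
  shows "(\<forall>a\<in>A. g a > X) \<or> (\<forall>a\<in>A. g a < - X)"
proof (rule ccontr)
  assume "\<not> ?thesis"
  then obtain a b where ab: "a \<in> A" "b \<in> A" "\<not> g a > X" "\<not> g b < - X" by blast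
  then have "g a \<le> 0" "0 \<le> g b" using assms(3)[OF ab(1)] assms(3)[OF ab(2)] assms(4) by linarith+
  moreover have "connected (g ` A)" by (rule connected_continuous_image[OF assms(2,1)])
  ultimately have "0 \<in> g ` A" using ab connectedD_interval[of "g ` A" "g a" "g b" 0] by blast
  then obtain z where "z \<in> A" "g z = 0" by auto
  then show False using assms(3)[of z] assms(4) by simp
qed

context stream_tube begin

lemma P1_cont: "continuous_on CR P1"
  by (intro continuous_intros P_cont)

lemma half_CR: "half \<times> UNIV \<subseteq> CR" using half_CI CI_CR by blast

lemma centre_line_onto: "\<exists>\<xi>. P1 (c, \<xi>) = v"
proof -
  let ?G = "{p \<in> region D. fst (coords D p) = c}"
  have "c \<in> rho_range D" using h by (simp add: rho_range_def)
  then have "streamline (domain bc H) u ?G" by (rule level_streamline)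
  then have "fst ` ?G = UNIV" by (rule streamline_onto) auto
  then have "v \<in> fst ` ?G" by simp
  then obtain p where p: "p \<in> ?G" "fst p = v" by auto
  then have "coords D p = (c, snd (coords D p))" by (simp add: prod_eq_iff)
  then have "P (c, snd (coords D p)) = p" using P_coords[of p] p by simp
  then have "P1 (c, snd (coords D p)) = v" using p by simp
  then show ?thesis ..
qed

text \<open>Each end of the tube is connected and avoids \<open>\<bar>x\<bar> \<le> X\<close>, so it
  lies on one side. Both ends cannot lie on the same side, because the central streamline projects
  onto the whole line and covers only a bounded range between the ends. Which end is which stays
  open, whence the disjunction.\<close>

lemma opposite_ends:
  assumes \<Xi>: "\<Xi> > 0" and X: "X \<ge> 0"
    and far: "\<And>\<rho> \<xi>. \<rho> \<in> half \<Longrightarrow> \<bar>\<xi>\<bar> \<ge> \<Xi> \<Longrightarrow> \<bar>P1 (\<rho>, \<xi>)\<bar> > X"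
  shows "(\<forall>\<rho>\<in>half. P1 (\<rho>, \<Xi>) > X \<and> P1 (\<rho>, - \<Xi>) < - X) \<or>
    (\<forall>\<rho>\<in>half. P1 (\<rho>, \<Xi>) < - X \<and> P1 (\<rho>, - \<Xi>) > X)"
proof -
  have cont: "continuous_on (half \<times> A) P1" for A
    by (rule continuous_on_subset[OF P1_cont]) (use half_CR in blast)
  have con: "connected (half \<times> {\<Xi>..})" "connected (half \<times> {..- \<Xi>})"
    unfolding half_def by (intro connected_Times; simp)+
  have R: "(\<forall>q\<in>half \<times> {\<Xi>..}. P1 q > X) \<or> (\<forall>q\<in>half \<times> {\<Xi>..}. P1 q < - X)"
    by (rule connected_abs_greater_imp_sign[OF con(1) cont _ X]) (use far \<Xi> in auto)
  have L: "(\<forall>q\<in>half \<times> {..- \<Xi>}. P1 q > X) \<or> (\<forall>q\<in>half \<times> {..- \<Xi>}. P1 q < - X)"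
    by (rule connected_abs_greater_imp_sign[OF con(2) cont _ X]) (use far \<Xi> in auto)
  have chalf: "c \<in> half" using h by (simp add: half_def)
  have "compact (P1 ` ({c} \<times> {-\<Xi>..\<Xi>}))"
    by (intro compact_continuous_image compact_Times continuous_on_subset[OF cont[of UNIV]])
       (use chalf in auto)
  then have "bounded (P1 ` ({c} \<times> {-\<Xi>..\<Xi>}))" by (rule compact_imp_bounded)
  then obtain B where "\<forall>x\<in>P1 ` ({c} \<times> {-\<Xi>..\<Xi>}). norm x \<le> B"
    unfolding bounded_iff by blast
  then have B: "\<bar>P1 (c, \<xi>)\<bar> \<le> B" if "\<bar>\<xi>\<bar> \<le> \<Xi>" for \<xi>
    using that by (simp add: abs_le_iff)
  \<comment> \<open>These abscissas exceed everything attained for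
    \<open>\<bar>\<xi>\<bar> \<le> \<Xi>\<close>, so \<open>\<xi>1\<close> and \<open>\<xi>2\<close>
    belong to the ends.\<close>
  obtain \<xi>1 where \<xi>1: "P1 (c, \<xi>1) = \<bar>B\<bar> + X + 1" using centre_line_onto by blast
  obtain \<xi>2 where \<xi>2: "P1 (c, \<xi>2) = - (\<bar>B\<bar> + X + 1)" using centre_line_onto by blast
  have out: "\<xi>1 \<ge> \<Xi> \<or> \<xi>1 \<le> - \<Xi>" "\<xi>2 \<ge> \<Xi> \<or> \<xi>2 \<le> - \<Xi>"
    using B[of \<xi>1] B[of \<xi>2] \<xi>1 \<xi>2 X by linarith+
  have "\<not> ((\<forall>q\<in>half \<times> {\<Xi>..}. P1 q > X) \<and> (\<forall>q\<in>half \<times> {..- \<Xi>}. P1 q > X))"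
  proof -
    have "(c, \<xi>2) \<in> half \<times> {\<Xi>..} \<or> (c, \<xi>2) \<in> half \<times> {..- \<Xi>}" using out(2) chalf by auto
    moreover have "\<not> P1 (c, \<xi>2) > X" using \<xi>2 X by linarith
    ultimately show ?thesis by blast
  qed
  moreover have "\<not> ((\<forall>q\<in>half \<times> {\<Xi>..}. P1 q < - X) \<and> (\<forall>q\<in>half \<times> {..- \<Xi>}. P1 q < - X))"
  proof -
    have "(c, \<xi>1) \<in> half \<times> {\<Xi>..} \<or> (c, \<xi>1) \<in> half \<times> {..- \<Xi>}" using out(1) chalf by auto
    moreover have "\<not> P1 (c, \<xi>1) < - X" using \<xi>1 X by linarith
    ultimately show ?thesis by blast
  qed
  ultimately show ?thesis using R L by auto
qed

text \<open>Determinant of the \<rho>-tangent and the velocity: the signed flux across a line of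
  constant \<xi> per unit of \<rho>. Its modulus is \<open>weighted_speed\<close>.\<close>

definition "w q = fst (P\<rho> q) * snd (u (P q)) - snd (P\<rho> q) * fst (u (P q))"

text \<open>The level set of \<rho> through \<open>p\<close> is traced by an integral curve of
  \<open>u\<close>, along which \<rho> is constant.\<close>

lemma tangent: assumes p: "p \<in> OT" shows "fst (DC p (u p)) = 0"
proof -
  let ?r = "fst (coords D p)"
  have "?r \<in> rho_range D" 
    using coords_CR[OF subsetD[OF O_region p]] by (simp add: coord_range_def mem_Times_iff)
  from level_streamline[OF this] obtain \<gamma> where \<gamma>: "\<And>s::real. (\<gamma> has_vector_derivative u (\<gamma> s)) (at s)"
      "{q \<in> region D. fst (coords D q) = ?r} = range \<gamma>"
    unfolding streamline_def by blast
  have "p \<in> range \<gamma>" using \<gamma>(2) p O_region by blast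
  then obtain s0 where s0: "p = \<gamma> s0" by blast
  have "((\<lambda>s. coords D (\<gamma> s)) has_derivative (\<lambda>t. DC p (t *\<^sub>R u p))) (at s0)"
    using has_derivative_compose[of \<gamma> _ s0 UNIV "coords D" "DC p"] \<gamma>(1)[of s0] coords_deriv[OF p]
    by (simp add: has_vector_derivative_def s0)
  then have "((\<lambda>s. fst (coords D (\<gamma> s))) has_derivative (\<lambda>t. fst (DC p (t *\<^sub>R u p)))) (at s0)"
    by (rule has_derivative_fst)
  moreover have "(\<lambda>s. fst (coords D (\<gamma> s))) = (\<lambda>s. ?r)"
    using \<gamma>(2) by blast
  ultimately have "(\<lambda>t. fst (DC p (t *\<^sub>R u p))) = (\<lambda>t. 0)"
    using has_derivative_unique has_derivative_const by metis
  then show ?thesis by (metis scaleR_one)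
qed

lemma u_parallel:
  assumes q: "q \<in> CI" obtains a where "u (P q) = a *\<^sub>R P\<xi> q"
proof -
  have "DP q (DC (P q) (u (P q))) = u (P q)"
    using DP_DC[OF P_O[OF q], of "u (P q)"] coords_P[OF subsetD[OF CI_CR q]] by simp
  then show thesis using tangent[OF P_O[OF q]] that[of "snd (DC (P q) (u (P q)))"] by (simp add: DP_def)
qed

lemma w_eq: "u (P q) = a *\<^sub>R P\<xi> q \<Longrightarrow> w q = a * J q"
  by (simp add: w_def J_def algebra_simps)

lemma abs_J: "q \<in> CR \<Longrightarrow> \<bar>J q\<bar> = E1 D q * E2 D q"
  using J_square[of q] E_pos[of q] by (metis abs_of_pos mult_pos_pos power2_eq_iff_nonneg abs_ge_zero power2_abs less_imp_le)

lemma abs_w: assumes q: "q \<in> CI" shows "\<bar>w q\<bar> = weighted_speed u D q"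
proof -
  obtain a where a: "u (P q) = a *\<^sub>R P\<xi> q" using u_parallel[OF q] .
  have qC: "q \<in> CR" using q CI_CR by blast
  show ?thesis using norm_P\<xi>[OF qC] by (simp add: w_eq[OF a] abs_mult abs_J[OF qC] weighted_speed_def a)
qed

lemma J_cont: "continuous_on CR J"
  unfolding J_def by (intro continuous_intros P\<rho>_cont P\<xi>_cont)

lemma w_cont: "continuous_on CR w"
proof -
  have "continuous_on CR (\<lambda>q. u (P q))"
    by (rule continuous_on_compose2[OF C1_on_imp_continuous_on[OF u_C1] P_cont])
       (use P_region region_subset in blast)
  then show ?thesis unfolding w_def by (intro continuous_intros P\<rho>_cont)
qed

text \<open>Along the tube \<open>u\<close> has a stream function, constant in \<open>\<xi>\<close>, whose \<open>\<rho>\<close>-derivative is \<open>-w\<close>.\<close>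

lemma w_const:
  assumes q: "(\<rho>, \<xi>1) \<in> CI" and lt: "\<xi>1 < \<xi>2"
  shows "w (\<rho>, \<xi>1) = w (\<rho>, \<xi>2)"
proof -
  define e where "e = min (\<rho> - (c - h)) (c + h - \<rho>) / 2"
  have e: "e > 0" using q by (auto simp: e_def CI_def)
  define X where "X = {\<rho> - e..\<rho> + e}"
  define Y where "Y = {\<xi>1..\<xi>2}"
  have NCI: "X \<times> Y \<subseteq> CI"
  proof
    fix q assume q: "q \<in> X \<times> Y"
    have "e \<le> (\<rho> - (c - h)) / 2" "e \<le> (c + h - \<rho>) / 2" by (auto simp: e_def)
    moreover have "\<rho> - e \<le> fst q" "fst q \<le> \<rho> + e" using q by (auto simp: X_def)
    ultimately have "c - h < fst q" "fst q < c + h" using e by argo+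
    then show "q \<in> CI" by (simp add: CI_def mem_Times_iff)
  qed
  have NCR: "X \<times> Y \<subseteq> CR" using NCI CI_CR by blast
  have "compact (P ` (X \<times> Y))" unfolding X_def Y_def
    by (intro compact_continuous_image compact_Times compact_Icc continuous_on_subset[OF P_cont])
       (use NCR in \<open>simp add: X_def Y_def\<close>)
  then obtain B where B: "\<And>p. p \<in> P ` (X \<times> Y) \<Longrightarrow> norm p \<le> B"
    using compact_imp_bounded bounded_iff by metis
  \<comment> \<open>A rectangle inside the domain that contains the image: the full height between
    the walls, or a sufficiently large height in the periodic plane.\<close>
  define b where "b = (case bc of Neumann \<Rightarrow> 0 | Periodic \<Rightarrow> - \<bar>B\<bar> - 1)"
  define b' where "b' = (case bc of Neumann \<Rightarrow> H | Periodic \<Rightarrow> \<bar>B\<bar> + 1)"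
  have bb: "b < b'" "{b..b'} \<subseteq> cross_section bc H" using H by (cases bc; simp add: b_def b'_def)+
  define a where "a = \<bar>B\<bar> + 1"
  have dom: "{- a..a} \<times> {b..b'} \<subseteq> domain bc H" using bb(2) by (auto simp: domain_eq)
  have sub: "P ` (X \<times> Y) \<subseteq> {- a..a} \<times> {b..b'}"
  proof
    fix p assume p: "p \<in> P ` (X \<times> Y)"
    have n: "\<bar>fst p\<bar> \<le> B" "\<bar>snd p\<bar> \<le> B"
      using B[OF p] norm_fst_le[of "fst p" "snd p"] norm_snd_le[of "snd p" "fst p"] by auto
    have pd: "p \<in> domain bc H" using p NCR P_region region_subset by blast
    show "p \<in> {- a..a} \<times> {b..b'}"
      using n pd by (cases bc) (auto simp: mem_Times_iff a_def b_def b'_def strip_def abs_le_iff)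
  qed
  note S = two_dim_at_points_domain[OF H, of bc]
  have uC1: "C1_on (domain bc H) (\<lambda>q. fst (u q))" "C1_on (domain bc H) (\<lambda>q. snd (u q))"
    by (intro C1_on_bounded_linear[OF _ u_C1] bounded_linear_intros)+
  obtain \<psi> where \<psi>: "\<And>x y. x \<in> {- a..a} \<Longrightarrow> y \<in> {b..b'} \<Longrightarrow>
    (\<psi> has_derivative (\<lambda>v. fst v * - snd (u (x, y)) + snd v * fst (u (x, y)))) (at (x, y) within {- a..a} \<times> {b..b'})"
  proof (rule stream_function_exists[where a="- a" and a'=a and b=b and b'=b'
        and ?u1.0="\<lambda>q. fst (u q)" and ?u2.0="\<lambda>q. snd (u q)" and p="d1 (domain bc H) (\<lambda>q. fst (u q))"])
    fix x y assume xy: "x \<in> {- a..a}" "y \<in> {b..b'}"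
    then have y: "y \<in> cross_section bc H" using bb(2) by blast
    show "((\<lambda>x. fst (u (x, y))) has_real_derivative d1 (domain bc H) (\<lambda>q. fst (u q)) (x, y)) (at x within {- a..a})"
      by (rule C1_slices(1)[OF H uC1(1) y])
    have "(x, y) \<in> domain bc H" using y by (simp add: domain_eq)
    then have "- d1 (domain bc H) (\<lambda>q. fst (u q)) (x, y) = d2 (domain bc H) (\<lambda>q. snd (u q)) (x, y)"
      using div_free[of "(x, y)"] by (simp add: divergence_def)
    then show "((\<lambda>y. snd (u (x, y))) has_real_derivative - d1 (domain bc H) (\<lambda>q. fst (u q)) (x, y)) (at y within {b..b'})"
      using C1_slices(2)[OF H uC1(2) y bb(2)] by simp
  next
    show "continuous_on ({- a..a} \<times> {b..b'}) (\<lambda>q. fst (u q))" "continuous_on ({- a..a} \<times> {b..b'}) (\<lambda>q. snd (u q))"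
      "continuous_on ({- a..a} \<times> {b..b'}) (d1 (domain bc H) (\<lambda>q. fst (u q)))"
      using dom C1_on_imp_continuous_on[OF uC1(1)] C1_on_imp_continuous_on[OF uC1(2)]
        C1_on_continuous_d1[OF S uC1(1)] by (auto intro: continuous_on_subset)
  qed (use bb(1) in \<open>auto simp: a_def\<close>)
  \<comment> \<open>By the chain rule the \<rho>-derivative is \<open>- w\<close>; the
    \<xi>-derivative is up to sign the determinant of \<open>P\<xi>\<close> and \<open>u\<close>,
    which are parallel.\<close>
  have der: "((\<lambda>q. \<psi> (P q)) has_derivative (\<lambda>v. fst v * - w q + snd v * 0)) (at q within X \<times> Y)"
    if qN: "q \<in> X \<times> Y" for q
  proof -
    have qCI: "q \<in> CI" using qN NCI by blast
    obtain \<alpha> where \<alpha>: "u (P q) = \<alpha> *\<^sub>R P\<xi> q" using u_parallel[OF qCI] .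
    have Pq: "P q \<in> {- a..a} \<times> {b..b'}" using qN sub by blast
    have "(\<psi> has_derivative (\<lambda>v. fst v * - snd (u (P q)) + snd v * fst (u (P q)))) (at (P q) within P ` (X \<times> Y))"
      using has_derivative_subset[OF \<psi>[of "fst (P q)" "snd (P q)"] sub] Pq by (simp add: mem_Times_iff)
    moreover have "(P has_derivative DP q) (at q within X \<times> Y)"
      using P_deriv[OF qCI] has_derivative_at_withinI by blast
    ultimately have "((\<lambda>q. \<psi> (P q)) has_derivative
        (\<lambda>v. fst (DP q v) * - snd (u (P q)) + snd (DP q v) * fst (u (P q)))) (at q within X \<times> Y)"
      using has_derivative_in_compose by blast
    moreover have "fst (DP q v) * - snd (u (P q)) + snd (DP q v) * fst (u (P q)) = fst v * - w q + snd v * 0" for v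
      by (simp add: DP_def w_def) (simp add: \<alpha> algebra_simps)
    ultimately show ?thesis by simp
  qed
  have const: "\<psi> (P (r, \<xi>1)) = \<psi> (P (r, \<xi>2))" if r: "r \<in> X" for r
  proof -
    have "((\<lambda>\<xi>. \<psi> (P (r, \<xi>))) has_real_derivative 0) (at \<xi> within Y)" if "\<xi> \<in> Y" for \<xi>
      by (rule has_derivative_slices(2)[OF der r that]) (use r that in simp)
    then obtain z where "\<And>\<xi>. \<xi> \<in> Y \<Longrightarrow> \<psi> (P (r, \<xi>)) = z"
      using has_field_derivative_zero_constant[of Y "\<lambda>\<xi>. \<psi> (P (r, \<xi>))"] by (auto simp: Y_def)
    then show ?thesis using lt by (simp add: Y_def)
  qed
  have \<rho>X: "\<rho> \<in> X" "\<rho> \<in> interior X" using e by (auto simp: X_def)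
  have d: "((\<lambda>r. \<psi> (P (r, \<xi>))) has_real_derivative - w (\<rho>, \<xi>)) (at \<rho> within X)" if "\<xi> \<in> Y" for \<xi>
    by (rule has_derivative_slices(1)[OF der \<rho>X(1) that]) (use \<rho>X that in simp)
  have "((\<lambda>r. \<psi> (P (r, \<xi>1))) has_real_derivative - w (\<rho>, \<xi>1)) (at \<rho> within X)"
    by (rule d) (use lt in \<open>simp add: Y_def\<close>)
  \<comment> \<open>By \<open>const\<close> both values of \<xi> give the same function of
    \<rho>.\<close>
  moreover have "((\<lambda>r. \<psi> (P (r, \<xi>1))) has_real_derivative - w (\<rho>, \<xi>2)) (at \<rho> within X)"
    unfolding has_field_derivative_def
    by (rule has_derivative_transform[OF \<rho>X(1) const d[unfolded has_field_derivative_def]])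
       (use lt in \<open>auto simp: Y_def\<close>)
  ultimately have "- w (\<rho>, \<xi>1) = - w (\<rho>, \<xi>2)"
    using at_within_interior[OF \<rho>X(2)] by (metis DERIV_unique)
  then show ?thesis by simp
qed

lemma w_indep: assumes "\<rho> \<in> half" shows "w (\<rho>, \<xi>) = w (\<rho>, \<xi>')"
proof -
  have "(\<rho>, \<xi>) \<in> CI" for \<xi> using assms half_CI by blast
  then show ?thesis using w_const[of \<rho>] by (metis linorder_less_linear)
qed

lemma J_sign: "(\<forall>q\<in>half \<times> UNIV. J q > 0) \<or> (\<forall>q\<in>half \<times> UNIV. J q < 0)"
proof -
  have "(\<forall>q\<in>half \<times> UNIV. J q > 0) \<or> (\<forall>q\<in>half \<times> UNIV. J q < - 0)"
  proof (rule connected_abs_greater_imp_sign)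
    show "connected (half \<times> (UNIV :: real set))" unfolding half_def by (intro connected_Times) auto
    show "continuous_on (half \<times> UNIV) J" by (rule continuous_on_subset[OF J_cont half_CR])
    show "0 < \<bar>J q\<bar>" if "q \<in> half \<times> UNIV" for q
    proof -
      have "q \<in> CR" using that half_CR by blast
      then show ?thesis using abs_J[of q] E_pos[of q] by simp
    qed
  qed simp
  then show ?thesis by simp
qed

end

section \<open>The tube inequality\<close>

locale front_tube = front bc \<kappa> v0 H U M f u \<theta> + stream_tube bc H K u D
  for bc :: bdry_cond and \<kappa> v0 H U M K :: real and f :: "real \<Rightarrow> real"
    and u :: "real \<times> real \<Rightarrow> real \<times> real" and \<theta> :: "real \<times> real \<Rightarrow> real" and D :: tube +
  fixes \<alpha> \<beta> cf :: real and g g' G :: "real \<Rightarrow> real"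
  assumes \<alpha>\<beta>: "0 < \<alpha>" "\<alpha> < \<beta>" "\<beta> < 1" "cf > 0"
    and G_deriv: "\<And>s. s \<in> {0..1} \<Longrightarrow> (G has_real_derivative g s) (at s)"
    and g_deriv: "\<And>s. (g has_real_derivative g' s) (at s)" and g'_cont: "continuous_on UNIV g'"
    and G0: "\<And>s. s \<in> {0..\<alpha>} \<Longrightarrow> G s = 0" and G1: "\<And>s. s \<in> {\<beta>..1} \<Longrightarrow> G s = 1"
    and g_nonneg: "\<And>s. 0 \<le> g s" and g_zero: "\<And>s. s \<notin> {\<alpha>..\<beta>} \<Longrightarrow> g s = 0"
    and g_sq: "\<And>s. s \<in> {0..1} \<Longrightarrow> (g s)\<^sup>2 \<le> cf * f s"
    and g_le: "\<And>s. s \<in> {0..1} \<Longrightarrow> g s \<le> cf" and g'_le: "\<And>s. s \<in> {0..1} \<Longrightarrow> \<bar>g' s\<bar> \<le> cf"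
begin

section \<open>The cutoff across a tube\<close>

definition "\<nu> r = 2 * (r - c) / h"
text \<open>As \<open>r\<close> runs over \<open>half\<close>, \<nu> runs from -1 to 1; the outer
  square makes the derivative vanish at both ends, so the extension by zero is
  \<open>C1\<close>.\<close>

definition "\<phi> r = (max 0 (1 - (\<nu> r)\<^sup>2))\<^sup>2"
definition "\<phi>' r = 2 * max 0 (1 - (\<nu> r)\<^sup>2) * (- 4 * \<nu> r / h)"

lemma abs_\<nu>: "\<bar>\<nu> r\<bar> = 2 * \<bar>r - c\<bar> / h"
  unfolding \<nu>_def abs_divide abs_mult using h by simp

lemma half_iff: "r \<in> half \<longleftrightarrow> 2 * \<bar>r - c\<bar> \<le> h"
proof
  assume "r \<in> half"
  then have "r - c \<le> h / 2" "- (r - c) \<le> h / 2" by (auto simp: half_def)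
  then have "\<bar>r - c\<bar> \<le> h / 2" by (rule abs_leI)
  then show "2 * \<bar>r - c\<bar> \<le> h" by simp
next
  assume "2 * \<bar>r - c\<bar> \<le> h"
  then have "\<bar>r - c\<bar> \<le> h / 2" by simp
  from abs_le_D1[OF this] abs_le_D2[OF this] show "r \<in> half" by (simp add: half_def)
qed

lemma \<nu>_cont: "continuous_on A \<nu>"
  unfolding \<nu>_def using h by (intro continuous_intros) auto

lemma \<phi>_deriv: "(\<phi> has_real_derivative \<phi>' r) (at r)"
proof -
  have "(\<nu> has_real_derivative 2 / h) (at r)"
    unfolding \<nu>_def using h by (auto intro!: derivative_eq_intros)
  then have "((\<lambda>r. 1 - (\<nu> r)\<^sup>2) has_real_derivative - 4 * \<nu> r / h) (at r)"
    by (auto intro!: derivative_eq_intros)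
  then show ?thesis unfolding \<phi>_def \<phi>'_def by (rule DERIV_chain2[OF max_zero_square_has_derivative])
qed

lemma \<phi>'_cont: "continuous_on A \<phi>'"
  unfolding \<phi>'_def using h by (intro continuous_intros \<nu>_cont) auto

lemma \<phi>_cont: "continuous_on A \<phi>"
  unfolding \<phi>_def by (intro continuous_intros \<nu>_cont)

lemma \<phi>_out: "r \<notin> half \<Longrightarrow> \<phi> r = 0" "r \<notin> half \<Longrightarrow> \<phi>' r = 0"
proof -
  assume r: "r \<notin> half"
  then have "h < 2 * \<bar>r - c\<bar>" by (simp add: half_iff)
  then have "1 < \<bar>\<nu> r\<bar>" using h unfolding abs_\<nu> by (simp add: less_divide_eq)
  then have "1 < (\<nu> r)\<^sup>2" using one_less_power[of "\<bar>\<nu> r\<bar>" 2] by simp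
  then show "\<phi> r = 0" "\<phi>' r = 0" by (auto simp: \<phi>_def \<phi>'_def max_def)
qed

lemma \<phi>_bounds: "0 \<le> \<phi> r" "\<phi> r \<le> 1" "\<bar>\<phi>' r\<bar> \<le> 8 / h"
proof -
  define m where "m = max 0 (1 - (\<nu> r)\<^sup>2)"
  have m: "0 \<le> m" "m \<le> 1" by (auto simp: m_def)
  show "0 \<le> \<phi> r" "\<phi> r \<le> 1" using m by (auto simp: \<phi>_def power_le_one simp flip: m_def)
  show "\<bar>\<phi>' r\<bar> \<le> 8 / h"
  proof (cases "r \<in> half")
    case True
    then have "2 * \<bar>r - c\<bar> \<le> h" by (simp add: half_iff)
    then have r: "\<bar>\<nu> r\<bar> \<le> 1" using h unfolding abs_\<nu> by (simp add: divide_le_eq)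
    have "\<bar>\<phi>' r\<bar> = 2 * m * (4 * \<bar>\<nu> r\<bar> / h)"
      using m h by (simp add: \<phi>'_def abs_mult flip: m_def)
    also have "\<dots> \<le> 2 * 1 * (4 * 1 / h)"
      using m r h by (intro mult_mono divide_right_mono) auto
    finally show ?thesis by simp
  next
    case False
    then show ?thesis using \<phi>_out h by simp
  qed
qed

lemma \<phi>_integral: "h / 4 \<le> integral half \<phi>"
proof -
  \<comment> \<open>The cutoff is at least 9/16 on this interval of length
    \<open>h / 2\<close>.\<close>
  have "integral {c - h/4..c + h/4} (\<lambda>_. 1 / 2) \<le> integral {c - h/4..c + h/4} \<phi>"
  proof (rule integral_le)
    fix r assume "r \<in> {c - h/4..c + h/4}"
    then have "r - c \<le> h / 4" "- (r - c) \<le> h / 4" by auto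
    then have "\<bar>r - c\<bar> \<le> h / 4" by (rule abs_leI)
    then have "4 * \<bar>r - c\<bar> \<le> h" by simp
    then have "\<bar>\<nu> r\<bar> \<le> 1/2" using h unfolding abs_\<nu> by (simp add: divide_le_eq)
    then have "(\<nu> r)\<^sup>2 \<le> (1/2)\<^sup>2" by (metis abs_ge_zero power2_abs power_mono)
    then have "(\<nu> r)\<^sup>2 \<le> 1/4" by (simp add: power2_eq_square)
    then have "3/4 \<le> max 0 (1 - (\<nu> r)\<^sup>2)" by simp
    then have "(3/4)\<^sup>2 \<le> \<phi> r" unfolding \<phi>_def by (rule power_mono) simp
    then show "1 / 2 \<le> \<phi> r" by (simp add: power2_eq_square)
  qed (auto intro: integrable_continuous_real \<phi>_cont)
  also have "\<dots> \<le> integral half \<phi>"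
    by (rule integral_subset_le) (use h \<phi>_bounds in \<open>auto simp: half_def intro: integrable_continuous_real \<phi>_cont\<close>)
  finally show ?thesis using h by simp
qed

lemma OT_S: "OT \<subseteq> S" using O_region region_subset by blast

definition "\<Phi> p = (if p \<in> OT then \<phi> (fst (coords D p)) else 0)"
definition "d\<Phi> p v = (if p \<in> OT then \<phi>' (fst (coords D p)) * fst (DC p v) else 0)"

lemma core_OT: "core \<subseteq> OT" by (auto simp: core_def)

lemma off_core: "p \<notin> core \<Longrightarrow> \<Phi> p = 0" "p \<notin> core \<Longrightarrow> d\<Phi> p v = 0"
  by (auto simp: \<Phi>_def d\<Phi>_def core_def \<phi>_out)

text \<open>Inside the tube this is the chain rule; elsewhere the point lies in the open complement
  of the core, where \<Phi> vanishes identically. The boundary of the tube thus needs no separate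
  case.\<close>

lemma \<Phi>_deriv: "(\<Phi> has_derivative d\<Phi> p) (at p)"
proof (cases "p \<in> OT")
  case True
  have "((\<lambda>p. \<phi> (fst (coords D p))) has_derivative (\<lambda>v. fst (DC p v) * \<phi>' (fst (coords D p)))) (at p)"
    by (rule has_derivative_compose[OF has_derivative_fst[OF coords_deriv[OF True]]])
       (use \<phi>_deriv in \<open>simp add: has_field_derivative_def mult_commute_abs\<close>)
  moreover have "d\<Phi> p = (\<lambda>v. fst (DC p v) * \<phi>' (fst (coords D p)))" using True by (auto simp: d\<Phi>_def)
  ultimately have "((\<lambda>p. \<phi> (fst (coords D p))) has_derivative d\<Phi> p) (at p)" by simp
  then show ?thesis
    by (rule has_derivative_transform_within_open[OF _ open_O True]) (simp add: \<Phi>_def)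
next
  case False
  then have p: "p \<in> - core" using core_OT by blast
  have "((\<lambda>_. 0) has_derivative d\<Phi> p) (at p)"
    using False by (simp add: d\<Phi>_def[abs_def])
  then show ?thesis
    by (rule has_derivative_transform_within_open[OF _ open_Compl[OF closed_core] p]) (simp add: off_core)
qed

lemma linear_d\<Phi>: "linear (d\<Phi> p)"
  using has_derivative_linear[OF \<Phi>_deriv] .

lemma d\<Phi>_bound: "\<bar>d\<Phi> p v\<bar> \<le> 8 * K / h * norm v"
proof (cases "p \<in> OT")
  case True
  have "\<bar>fst (DC p v)\<bar> \<le> K * norm v"
    using norm_DC[OF True, of v] norm_fst_le[of "fst (DC p v)" "snd (DC p v)"] by simp
  then have "\<bar>\<phi>' (fst (coords D p))\<bar> * \<bar>fst (DC p v)\<bar> \<le> 8 / h * (K * norm v)"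
    using \<phi>_bounds(3) h by (intro mult_mono) auto
  then show ?thesis using True by (simp add: d\<Phi>_def abs_mult)
qed (use h K in \<open>simp add: d\<Phi>_def\<close>)

text \<open>\<open>OT\<close> and the complement of the core are an open cover of the plane.\<close>

lemma continuous_by_gluing:
  fixes k :: "real \<times> real \<Rightarrow> real"
  assumes "continuous_on OT k" "\<And>p. p \<notin> core \<Longrightarrow> k p = 0"
  shows "continuous_on A k"
proof -
  have "continuous_on (- core) k"
    by (rule continuous_on_eq[OF continuous_on_const[of _ 0]]) (use assms(2) in auto)
  then have "continuous_on (OT \<union> - core) k"
    by (intro continuous_on_open_Un open_O open_Compl closed_core assms(1))
  then show ?thesis using core_OT by (auto intro: continuous_on_subset)
qed

lemma \<Phi>_cont: "continuous_on A \<Phi>"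
  by (rule has_derivative_continuous_on) (rule has_derivative_at_withinI[OF \<Phi>_deriv])

lemma DC_cont: "continuous_on OT (\<lambda>p. DC p v)"
proof -
  obtain A where A: "\<And>p. p \<in> region D \<Longrightarrow> (coords D has_derivative blinfun_apply (A p)) (at p within region D)"
    and cA: "C1_on (region D) A" using coords_C2 unfolding C2_on_def by blast
  have "DC p = blinfun_apply (A p)" if p: "p \<in> OT" for p
    using A[of p] coords_deriv[OF p] at_within_open_subset[OF p open_O O_region] p O_region
    by (metis has_derivative_unique subsetD)
  moreover have "continuous_on OT (\<lambda>p. blinfun_apply (A p) v)"
    by (intro continuous_intros continuous_on_subset[OF C1_on_imp_continuous_on[OF cA] O_region])
  ultimately show ?thesis by (simp cong: continuous_on_cong)
qed

lemma d\<Phi>_cont: "continuous_on A (\<lambda>p. d\<Phi> p v)"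
proof (rule continuous_by_gluing)
  have "continuous_on OT (\<lambda>p. \<phi>' (fst (coords D p)) * fst (DC p v))"
    by (intro continuous_intros DC_cont continuous_on_compose2[OF \<phi>'_cont[of UNIV]] coords_cont) auto
  then show "continuous_on OT (\<lambda>p. d\<Phi> p v)" by (simp add: d\<Phi>_def cong: continuous_on_cong)
qed (rule off_core)

lemma g_cont: "continuous_on A g"
  using g_deriv by (meson DERIV_isCont continuous_at_imp_continuous_on)

lemma cont_OT:
  "continuous_on OT \<theta>" "continuous_on OT (D1 \<theta>)" "continuous_on OT (D2 \<theta>)"
  "continuous_on OT (D1 (D1 \<theta>))" "continuous_on OT (D2 (D2 \<theta>))" "continuous_on OT u1" "continuous_on OT u2"
  "continuous_on OT F" "continuous_on OT E" "continuous_on OT \<tau>"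
  "continuous_on OT (\<lambda>p. g (\<theta> p))" "continuous_on OT (\<lambda>p. g' (\<theta> p))"
proof -
  note s = continuous_on_subset[OF _ OT_S]
  show c: "continuous_on OT \<theta>" by (rule s[OF cont_\<theta>])
  show "continuous_on OT (D1 \<theta>)" "continuous_on OT (D2 \<theta>)"
    "continuous_on OT (D1 (D1 \<theta>))" "continuous_on OT (D2 (D2 \<theta>))" "continuous_on OT u1" "continuous_on OT u2"
    "continuous_on OT F" "continuous_on OT E" "continuous_on OT \<tau>"
    by (rule s[OF cont_D1] s[OF cont_D2] s[OF cont_D11] s[OF cont_D22] s[OF cont_u1] s[OF cont_u2]
        s[OF cont_F] s[OF cont_E] s[OF cont_\<tau>])+
  show "continuous_on OT (\<lambda>p. g (\<theta> p))" "continuous_on OT (\<lambda>p. g' (\<theta> p))"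
    by (rule continuous_on_compose2[OF g_cont[of UNIV] c] continuous_on_compose2[OF g'_cont c]; simp)+
qed

lemma at_cross_section: assumes "(x, y) \<in> OT" shows "y \<in> cross_section bc H" "at y within cross_section bc H = at y"
proof -
  show "y \<in> cross_section bc H" using assms OT_S by (auto simp: domain_eq)
  obtain A B where AB: "open A" "open B" "x \<in> A" "y \<in> B" "A \<times> B \<subseteq> OT"
    using open_prod_elim[OF open_O assms] by (metis mem_Sigma_iff)
  have "B \<subseteq> cross_section bc H" using AB OT_S by (auto simp: domain_eq)
  then show "at y within cross_section bc H = at y"
    using at_within_open_subset[OF AB(4,2)] by blast
qed

lemma \<theta>_slices_OT:
  assumes "(x, y) \<in> OT"
  shows "((\<lambda>x. \<theta> (x, y)) has_real_derivative D1 \<theta> (x, y)) (at x)"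
    "((\<lambda>x. D1 \<theta> (x, y)) has_real_derivative D1 (D1 \<theta>) (x, y)) (at x)"
    "((\<lambda>y. \<theta> (x, y)) has_real_derivative D2 \<theta> (x, y)) (at y)"
    "((\<lambda>y. D2 \<theta> (x, y)) has_real_derivative D2 (D2 \<theta>) (x, y)) (at y)"
  using C2_slices[OF H C2 at_cross_section(1)[OF assms], of x] at_cross_section(2)[OF assms] by simp_all

definition "\<Phi>1 p = d\<Phi> p (1, 0)"
definition "\<Phi>2 p = d\<Phi> p (0, 1)"

lemma d\<Phi>_grad: "d\<Phi> p (a, b) = a * \<Phi>1 p + b * \<Phi>2 p"
proof -
  have "d\<Phi> p (a *\<^sub>R (1, 0) + b *\<^sub>R (0, 1)) = a * \<Phi>1 p + b * \<Phi>2 p"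
    unfolding linear_add[OF linear_d\<Phi>] linear_scale[OF linear_d\<Phi>] by (simp add: \<Phi>1_def \<Phi>2_def)
  then show ?thesis by simp
qed

lemma \<Phi>12_cont: "continuous_on A \<Phi>1" "continuous_on A \<Phi>2"
  unfolding \<Phi>1_def \<Phi>2_def by (rule d\<Phi>_cont)+

lemma \<Phi>12_off: "p \<notin> core \<Longrightarrow> \<Phi>1 p = 0" "p \<notin> core \<Longrightarrow> \<Phi>2 p = 0"
  unfolding \<Phi>1_def \<Phi>2_def by (rule off_core(2); simp)+

lemma \<Phi>_slices:
  "((\<lambda>x. \<Phi> (x, y)) has_real_derivative \<Phi>1 (x, y)) (at x)"
  "((\<lambda>y. \<Phi> (x, y)) has_real_derivative \<Phi>2 (x, y)) (at y)"
proof -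
  have "d\<Phi> (x, y) = (\<lambda>v. fst v * \<Phi>1 (x, y) + snd v * \<Phi>2 (x, y))"
  proof
    fix v show "d\<Phi> (x, y) v = fst v * \<Phi>1 (x, y) + snd v * \<Phi>2 (x, y)"
      using d\<Phi>_grad[of "(x, y)" "fst v" "snd v"] by simp
  qed
  then have "(\<Phi> has_derivative (\<lambda>v. fst v * \<Phi>1 (x, y) + snd v * \<Phi>2 (x, y)))
      (at (x, y) within UNIV \<times> UNIV)" using \<Phi>_deriv[of "(x, y)"] by simp
  from has_derivative_slices[OF this]
  show "((\<lambda>x. \<Phi> (x, y)) has_real_derivative \<Phi>1 (x, y)) (at x)"
    "((\<lambda>y. \<Phi> (x, y)) has_real_derivative \<Phi>2 (x, y)) (at y)" by simp_all
qed

text \<open>\<open>k\<close> is the transport term tested with \<Phi> times \<open>g\<close> of the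
  temperature, and \<open>V\<close> collects the rest: by the equation, \<open>k + V\<close> is the
  divergence of \<kappa> \<Phi> g(\<theta>) grad \<theta>.\<close>

definition "k p = \<Phi> p * g (\<theta> p) * (u1 p * D1 \<theta> p + u2 p * D2 \<theta> p)"
definition "V p = \<kappa> * (g (\<theta> p) * d\<Phi> p (D1 \<theta> p, D2 \<theta> p)) + \<kappa> * (\<Phi> p * g' (\<theta> p) * E p)
  + \<Phi> p * g (\<theta> p) * (\<tau> p - F p)"

lemma k_cont: "continuous_on A k"
proof (rule continuous_by_gluing)
  show "continuous_on OT k" unfolding k_def by (intro continuous_intros cont_OT \<Phi>_cont)
qed (simp add: k_def off_core)

lemma V_cont: "continuous_on A V"
proof (rule continuous_by_gluing)
  show "continuous_on OT V" unfolding V_def d\<Phi>_grad by (intro continuous_intros cont_OT \<Phi>_cont \<Phi>12_cont)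
qed (simp add: V_def off_core)

text \<open>The square may exceed the domain, and a lifted periodic tube may leave the strip; off
  the core every term carries a vanishing factor \<Phi> or derivative of it. The hypothesis
  \<open>out\<close> makes the flux vanish on the sides of the square.\<close>

lemma tested_equation:
  assumes R: "R > 0" and out: "\<And>p. \<Phi> p * g (\<theta> p) \<noteq> 0 \<Longrightarrow> \<bar>fst p\<bar> < R \<and> \<bar>snd p\<bar> < R"
  shows "integral (cbox (- R, - R) (R, R)) k = - integral (cbox (- R, - R) (R, R)) V"
proof -
  let ?B = "cbox (- R, - R) (R, R)"
  define X1 where "X1 p = \<kappa> * (\<Phi> p * g (\<theta> p) * D1 \<theta> p)" for p
  define X2 where "X2 p = \<kappa> * (\<Phi> p * g (\<theta> p) * D2 \<theta> p)" for p
  define Y1 where "Y1 p = \<kappa> * (\<Phi>1 p * g (\<theta> p) * D1 \<theta> p + \<Phi> p * g' (\<theta> p) * (D1 \<theta> p)\<^sup>2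
     + \<Phi> p * g (\<theta> p) * D1 (D1 \<theta>) p)" for p
  define Y2 where "Y2 p = \<kappa> * (\<Phi>2 p * g (\<theta> p) * D2 \<theta> p + \<Phi> p * g' (\<theta> p) * (D2 \<theta> p)\<^sup>2
     + \<Phi> p * g (\<theta> p) * D2 (D2 \<theta>) p)" for p
  have c: "continuous_on A Y1" "continuous_on A Y2" for A
    by (rule continuous_by_gluing;
        (unfold Y1_def Y2_def; intro continuous_intros cont_OT \<Phi>_cont \<Phi>12_cont | simp add: Y1_def Y2_def off_core \<Phi>12_off))+
  have nc: "open (- core)" using closed_core by blast
  have "integral ?B (\<lambda>p. Y1 p + Y2 p) = integral {- R..R} (\<lambda>y. X1 (R, y) - X1 (- R, y)) + integral {- R..R} (\<lambda>x. X2 (x, R) - X2 (x, - R))"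
  proof (rule integral_divergence_box)
    fix x y :: real
    have "((\<lambda>x. X1 (x, y)) has_real_derivative Y1 (x, y)) (at x)"
    proof (cases "(x, y) \<in> OT")
      case True
      note s = \<theta>_slices_OT[OF True] \<Phi>_slices DERIV_chain2[OF g_deriv \<theta>_slices_OT(1)[OF True]]
      show ?thesis unfolding X1_def Y1_def
        by (rule derivative_eq_intros s refl | simp)+ (simp add: algebra_simps power2_eq_square)
    next
      case False
      then have p: "(x, y) \<in> - core" using core_OT by blast
      have "((\<lambda>x. 0) has_real_derivative Y1 (x, y)) (at x)" using p by (simp add: Y1_def off_core \<Phi>12_off)
      then show ?thesis
        by (rule has_field_derivative_transform_within_open[where S = "(\<lambda>x. (x, y)) -` (- core)"])
           (use p in \<open>auto simp: X1_def off_core intro!: open_vimage nc continuous_intros\<close>)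
    qed
    then show "((\<lambda>x. X1 (x, y)) has_real_derivative Y1 (x, y)) (at x within {- R..R})"
      by (rule has_field_derivative_at_within)
    have "((\<lambda>y. X2 (x, y)) has_real_derivative Y2 (x, y)) (at y)"
    proof (cases "(x, y) \<in> OT")
      case True
      note s = \<theta>_slices_OT[OF True] \<Phi>_slices DERIV_chain2[OF g_deriv \<theta>_slices_OT(3)[OF True]]
      show ?thesis unfolding X2_def Y2_def
        by (rule derivative_eq_intros s refl | simp)+ (simp add: algebra_simps power2_eq_square)
    next
      case False
      then have p: "(x, y) \<in> - core" using core_OT by blast
      have "((\<lambda>y. 0) has_real_derivative Y2 (x, y)) (at y)" using p by (simp add: Y2_def off_core \<Phi>12_off)
      then show ?thesis
        by (rule has_field_derivative_transform_within_open[where S = "(\<lambda>y. (x, y)) -` (- core)"])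
           (use p in \<open>auto simp: X2_def off_core intro!: open_vimage nc continuous_intros\<close>)
    qed
    then show "((\<lambda>y. X2 (x, y)) has_real_derivative Y2 (x, y)) (at y within {- R..R})"
      by (rule has_field_derivative_at_within)
  qed (use R c in auto)
  moreover have "X1 (R, y) = 0" "X1 (- R, y) = 0" "X2 (x, R) = 0" "X2 (x, - R) = 0" for x y
    using out[of "(R, y)"] out[of "(- R, y)"] out[of "(x, R)"] out[of "(x, - R)"] R
    by (auto simp: X1_def X2_def)
  ultimately have "integral ?B (\<lambda>p. Y1 p + Y2 p) = 0" by simp
  moreover have "Y1 p + Y2 p = k p + V p" for p
    unfolding Y1_def Y2_def k_def V_def d\<Phi>_grad \<tau>_def E_def by (simp add: algebra_simps)
  ultimately have "integral ?B (\<lambda>p. k p + V p) = 0" by simp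
  then show ?thesis
    using integral_add[OF integrable_continuous[OF k_cont] integrable_continuous[OF V_cont], of "(- R, - R)" "(R, R)"]
    by simp
qed

text \<open>\<open>4 * K\<close> is half of the \<open>8 * K\<close> from
  \<open>d\<Phi>_bound\<close>, the half coming from Young's inequality; \<open>cf + 1\<close>
  majorises the coefficients of \<open>F\<close> and of \<open>\<kappa> * E\<close>; the added 1
  serves the terms without a derivative of the cutoff.\<close>

definition "C2 = (4 * K + 1) * (cf + 1)"

lemma V_bound:
  "\<bar>V p\<bar> \<le> C2 * (1 + (\<kappa> / v0) / h) * n p" if p: "p \<in> OT"
proof -
  have pS: "p \<in> S" using p OT_S by blast
  have \<theta>: "\<theta> p \<in> {0..1}" using range[OF pS] by simp
  define l where "l = (\<kappa> / v0) / h"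
  have l: "l \<ge> 0" using \<kappa> v0 h by (simp add: l_def)
  note nn = \<tau>_nonneg[OF pS] F_nonneg[OF pS] E_nonneg[of p]
  have \<Phi>: "0 \<le> \<Phi> p" "\<Phi> p \<le> 1" using \<phi>_bounds by (auto simp: \<Phi>_def)
  have kE: "0 \<le> \<kappa> * E p" using nn \<kappa> by simp
  have norm_grad: "norm (D1 \<theta> p, D2 \<theta> p) = sqrt (E p)" by (simp add: norm_prod_def E_def)
  have "\<bar>\<kappa> * (g (\<theta> p) * d\<Phi> p (D1 \<theta> p, D2 \<theta> p))\<bar> = \<kappa> * (g (\<theta> p) * \<bar>d\<Phi> p (D1 \<theta> p, D2 \<theta> p)\<bar>)"
    using \<kappa> g_nonneg[of "\<theta> p"] by (simp add: abs_mult)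
  also have "\<dots> \<le> \<kappa> * (g (\<theta> p) * (8 * K / h * sqrt (E p)))"
    using d\<Phi>_bound[of p "(D1 \<theta> p, D2 \<theta> p)", unfolded norm_grad] \<kappa> g_nonneg[of "\<theta> p"]
    by (intro mult_left_mono) auto
  \<comment> \<open>Splitting off \<open>v0\<close> prepares Young's inequality and leaves the ratio
    of \<open>\<kappa> / v0\<close> to \<open>h\<close>, which arises only here.\<close>
  also have "\<dots> = 8 * K * l * (v0 * (g (\<theta> p) * sqrt (E p)))" using v0 h by (simp add: l_def field_simps)
  also have "\<dots> \<le> 8 * K * l * ((cf * F p + \<kappa> * E p) / 2)"
    using young_reaction_diffusion[OF g_sq[OF \<theta>], of "sqrt (E p)"] nn g_nonneg K l
    by (intro mult_left_mono) auto
  also have "\<dots> \<le> 8 * K * l * ((cf + 1) * n p / 2)"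
  proof -
    have "cf * F p \<le> (cf + 1) * (F p + \<tau> p)" using nn \<alpha>\<beta>(4) by (intro mult_mono) auto
    moreover have "1 * (\<kappa> * E p) \<le> (cf + 1) * (\<kappa> * E p)" using \<alpha>\<beta>(4) kE by (intro mult_right_mono) auto
    ultimately have "cf * F p + \<kappa> * E p \<le> (cf + 1) * (F p + \<tau> p) + (cf + 1) * (\<kappa> * E p)" by simp
    then have "cf * F p + \<kappa> * E p \<le> (cf + 1) * n p" by (simp add: n_def algebra_simps)
    then show ?thesis using K l by (intro mult_left_mono divide_right_mono) auto
  qed
  finally have 1: "\<bar>\<kappa> * (g (\<theta> p) * d\<Phi> p (D1 \<theta> p, D2 \<theta> p))\<bar> \<le> 4 * K * l * ((cf + 1) * n p)" by simp
  have "\<bar>\<Phi> p * g' (\<theta> p)\<bar> \<le> 1 * cf" unfolding abs_mult using \<Phi> g'_le[OF \<theta>] by (intro mult_mono) auto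
  then have "\<bar>\<Phi> p * g' (\<theta> p)\<bar> * (\<kappa> * E p) \<le> cf * (\<kappa> * E p)" using kE by (intro mult_right_mono) auto
  then have 2: "\<bar>\<kappa> * (\<Phi> p * g' (\<theta> p) * E p)\<bar> \<le> cf * (\<kappa> * E p)"
    using kE nn \<kappa> by (simp add: abs_mult mult_ac)
  have "\<bar>\<Phi> p * g (\<theta> p)\<bar> \<le> 1 * cf" unfolding abs_mult using \<Phi> g_le[OF \<theta>] g_nonneg[of "\<theta> p"] by (intro mult_mono) auto
  moreover have "\<bar>\<tau> p - F p\<bar> \<le> \<tau> p + F p" using nn by linarith
  ultimately have 3: "\<bar>\<Phi> p * g (\<theta> p) * (\<tau> p - F p)\<bar> \<le> cf * (\<tau> p + F p)"
    unfolding abs_mult[of "\<Phi> p * g (\<theta> p)"] by (intro mult_mono) auto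
  have n0: "0 \<le> n p" using nn kE by (simp add: n_def)
  have "\<bar>V p\<bar> \<le> 4 * K * l * ((cf + 1) * n p) + cf * n p"
    using 1 2 3 unfolding V_def by (simp add: n_def algebra_simps)
  also have "\<dots> \<le> C2 * (1 + l) * n p"
  proof -
    have "C2 * (1 + l) * n p - (4 * K * l * ((cf + 1) * n p) + cf * n p)
        = 4 * K * (cf + 1) * n p + (cf + 1) * l * n p + n p" by (simp add: C2_def algebra_simps)
    moreover have "0 \<le> 4 * K * (cf + 1) * n p + (cf + 1) * l * n p + n p"
      using K \<alpha>\<beta>(4) l n0 by (intro add_nonneg_nonneg mult_nonneg_nonneg) auto
    ultimately show ?thesis by simp
  qed
  finally show ?thesis by (simp add: l_def)
qed

lemma V_off: "p \<notin> OT \<Longrightarrow> V p = 0"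
proof -
  assume "p \<notin> OT"
  then have "p \<notin> core" using core_OT by blast
  then show ?thesis by (simp add: V_def off_core)
qed

lemma integral_k_upper:
  assumes R: "R > 0" and out: "\<And>p. \<Phi> p * g (\<theta> p) \<noteq> 0 \<Longrightarrow> \<bar>fst p\<bar> < R \<and> \<bar>snd p\<bar> < R"
  shows "ennreal \<bar>integral (cbox (- R, - R) (R, R)) k\<bar>
    \<le> (\<integral>\<^sup>+ p. ennreal (C2 * (1 + (\<kappa> / v0) / h)) * (ennreal (n p) * indicator OT p) \<partial>lborel)"
proof -
  let ?B = "cbox (- R, - R) (R, R)"
  have i: "integrable lborel (\<lambda>p. indicator ?B p *\<^sub>R \<bar>V p\<bar>)"
    by (intro borel_integrable_compact compact_cbox continuous_intros V_cont)
  then have si: "set_integrable lborel ?B (\<lambda>p. \<bar>V p\<bar>)" by (simp add: set_integrable_def)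
  have "\<bar>integral ?B k\<bar> = \<bar>integral ?B V\<bar>" using tested_equation[OF R out] by simp
  also have "\<dots> \<le> integral ?B (\<lambda>p. \<bar>V p\<bar>)"
    by (rule abs_integral_le) (auto intro!: integrable_continuous continuous_intros V_cont)
  also have "\<dots> = (\<integral>p. indicator ?B p *\<^sub>R \<bar>V p\<bar> \<partial>lborel)"
    using set_borel_integral_eq_integral(2)[OF si] by (simp add: set_lebesgue_integral_def)
  finally have "ennreal \<bar>integral ?B k\<bar> \<le> ennreal (\<integral>p. indicator ?B p *\<^sub>R \<bar>V p\<bar> \<partial>lborel)"
    by (rule ennreal_leI)
  also have "\<dots> = (\<integral>\<^sup>+ p. ennreal (indicator ?B p *\<^sub>R \<bar>V p\<bar>) \<partial>lborel)"
    by (rule nn_integral_eq_integral[symmetric, OF i]) simp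
  also have "\<dots> \<le> (\<integral>\<^sup>+ p. ennreal (C2 * (1 + (\<kappa> / v0) / h)) * (ennreal (n p) * indicator OT p) \<partial>lborel)"
  proof (rule nn_integral_mono)
    fix p
    have C: "0 \<le> C2 * (1 + (\<kappa> / v0) / h)"
      using K \<alpha>\<beta>(4) \<kappa> v0 h by (auto simp: C2_def)
    show "ennreal (indicator ?B p *\<^sub>R \<bar>V p\<bar>) \<le> ennreal (C2 * (1 + (\<kappa> / v0) / h)) * (ennreal (n p) * indicator OT p)"
    proof (cases "p \<in> OT")
      case True
      have "indicator ?B p *\<^sub>R \<bar>V p\<bar> \<le> \<bar>V p\<bar>" by (simp add: indicator_def)
      also have "\<dots> \<le> C2 * (1 + (\<kappa> / v0) / h) * n p" by (rule V_bound[OF True])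
      finally show ?thesis using True C by (simp add: ennreal_mult'[symmetric] ennreal_leI)
    qed (simp add: V_off)
  qed
  finally show ?thesis .
qed

text \<open>In coordinates \<open>u\<close> is \<open>a\<close> times \<open>P\<xi>\<close> and
  \<open>w\<close> is \<open>a\<close> times \<open>J\<close>, so the Jacobian turns
  \<open>k\<close> into \<phi> times \<open>w\<close> times the \<xi>-derivative of \<open>G\<close>
  of the temperature, which increases or decreases between 0 and 1 in total. The signs
  \<open>s\<close>, \<open>e\<close>, \<open>z\<close> record the orientation of the chart, of the
  tube and of the flux. The bound is \<open>W / 2\<close> times the mass \<open>h / 4\<close> of
  \<phi>.\<close>

lemma integral_k_lower:
  assumes W: "W > 0" "\<And>q. q \<in> CR \<Longrightarrow> W / 2 \<le> weighted_speed u D q"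
  obtains R where "R > 0" "\<And>p. \<Phi> p * g (\<theta> p) \<noteq> 0 \<Longrightarrow> \<bar>fst p\<bar> < R \<and> \<bar>snd p\<bar> < R"
    "W * h / 8 \<le> \<bar>integral (cbox (- R, - R) (R, R)) k\<bar>"
proof -
  obtain X where X: "X > 0" "\<And>x y. (x, y) \<in> S \<Longrightarrow> x \<ge> X \<Longrightarrow> \<theta> (x, y) < \<alpha>"
    "\<And>x y. (x, y) \<in> S \<Longrightarrow> x \<le> - X \<Longrightarrow> \<beta> < \<theta> (x, y)" using far_field[OF \<alpha>\<beta>(1,3)] by metis
  obtain \<Xi> where \<Xi>: "\<Xi> > 0" "\<And>\<rho> \<xi>. \<rho> \<in> half \<Longrightarrow> \<bar>\<xi>\<bar> \<ge> \<Xi> \<Longrightarrow> \<bar>P1 (\<rho>, \<xi>)\<bar> > X" using proper by blast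
  define Q0 where "Q0 = cbox (c - h/2, - \<Xi>) (c + h/2, \<Xi>)"
  have Q0: "Q0 = half \<times> {- \<Xi>..\<Xi>}" by (simp add: Q0_def half_def cbox_Pair_eq)
  have Q0_CI: "Q0 \<subseteq> CI" using half_CI by (auto simp: Q0)
  have Q0_CR: "Q0 \<subseteq> CR" using Q0_CI CI_CR by blast
  have cP: "continuous_on Q0 P" by (rule continuous_on_subset[OF P_cont Q0_CR])
  have comp: "compact (P ` Q0)" by (rule compact_continuous_image[OF cP]) (simp add: Q0_def)
  have PQ0: "P ` Q0 \<subseteq> OT" using P_O Q0_CI by blast
  \<comment> \<open>Where \<open>g\<close> of the temperature is nonzero, \<theta> stays away from
    both limits; so \<open>x\<close> is bounded by \<open>X\<close>, and hence \<xi> by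
    \<Xi>.\<close>
  have supp: "p \<in> P ` Q0" if "\<Phi> p * g (\<theta> p) \<noteq> 0" for p
  proof -
    have "p \<in> core" using that off_core(1)[of p] by auto
    then obtain r x where rx: "p = P (r, x)" "r \<in> half" unfolding core_eq by auto
    have "p \<in> S" using \<open>p \<in> core\<close> core_OT OT_S by blast
    have "\<theta> p \<in> {\<alpha>..\<beta>}" using g_zero that by auto
    then have "\<not> \<bar>P1 (r, x)\<bar> > X"
      using X(2,3)[of "fst p" "snd p"] \<open>p \<in> S\<close> by (auto simp: rx(1) abs_if split: if_splits)
    then have "\<not> \<bar>x\<bar> \<ge> \<Xi>" using \<Xi>(2)[OF rx(2)] by blast
    then have "x \<in> {- \<Xi>..\<Xi>}" by auto
    then show ?thesis using rx by (auto simp: Q0)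
  qed
  obtain B where B: "\<And>p. p \<in> P ` Q0 \<Longrightarrow> norm p \<le> B"
    using compact_imp_bounded[OF comp] unfolding bounded_iff by blast
  define R where "R = \<bar>B\<bar> + 1"
  have R: "R > 0" by (simp add: R_def)
  have inR: "\<bar>fst p\<bar> < R \<and> \<bar>snd p\<bar> < R" if "p \<in> P ` Q0" for p
    using B[OF that] norm_fst_le[of "fst p" "snd p"] norm_snd_le[of "snd p" "fst p"] by (auto simp: R_def)
  let ?B = "cbox (- R, - R) (R, R)"
  have sub: "P ` Q0 \<subseteq> ?B"
  proof
    fix p assume "p \<in> P ` Q0"
    from inR[OF this] show "p \<in> ?B" by (cases p) (auto simp: cbox_Pair_eq)
  qed
  obtain s :: real where s: "\<bar>s\<bar> = 1" "\<And>q. q \<in> half \<times> UNIV \<Longrightarrow> \<bar>J q\<bar> = s * J q"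
  proof -
    from J_sign show thesis
    proof
      assume J: "\<forall>q\<in>half \<times> UNIV. J q > 0"
      show thesis by (rule that[of 1]) (simp_all only: abs_of_pos[OF J[rule_format]] abs_one mult_1)
    next
      assume J: "\<forall>q\<in>half \<times> UNIV. J q < 0"
      show thesis by (rule that[of "-1"]) (simp_all only: abs_of_neg[OF J[rule_format]] abs_minus_cancel abs_one mult_minus1)
    qed
  qed
  define T2 where "T2 q = fst (P\<xi> q) * D1 \<theta> (P q) + snd (P\<xi> q) * D2 \<theta> (P q)" for q
  define X2 where "X2 q = s * \<phi> (fst q) * w (fst q, 0) * G (\<theta> (P q))" for q
  have kJ: "\<bar>J q\<bar> * k (P q) = s * \<phi> (fst q) * w (fst q, 0) * (g (\<theta> (P q)) * T2 q)" if q: "q \<in> Q0" for q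
  proof -
    have qCI: "q \<in> CI" and qh: "q \<in> half \<times> UNIV" using q Q0_CI by (auto simp: Q0)
    obtain a where a: "u (P q) = a *\<^sub>R P\<xi> q" using u_parallel[OF qCI] .
    have "w (fst q, 0) = w q" using w_indep[of "fst q" 0 "snd q"] qh by (simp add: mem_Times_iff)
    then have w: "w (fst q, 0) = a * J q" by (simp add: w_eq[OF a])
    have "\<Phi> (P q) = \<phi> (fst q)" using P_O[OF qCI] coords_P[of q] qCI CI_CR by (auto simp: \<Phi>_def)
    then have "k (P q) = \<phi> (fst q) * g (\<theta> (P q)) * (a * T2 q)"
      by (simp add: k_def a T2_def algebra_simps)
    then show ?thesis by (simp add: s(2)[OF qh] w)
  qed
  have "integral ?B k = integral ?B (\<lambda>p. if p \<in> P ` Q0 then k p else 0)"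
    by (rule integral_cong) (use supp in \<open>auto simp: k_def\<close>)
  also have "\<dots> = integral (P ` Q0) k"
    using has_integral_restrict[OF sub, of k] integrable_integral[OF set_lebesgue_integral_eq_integral(1)[OF
          absolutely_integrable_on_compact[OF comp k_cont]]] by (blast intro: integral_unique)
  also have "\<dots> = integral Q0 (\<lambda>q. \<bar>J q\<bar> * k (P q))"
  proof (rule change_of_variables_plane)
    show "(P has_derivative DP q) (at q within Q0)" if "q \<in> Q0" for q
      using P_deriv[of q] that Q0_CI has_derivative_at_withinI by blast
    show "J q = fst (DP q (1, 0)) * snd (DP q (0, 1)) - snd (DP q (1, 0)) * fst (DP q (0, 1))" for q
      by (simp add: DP_def J_def)
  qed (use Q0_CR in \<open>auto simp: Q0_def intro: inj_on_subset[OF P_inj] k_cont continuous_on_subset[OF J_cont]\<close>)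
  \<comment> \<open>Shaped for \<open>integral_divergence_box\<close> with vanishing first
    component.\<close>
  also have "\<dots> = integral Q0 (\<lambda>q. (\<lambda>_. 0) q + s * \<phi> (fst q) * w (fst q, 0) * (g (\<theta> (P q)) * T2 q))"
    by (rule integral_cong) (simp add: kJ)
  also have "\<dots> = integral {- \<Xi>..\<Xi>} (\<lambda>y. (\<lambda>_. 0) (c + h/2, y) - (\<lambda>_. 0) (c - h/2, y)) +
     integral {c - h/2..c + h/2} (\<lambda>x. X2 (x, \<Xi>) - X2 (x, - \<Xi>))"
    unfolding Q0_def
  proof (rule integral_divergence_box)
    fix x y assume xy: "x \<in> {c - h/2..c + h/2}" "y \<in> {- \<Xi>..\<Xi>}"
    then have q: "(x, y) \<in> CI" using Q0_CI by (auto simp: Q0 half_def)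
    have p: "P (x, y) \<in> OT" by (rule P_O[OF q])
    have pS: "P (x, y) \<in> S" using p OT_S by blast
    have "(\<theta> has_derivative (\<lambda>v. fst v * D1 \<theta> (P (x, y)) + snd v * D2 \<theta> (P (x, y)))) (at (P (x, y)))"
      using C1_on_has_derivative[OF two_dim_at_points_domain[OF H] C2_on_imp_C1_on[OF C2] pS]
        at_within_open_subset[OF p open_O OT_S] by simp
    from has_derivative_compose[OF P_deriv[OF q] this]
    have "((\<lambda>q. \<theta> (P q)) has_derivative (\<lambda>v. fst (DP (x, y) v) * D1 \<theta> (P (x, y)) + snd (DP (x, y) v) * D2 \<theta> (P (x, y))))
        (at (x, y))" .
    moreover have "(\<lambda>v. fst (DP (x, y) v) * D1 \<theta> (P (x, y)) + snd (DP (x, y) v) * D2 \<theta> (P (x, y)))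
        = (\<lambda>v. fst v * (fst (P\<rho> (x, y)) * D1 \<theta> (P (x, y)) + snd (P\<rho> (x, y)) * D2 \<theta> (P (x, y))) + snd v * T2 (x, y))"
      by (rule ext) (simp add: DP_def T2_def algebra_simps)
    ultimately have "((\<lambda>q. \<theta> (P q)) has_derivative (\<lambda>v. fst v * (fst (P\<rho> (x, y)) * D1 \<theta> (P (x, y)) + snd (P\<rho> (x, y)) * D2 \<theta> (P (x, y)))
        + snd v * T2 (x, y))) (at (x, y) within UNIV \<times> UNIV)" by simp
    from has_derivative_slices(2)[OF this]
    have "((\<lambda>y. \<theta> (P (x, y))) has_real_derivative T2 (x, y)) (at y)" by simp
    from DERIV_chain2[OF G_deriv this] have "((\<lambda>y. G (\<theta> (P (x, y)))) has_real_derivative g (\<theta> (P (x, y))) * T2 (x, y)) (at y)"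
      using range[OF pS] by simp
    from DERIV_cmult[OF this]
    show "((\<lambda>y. X2 (x, y)) has_real_derivative
        s * \<phi> (fst (x, y)) * w (fst (x, y), 0) * (g (\<theta> (P (x, y))) * T2 (x, y))) (at y within {- \<Xi>..\<Xi>})"
      unfolding X2_def fst_conv by (rule has_field_derivative_at_within)
  next
    have PS: "P ` Q0 \<subseteq> S" using PQ0 OT_S by blast
    have "continuous_on Q0 T2" unfolding T2_def
      by (intro continuous_intros continuous_on_subset[OF P\<xi>_cont Q0_CR]
          continuous_on_compose2[OF cont_D1 cP PS] continuous_on_compose2[OF cont_D2 cP PS])
    moreover have "continuous_on Q0 (\<lambda>q. g (\<theta> (P q)))"
      by (intro continuous_on_compose2[OF g_cont[of UNIV]] continuous_on_compose2[OF cont_\<theta> cP PS]) auto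
    moreover have "continuous_on Q0 (\<lambda>q. w (fst q, 0))"
      by (rule continuous_on_compose2[OF w_cont])
         (use half_CR in \<open>auto intro!: continuous_intros simp: Q0\<close>)
    moreover have "continuous_on Q0 (\<lambda>q. \<phi> (fst q))"
      by (rule continuous_on_compose2[OF \<phi>_cont[of UNIV]]) (auto intro!: continuous_intros)
    ultimately have "continuous_on Q0 (\<lambda>q. s * \<phi> (fst q) * w (fst q, 0) * (g (\<theta> (P q)) * T2 q))"
      by (intro continuous_on_mult continuous_on_const)
    then show "continuous_on (cbox (c - h/2, - \<Xi>) (c + h/2, \<Xi>)) (\<lambda>q. s * \<phi> (fst q) * w (fst q, 0) * (g (\<theta> (P q)) * T2 q))"
      by (simp add: Q0_def)
  qed (use h \<Xi> in auto)
  also have "\<dots> = integral half (\<lambda>x. s * \<phi> x * w (x, 0) * (G (\<theta> (P (x, \<Xi>))) - G (\<theta> (P (x, - \<Xi>)))))"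
    by (simp add: half_def X2_def algebra_simps)
  finally have ik: "integral ?B k = \<dots>" .
  obtain e :: real where e: "\<bar>e\<bar> = 1" "\<And>r. r \<in> half \<Longrightarrow> G (\<theta> (P (r, \<Xi>))) - G (\<theta> (P (r, - \<Xi>))) = e"
  proof -
    have PS: "P (r, y) \<in> S" if "r \<in> half" for r y
      using P_O half_CI OT_S that by blast
    have hi: "G (\<theta> (P (r, y))) = 0" if "r \<in> half" "P1 (r, y) > X" for r y
      using X(2)[of "P1 (r, y)" "P2 (r, y)"] PS[OF that(1), of y] that(2) range[OF PS[OF that(1), of y]]
      by (intro G0) auto
    have lo: "G (\<theta> (P (r, y))) = 1" if "r \<in> half" "P1 (r, y) < - X" for r y
      using X(3)[of "P1 (r, y)" "P2 (r, y)"] PS[OF that(1), of y] that(2) range[OF PS[OF that(1), of y]]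
      by (intro G1) auto
    from opposite_ends[OF \<Xi>(1) less_imp_le[OF X(1)] \<Xi>(2)] show thesis
    proof
      assume "\<forall>\<rho>\<in>half. P1 (\<rho>, \<Xi>) > X \<and> P1 (\<rho>, - \<Xi>) < - X"
      then show thesis using hi lo by (intro that[of "-1"]) auto
    next
      assume "\<forall>\<rho>\<in>half. P1 (\<rho>, \<Xi>) < - X \<and> P1 (\<rho>, - \<Xi>) > X"
      then show thesis using hi lo by (intro that[of 1]) auto
    qed
  qed
  have w_low: "W / 2 \<le> \<bar>w (r, 0)\<bar>" if "r \<in> half" for r
  proof -
    have "(r, 0) \<in> CI" using half_CI that by blast
    then show ?thesis using W(2)[of "(r, 0)"] CI_CR by (auto simp: abs_w)
  qed
  have w_cont': "continuous_on half (\<lambda>r. w (r, 0))"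
    by (rule continuous_on_compose2[OF w_cont]) (use half_CR in \<open>auto intro!: continuous_intros\<close>)
  obtain z :: real where z: "\<bar>z\<bar> = 1" "\<And>r. r \<in> half \<Longrightarrow> w (r, 0) = z * \<bar>w (r, 0)\<bar>"
  proof -
    \<comment> \<open>The flux is bounded away from 0, so it has one sign on the connected interval
      and no cancellation occurs.\<close>
    have "(\<forall>r\<in>half. w (r, 0) > 0) \<or> (\<forall>r\<in>half. w (r, 0) < - 0)"
    proof (rule connected_abs_greater_imp_sign[OF _ w_cont'])
      show "0 < \<bar>w (r, 0)\<bar>" if "r \<in> half" for r using w_low[OF that] W(1) by linarith
    qed (auto simp: half_def)
    then show thesis
    proof
      assume w: "\<forall>r\<in>half. w (r, 0) > 0"
      show thesis by (rule that[of 1]) (simp_all only: abs_of_pos[OF w[rule_format]] abs_one mult_1)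
    next
      assume "\<forall>r\<in>half. w (r, 0) < - 0"
      then have w: "\<forall>r\<in>half. w (r, 0) < 0" by simp
      show thesis
        by (rule that[of "-1"]) (simp_all only: abs_of_neg[OF w[rule_format]] abs_minus_cancel abs_one mult_minus1 minus_minus)
    qed
  qed
  have "integral ?B k = integral half (\<lambda>r. s * e * z * (\<phi> r * \<bar>w (r, 0)\<bar>))"
    unfolding ik
  proof (rule integral_cong)
    fix r assume r: "r \<in> half"
    have "s * \<phi> r * w (r, 0) * e = s * \<phi> r * (z * \<bar>w (r, 0)\<bar>) * e"
      by (rule arg_cong[OF z(2)[OF r]])
    then show "s * \<phi> r * w (r, 0) * (G (\<theta> (P (r, \<Xi>))) - G (\<theta> (P (r, - \<Xi>)))) = s * e * z * (\<phi> r * \<bar>w (r, 0)\<bar>)"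
      unfolding e(2)[OF r] by (simp only: mult_ac)
  qed
  then have "\<bar>integral ?B k\<bar> = \<bar>integral half (\<lambda>r. \<phi> r * \<bar>w (r, 0)\<bar>)\<bar>"
    using s(1) e(1) z(1) by (simp add: abs_mult)
  moreover have "integral half (\<lambda>r. W / 2 * \<phi> r) \<le> integral half (\<lambda>r. \<phi> r * \<bar>w (r, 0)\<bar>)"
  proof (rule integral_le)
    show "(\<lambda>r. W / 2 * \<phi> r) integrable_on half" "(\<lambda>r. \<phi> r * \<bar>w (r, 0)\<bar>) integrable_on half"
      using w_cont' unfolding half_def
      by (auto intro!: integrable_continuous_real continuous_intros \<phi>_cont)
    show "W / 2 * \<phi> r \<le> \<phi> r * \<bar>w (r, 0)\<bar>" if "r \<in> half" for r
      using mult_left_mono[OF w_low[OF that] \<phi>_bounds(1)[of r]] by (simp add: mult.commute)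
  qed
  moreover have "W / 2 * (h / 4) \<le> integral half (\<lambda>r. W / 2 * \<phi> r)"
    using mult_left_mono[OF \<phi>_integral, of "W / 2"] W(1) by simp
  ultimately have "W * h / 8 \<le> \<bar>integral ?B k\<bar>" by simp
  then show thesis using that[of R] R supp inR by blast
qed

lemma tube_inequality:
  assumes W: "\<And>q. q \<in> CR \<Longrightarrow> W / 2 \<le> weighted_speed u D q"
  shows "ennreal (W * h) \<le> ennreal (8 * C2 * (1 + (\<kappa> / v0) / h)) * (\<integral>\<^sup>+ p. ennreal (n p) * indicator OT p \<partial>lborel)"
proof (cases "W > 0")
  case True
  obtain R where R: "R > 0" "\<And>p. \<Phi> p * g (\<theta> p) \<noteq> 0 \<Longrightarrow> \<bar>fst p\<bar> < R \<and> \<bar>snd p\<bar> < R"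
    "W * h / 8 \<le> \<bar>integral (cbox (- R, - R) (R, R)) k\<bar>" using integral_k_lower[OF True W] by blast
  have C: "0 \<le> C2 * (1 + (\<kappa> / v0) / h)" using K \<alpha>\<beta>(4) \<kappa> v0 h by (auto simp: C2_def)
  have "ennreal (W * h / 8) \<le> ennreal (C2 * (1 + (\<kappa> / v0) / h)) * (\<integral>\<^sup>+ p. ennreal (n p) * indicator OT p \<partial>lborel)"
    using order_trans[OF ennreal_leI[OF R(3)] integral_k_upper[OF R(1,2)]]
      nn_integral_cmult[OF n_indicator_measurable[OF open_O OT_S]] by simp
  from mult_left_mono[OF this, of "ennreal 8"]
  have "ennreal 8 * ennreal (W * h / 8) \<le> ennreal 8 * ennreal (C2 * (1 + (\<kappa> / v0) / h)) * (\<integral>\<^sup>+ p. ennreal (n p) * indicator OT p \<partial>lborel)"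
    by (simp add: mult.assoc)
  moreover have "ennreal 8 * ennreal (W * h / 8) = ennreal (W * h)"
    using True h by (subst ennreal_mult[symmetric]) auto
  moreover have "ennreal 8 * ennreal (C2 * (1 + (\<kappa> / v0) / h)) = ennreal (8 * C2 * (1 + (\<kappa> / v0) / h))"
    by (subst ennreal_mult[symmetric]) (use C in \<open>auto simp: mult.assoc\<close>)
  ultimately show ?thesis by simp
next
  \<comment> \<open>\<open>ennreal\<close> sends nonpositive numbers to 0.\<close>
  case False
  then have "W * h \<le> 0" using h by (simp add: mult_nonpos_nonneg)
  then show ?thesis by (simp add: ennreal_neg)
qed

end

section \<open>Summation over the tubes\<close>

lemma has_derivative_translate_iff:
  fixes g :: "'a::real_normed_vector \<Rightarrow> 'b::real_normed_vector"
  shows "((\<lambda>q. g (q + a)) has_derivative L) (at p) \<longleftrightarrow> (g has_derivative L) (at (p + a))"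
proof
  have tr: "((\<lambda>q. q + b) has_derivative (\<lambda>v. v)) (at q)" for b q :: 'a
    by (auto intro!: derivative_eq_intros)
  show "((\<lambda>q. g (q + a)) has_derivative L) (at p)" if "(g has_derivative L) (at (p + a))"
    using has_derivative_compose[OF tr that] .
  show "(g has_derivative L) (at (p + a))" if h: "((\<lambda>q. g (q + a)) has_derivative L) (at p)"
  proof -
    have "((\<lambda>q. g (q + a)) has_derivative L) (at (p + a + - a))" using h by simp
    from has_derivative_compose[OF tr this] show ?thesis by simp
  qed
qed

text \<open>The two points have the same set of derivatives, so \<open>frechet_derivative\<close>
  makes the same choice at both, differentiable or not.\<close>

lemma periodic_partials:
  assumes "\<And>x y. g (x, y + H) = g (x, y)"
  shows "d1 UNIV g (x, y + H) = d1 UNIV g (x, y)" "d2 UNIV g (x, y + H) = d2 UNIV g (x, y)"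
proof -
  have "(\<lambda>q. g (q + (0, H))) = g" using assms by (auto simp: fun_eq_iff)
  then have "(g has_derivative L) (at (x, y + H)) \<longleftrightarrow> (g has_derivative L) (at (x, y))" for L
    using has_derivative_translate_iff[of g "(0, H)" L "(x, y)"] by simp
  then show "d1 UNIV g (x, y + H) = d1 UNIV g (x, y)" "d2 UNIV g (x, y + H) = d2 UNIV g (x, y)"
    by (simp_all add: d1_def d2_def frechet_derivative_def)
qed

lemma sum_suminf_indicator_le_1:
  fixes P :: "'i \<Rightarrow> nat \<Rightarrow> bool"
  assumes I: "finite I"
    and uniq: "\<And>i j m n. i \<in> I \<Longrightarrow> j \<in> I \<Longrightarrow> P i m \<Longrightarrow> P j n \<Longrightarrow> i = j \<and> m = n"
  shows "(\<Sum>i\<in>I. \<Sum>m. of_bool (P i m) :: ennreal) \<le> 1"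
proof (cases "\<exists>i\<in>I. \<exists>m. P i m")
  case True
  then obtain i m where im: "i \<in> I" "P i m" by blast
  have "(\<Sum>m. of_bool (P j m) :: ennreal) = (if j = i then 1 else 0)" if "j \<in> I" for j
  proof -
    have P: "P j k \<longleftrightarrow> j = i \<and> k = m" for k using uniq[OF that im(1) _ im(2)] im(2) by blast
    have "(\<Sum>k. of_bool (P j k) :: ennreal) = (\<Sum>k\<in>{m}. of_bool (P j k))"
      by (rule suminf_finite) (auto simp: P)
    then show ?thesis by (simp add: P)
  qed
  then have "(\<Sum>j\<in>I. \<Sum>m. of_bool (P j m) :: ennreal) = (\<Sum>j\<in>I. if j = i then 1 else 0)" by simp
  then show ?thesis using I im(1) by simp
next
  case False
  then have "(\<Sum>i\<in>I. \<Sum>m. of_bool (P i m) :: ennreal) = 0" by (intro sum.neutral) auto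
  then show ?thesis by simp
qed

lemma nn_integral_translate:
  fixes f :: "real \<times> real \<Rightarrow> ennreal"
  assumes "f \<in> borel_measurable borel"
  shows "(\<integral>\<^sup>+ p. f p \<partial>lborel) = (\<integral>\<^sup>+ p. f (a + p) \<partial>lborel)"
proof -
  have "(\<integral>\<^sup>+ p. f p \<partial>lborel) = (\<integral>\<^sup>+ p. f p \<partial>(distr lborel borel ((+) a)))"
    by (simp add: lborel_distr_plus)
  also have "\<dots> = (\<integral>\<^sup>+ p. f (a + p) \<partial>lborel)" by (rule nn_integral_distr) (use assms in auto)
  finally show ?thesis .
qed

text \<open>Cut each \<open>A i\<close> along the period cells and translate the pieces into one
  cell. Disjointness modulo the period says that no point of the cell is covered twice, neither by
  two pieces of one set nor by pieces of two sets.\<close>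

lemma sum_nn_integral_periodic_le:
  fixes n :: "real \<times> real \<Rightarrow> ennreal" and A :: "'i \<Rightarrow> (real \<times> real) set"
  assumes H: "H > 0" and I: "finite I" and n: "n \<in> borel_measurable borel"
    and per: "\<And>x y. n (x, y + H) = n (x, y)"
    and A: "\<And>i. i \<in> I \<Longrightarrow> A i \<in> sets borel"
    and disj: "\<And>i j k. i \<in> I \<Longrightarrow> j \<in> I \<Longrightarrow> i \<noteq> j \<or> k \<noteq> 0 \<Longrightarrow>
      A i \<inter> (\<lambda>(x, y). (x, y + of_int k * H)) ` A j = {}"
  shows "(\<Sum>i\<in>I. \<integral>\<^sup>+ p. n p * indicator (A i) p \<partial>lborel) \<le> (\<integral>\<^sup>+ p. n p * indicator (strip H) p \<partial>lborel)"
proof -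
  \<comment> \<open>Half open, so that its translates cover every point exactly once;
    \<open>e\<close> enumerates the integer shifts by natural numbers, as the series
    require.\<close>
  define B where "B = (UNIV :: real set) \<times> {0..<H}"
  have B: "B \<in> sets borel" unfolding B_def by (intro borel_Times) auto
  define e where "e m = (0 :: real, of_int (int_decode m) * H)" for m
  have one: "(\<Sum>m. indicator B (p - e m) :: ennreal) = 1" for p
  proof -
    obtain x y where p: "p = (x, y)" by (metis surj_pair)
    have iff: "p - e m \<in> B \<longleftrightarrow> m = int_encode \<lfloor>y / H\<rfloor>" for m
    proof -
      have "p - e m \<in> B \<longleftrightarrow> of_int (int_decode m) \<le> y / H \<and> y / H < of_int (int_decode m) + 1"
        using H by (auto simp: p e_def B_def pos_le_divide_eq pos_divide_less_eq algebra_simps)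
      also have "\<dots> \<longleftrightarrow> \<lfloor>y / H\<rfloor> = int_decode m" by (simp add: floor_eq_iff)
      finally show ?thesis by (metis int_decode_inverse int_encode_inverse)
    qed
    have "(\<Sum>m. indicator B (p - e m) :: ennreal) = (\<Sum>m\<in>{int_encode \<lfloor>y / H\<rfloor>}. indicator B (p - e m))"
      by (rule suminf_finite) (use iff in \<open>auto simp: indicator_def\<close>)
    then show ?thesis using iff by (simp add: indicator_def)
  qed
  have meas: "(\<lambda>p. n p * indicator (A i) p * indicator B (p - e m)) \<in> borel_measurable borel" if "i \<in> I" for i m
  proof -
    have "(\<lambda>p. p - e m) \<in> borel_measurable borel" by measurable
    then have "(\<lambda>p. indicator B (p - e m) :: ennreal) \<in> borel_measurable borel"
      using B by (rule measurable_compose[OF _ borel_measurable_indicator])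
    then show ?thesis using n A[OF that] by measurable
  qed
  have nper: "n (e m + p) = n p" for m p
    using periodic_int_shift[of n H "fst p" "snd p" "int_decode m"] per
    by (cases p) (simp add: e_def add.commute)
  have cellsum: "(\<integral>\<^sup>+ p. n p * indicator (A i) p \<partial>lborel)
      = (\<Sum>m. \<integral>\<^sup>+ p. n p * indicator B p * indicator (A i) (e m + p) \<partial>lborel)" if i: "i \<in> I" for i
  proof -
    have "(\<integral>\<^sup>+ p. n p * indicator (A i) p \<partial>lborel)
      = (\<integral>\<^sup>+ p. (\<Sum>m. n p * indicator (A i) p * indicator B (p - e m)) \<partial>lborel)"
      by (simp add: one)
    also have "\<dots> = (\<Sum>m. \<integral>\<^sup>+ p. n p * indicator (A i) p * indicator B (p - e m) \<partial>lborel)"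
      by (rule nn_integral_suminf) (use meas[OF i] in simp)
    also have "\<dots> = (\<Sum>m. \<integral>\<^sup>+ p. n (e m + p) * indicator (A i) (e m + p) * indicator B (e m + p - e m) \<partial>lborel)"
      by (intro suminf_cong nn_integral_translate meas i)
    finally show ?thesis by (simp add: nper mult_ac)
  qed
  have meas2: "(\<lambda>p. n p * indicator B p * indicator (A i) (e m + p)) \<in> borel_measurable lborel"
    if "i \<in> I" for i m
  proof -
    have "(\<lambda>p. e m + p) \<in> borel_measurable borel" by measurable
    then have "(\<lambda>p. indicator (A i) (e m + p) :: ennreal) \<in> borel_measurable borel"
      using A[OF that] by (rule measurable_compose[OF _ borel_measurable_indicator])
    then have "(\<lambda>p. n p * indicator B p * indicator (A i) (e m + p)) \<in> borel_measurable borel"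
      using n B by measurable
    then show ?thesis by simp
  qed
  have "(\<Sum>i\<in>I. \<integral>\<^sup>+ p. n p * indicator (A i) p \<partial>lborel)
      = (\<Sum>i\<in>I. \<integral>\<^sup>+ p. (\<Sum>m. n p * indicator B p * indicator (A i) (e m + p)) \<partial>lborel)"
    by (intro sum.cong refl) (simp only: cellsum nn_integral_suminf[OF meas2])
  also have "\<dots> = (\<integral>\<^sup>+ p. (\<Sum>i\<in>I. \<Sum>m. n p * indicator B p * indicator (A i) (e m + p)) \<partial>lborel)"
    by (rule nn_integral_sum[symmetric]) (intro borel_measurable_suminf_order meas2)
  also have "\<dots> \<le> (\<integral>\<^sup>+ p. n p * indicator (strip H) p \<partial>lborel)"
  proof (rule nn_integral_mono)
    fix p
    have "(\<Sum>i\<in>I. \<Sum>m. indicator (A i) (e m + p) :: ennreal) \<le> 1"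
      unfolding indicator_def
    proof (rule sum_suminf_indicator_le_1[OF I])
      fix i j m l assume ij: "i \<in> I" "j \<in> I" "e m + p \<in> A i" "e l + p \<in> A j"
      define k where "k = int_decode m - int_decode l"
      have "e m + p = (\<lambda>(x, y). (x, y + of_int k * H)) (e l + p)"
        by (cases p) (simp add: e_def k_def algebra_simps)
      then have "e m + p \<in> A i \<inter> (\<lambda>(x, y). (x, y + of_int k * H)) ` A j" using ij by blast
      then have "i = j \<and> k = 0" using disj[OF ij(1,2), of k] by blast
      then show "i = j \<and> m = l" by (auto simp: k_def) (metis int_decode_inverse)
    qed
    then have "n p * indicator B p * (\<Sum>i\<in>I. \<Sum>m. indicator (A i) (e m + p) :: ennreal)
        \<le> n p * indicator B p * 1" by (rule mult_left_mono) simp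
    moreover have "n p * indicator B p * 1 \<le> n p * indicator (strip H) p"
      by (auto simp: indicator_def B_def strip_def)
    ultimately show "(\<Sum>i\<in>I. \<Sum>m. n p * indicator B p * indicator (A i) (e m + p)) \<le> n p * indicator (strip H) p"
      unfolding sum_distrib_left ennreal_suminf_cmult by (rule order_trans)
  qed
  finally show ?thesis .
qed

context front begin

lemma n_periodic:
  assumes "bc = Periodic" shows "n (x, y + H) = n (x, y)"
proof -
  have t: "\<theta> (x, y + H) = \<theta> (x, y)" and u: "u (x, y + H) = u (x, y)" for x y
    using \<theta>_bc u_bc assms by auto
  note p = periodic_partials[of \<theta> H, OF t]
  note p1 = periodic_partials[of "d1 UNIV \<theta>" H, OF p(1)] and p2 = periodic_partials[of "d2 UNIV \<theta>" H, OF p(2)]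
  show ?thesis unfolding n_def \<tau>_def F_def E_def using assms by (simp add: t u p p1 p2)
qed

lemma sum_tubes_le:
  assumes I: "finite I" and A: "\<And>i. i \<in> I \<Longrightarrow> open (A i)" "\<And>i. i \<in> I \<Longrightarrow> A i \<subseteq> S"
    and disj: "\<And>i j k. i \<in> I \<Longrightarrow> j \<in> I \<Longrightarrow> k \<in> lattice_shifts bc \<Longrightarrow> i \<noteq> j \<or> k \<noteq> 0 \<Longrightarrow>
      A i \<inter> (\<lambda>(x, y). (x, y + of_int k * H)) ` A j = {}"
  shows "(\<Sum>i\<in>I. \<integral>\<^sup>+ p. ennreal (n p) * indicator (A i) p \<partial>lborel) \<le> ennreal (5 * Q)"
proof -
  have "(\<Sum>i\<in>I. \<integral>\<^sup>+ p. ennreal (n p) * indicator (A i) p \<partial>lborel)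
      \<le> (\<integral>\<^sup>+ p. ennreal (n p) * indicator (strip H) p \<partial>lborel)"
  proof (cases bc)
    case Periodic
    have "n \<in> borel_measurable borel"
      using cont_n Periodic by (auto intro: borel_measurable_continuous_onI)
    then show ?thesis
      by (intro sum_nn_integral_periodic_le[OF H I])
         (use A disj n_periodic Periodic in auto)
  next
    case Neumann
    have dj: "i = j" if "i \<in> I" "j \<in> I" "p \<in> A i" "p \<in> A j" for i j p
    proof (rule ccontr)
      assume "i \<noteq> j"
      then have "A i \<inter> (\<lambda>(x, y). (x, y + of_int 0 * H)) ` A j = {}"
        using disj[OF that(1,2), of 0] Neumann by simp
      then show False using that by (auto simp: case_prod_unfold)
    qed
    have "(\<Sum>i\<in>I. \<integral>\<^sup>+ p. ennreal (n p) * indicator (A i) p \<partial>lborel)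
        = (\<integral>\<^sup>+ p. (\<Sum>i\<in>I. ennreal (n p) * indicator (A i) p) \<partial>lborel)"
      by (rule nn_integral_sum[symmetric]) (rule n_indicator_measurable[OF A])
    also have "\<dots> \<le> (\<integral>\<^sup>+ p. ennreal (n p) * indicator (strip H) p \<partial>lborel)"
    proof (rule nn_integral_mono)
      fix p
      show "(\<Sum>i\<in>I. ennreal (n p) * indicator (A i) p) \<le> ennreal (n p) * indicator (strip H) p"
      proof (cases "\<exists>i\<in>I. p \<in> A i")
        case True
        then obtain i where i: "i \<in> I" "p \<in> A i" by blast
        have "(\<Sum>j\<in>I. ennreal (n p) * indicator (A j) p) = (\<Sum>j\<in>I. if j = i then ennreal (n p) else 0)"
        proof (rule sum.cong[OF refl])
          fix j assume "j \<in> I"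
          then have "p \<in> A j \<longleftrightarrow> j = i" using dj[OF _ i(1) _ i(2)] i(2) by blast
          then show "ennreal (n p) * indicator (A j) p = (if j = i then ennreal (n p) else 0)"
            by (simp add: indicator_def)
        qed
        moreover have "p \<in> strip H" using A(2)[OF i(1)] i(2) Neumann by auto
        ultimately show ?thesis using I i(1) by simp
      qed (simp add: indicator_def)
    qed
    finally show ?thesis .
  qed
  also have "\<dots> \<le> ennreal (5 * Q)" by (rule nn_integral_n_strip)
  finally show ?thesis .
qed

text \<open>The burning rate is a Lebesgue integral and \<open>Q\<close> a gauge integral; they
  agree because a nonnegative gauge-integrable function is absolutely integrable.\<close>

lemma Q_lebesgue: "(LINT p:strip H|lborel. \<tau> p) = Q"
proof -
  have sub: "strip H \<subseteq> S" by (rule strip_subset_domain)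
  have cs: "closed (strip H)" using closed_domain[of Neumann H] by simp
  have "\<tau> absolutely_integrable_on strip H"
    by (rule nonnegative_absolutely_integrable_1[OF \<tau>_integrable]) (use \<tau>_nonneg sub in blast)
  moreover have "(\<lambda>p. indicator (strip H) p *\<^sub>R \<tau> p) \<in> borel_measurable borel"
    by (rule borel_measurable_continuous_on_indicator[OF _ continuous_on_subset[OF cont_\<tau> sub]])
       (use cs in auto)
  ultimately have "set_integrable lborel (strip H) \<tau>"
    unfolding set_integrable_def by (simp add: integrable_completion)
  then show ?thesis unfolding Q_def by (rule set_borel_integral_eq_integral(2))
qed

end

text \<open>The quadratic Taylor minorant of \<open>exp (a * x)\<close> already dominates a multiple
  of \<open>1 + x\<^sup>2\<close>.\<close>

lemma exp_le_inverse_one_plus_square: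
  fixes a x :: real
  assumes a: "a > 0" and x: "x \<ge> 0"
  shows "exp (- a * x) \<le> 1 / min 1 (a\<^sup>2 / 2) / (1 + x\<^sup>2)"
proof -
  define m where "m = min 1 (a\<^sup>2 / 2)"
  have m: "0 < m" "m \<le> 1" "m \<le> a\<^sup>2 / 2" using a by (auto simp: m_def)
  have "m * (1 + x\<^sup>2) = m + m * x\<^sup>2" by (simp add: algebra_simps)
  also have "\<dots> \<le> 1 + a\<^sup>2 / 2 * x\<^sup>2" using m by (intro add_mono mult_right_mono) auto
  also have "\<dots> \<le> 1 + a * x + (a * x)\<^sup>2 / 2" using a x by (simp add: power_mult_distrib)
  also have "\<dots> \<le> exp (a * x)" using a x by (intro exp_lower_Taylor_quadratic) simp
  finally have le: "m * (1 + x\<^sup>2) \<le> exp (a * x)" .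
  have pos: "1 + x\<^sup>2 > 0" by (metis add_pos_nonneg zero_le_power2 zero_less_one)
  have "exp (- a * x) = 1 / exp (a * x)" by (simp add: exp_minus inverse_eq_divide)
  also have "\<dots> \<le> 1 / (m * (1 + x\<^sup>2))" using le m pos by (intro divide_left_mono) auto
  finally show ?thesis by (simp add: m_def)
qed

text \<open>Freezing time weakens exponential decay to the algebraic weight, and the sign of the
  time derivative becomes a differential inequality for the profile.\<close>

lemma (in combustion) front_exists:
  assumes t: "t > 0" and u_C1: "C1_on (domain bc H) u"
    and div_free: "\<And>p. p \<in> domain bc H \<Longrightarrow> divergence (domain bc H) u p = 0"
    and mean_zero: "\<And>x. integral {0..H} (\<lambda>y. fst (u (x, y))) = 0" and u_bc: "flow_bc bc H u"
  obtains M where "front bc \<kappa> v0 H U M f u (T t)"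
proof -
  obtain a M where aM: "a > 0" "M \<ge> 0" "\<And>p. p \<in> S \<Longrightarrow> T t p \<le> M * exp (- a * fst p)"
    "\<And>p. p \<in> S \<Longrightarrow> 1 - T t p \<le> M * exp (a * fst p)" using exponential_decay[OF t] by metis
  define M' where "M' = M * (1 / min 1 (a\<^sup>2 / 2))"
  have bnd: "M * exp (- a * x) \<le> M' / (1 + x\<^sup>2)" if "x \<ge> 0" for x
    using mult_left_mono[OF exp_le_inverse_one_plus_square[OF aM(1) that] aM(2)] by (simp add: M'_def)
  have "front bc \<kappa> v0 H U M' f u (T t)"
  proof (unfold_locales)
    show "T t (x, y) \<le> M' / (1 + x\<^sup>2)" if "(x, y) \<in> domain bc H" "0 \<le> x" for x y
      using aM(3)[OF that(1)] bnd[OF that(2)] by simp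
    show "1 - T t (x, y) \<le> M' / (1 + x\<^sup>2)" if "(x, y) \<in> domain bc H" "x \<le> 0" for x y
      using aM(4)[OF that(1)] bnd[of "- x"] that(2) by simp
    show "u p \<bullet> grad (domain bc H) (T t) p \<le> \<kappa> * laplacian (domain bc H) (T t) p + v0\<^sup>2 / \<kappa> * f (T t p)"
      if "p \<in> domain bc H" for p
      using T_pde[OF t that] time_derivative_nonneg[OF t that]
      by (simp add: grad_def inner_prod_def laplacian_def algebra_simps)
  qed (use \<kappa> v0 H f u_C1 div_free mean_zero u_bc U T_C2[OF t] T_range[of t] T_bc[of t] t in auto)
  then show thesis by (rule that)
qed

theorem theorem4:
  fixes f :: "real \<Rightarrow> real" and K :: real
  assumes "reaction_term f" and "K > 0"
  shows "\<exists>C>0. \<forall>bc \<kappa> v0 H u N D T0 T.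
    \<kappa> > 0 \<longrightarrow> v0 > 0 \<longrightarrow> H > 0 \<longrightarrow>
    percolating_flow bc H K u N D \<longrightarrow>
    initial_temperature bc H \<kappa> v0 f u T0 \<longrightarrow>
    temperature bc H \<kappa> v0 f u T0 T \<longrightarrow>
    (\<forall>t>0. \<forall>\<xi> :: nat \<times> flow_dir \<Rightarrow> real.
      bulk_burning_rate H T t \<ge>
        C * (v0 + (\<Sum>i\<in>tube_index N.
          inverse (1 + (\<kappa> / v0) / hwidth (D i)) *
          integral (rho_range (D i)) (\<lambda>\<rho>. norm (u (param (D i) (\<rho>, \<xi> i))) * E1 (D i) (\<rho>, \<xi> i) / H))))"
proof -
  obtain \<alpha> \<beta> c and g g' G :: "real \<Rightarrow> real" where cut: "0 < \<alpha>" "\<alpha> < \<beta>" "\<beta> < 1" "c > 0"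
    "\<And>s. s \<in> {0..1} \<Longrightarrow> (G has_real_derivative g s) (at s)"
    "\<And>s. (g has_real_derivative g' s) (at s)" "continuous_on UNIV g'"
    "\<And>s. s \<in> {0..\<alpha>} \<Longrightarrow> G s = 0" "\<And>s. s \<in> {\<beta>..1} \<Longrightarrow> G s = 1"
    "\<And>s. 0 \<le> g s" "\<And>s. s \<notin> {\<alpha>..\<beta>} \<Longrightarrow> g s = 0" "\<And>s. s \<in> {0..1} \<Longrightarrow> (g s)\<^sup>2 \<le> c * f s"
    "\<And>s. s \<in> {0..1} \<Longrightarrow> g s \<le> c" "\<And>s. s \<in> {0..1} \<Longrightarrow> \<bar>g' s\<bar> \<le> c"
    by (rule reaction_cutoff[OF assms(1)]; rule that; assumption)
  define C2 where "C2 = (4 * K + 1) * (c + 1)"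
  have C2: "C2 > 0" using assms(2) cut(4) by (simp add: C2_def)
  \<comment> \<open>\<open>c + 1\<close> comes from the speed bound; 80 is the product of 8 from a
    single tube, 5 from the total of \<open>n\<close> and 2 from the full width of the
    \<rho>-range.\<close>
  define C where "C = 1 / (c + 1 + 80 * C2)"
  have C: "C > 0" using C2 cut(4) by (simp add: C_def)
  have main: "C * (v0 + (\<Sum>i\<in>tube_index N. inverse (1 + (\<kappa> / v0) / hwidth (D i)) *
          integral (rho_range (D i)) (\<lambda>\<rho>. norm (u (param (D i) (\<rho>, \<xi> i))) * E1 (D i) (\<rho>, \<xi> i) / H)))
      \<le> bulk_burning_rate H T t"
    if \<kappa>: "\<kappa> > 0" and v0: "v0 > 0" and H: "H > 0" and flow: "percolating_flow bc H K u N D"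
      and T0: "initial_temperature bc H \<kappa> v0 f u T0" and T: "temperature bc H \<kappa> v0 f u T0 T" and t: "t > 0"
    for bc \<kappa> v0 H u N D T0 T t and \<xi> :: "nat \<times> flow_dir \<Rightarrow> real"
  proof -
    let ?S = "domain bc H"
    obtain L where uf: "C1_on ?S u" "\<And>p. p \<in> ?S \<Longrightarrow> divergence ?S u p = 0"
      "\<And>x. integral {0..H} (\<lambda>y. fst (u (x, y))) = 0" "flow_bc bc H u" "L > 0"
      "\<And>x y. (x, y) \<in> ?S \<Longrightarrow> u (x + L, y) = u (x, y)"
      using flow unfolding percolating_flow_def by blast
    have disj: "disjoint_tubes bc H N D"
      using flow unfolding percolating_flow_def by blast
    have tubes: "stream_coords ?S u (D i)" "metric_bounds K (D i)" "speed_bounds u (D i)" if "i \<in> tube_index N" for i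
      using flow that unfolding percolating_flow_def by (auto simp: case_prod_unfold)
    obtain U where U: "\<And>p. p \<in> ?S \<Longrightarrow> norm (u p) \<le> U"
      using flow_bounded[OF H uf(1,5,6,4)] by metis
    interpret comb: combustion bc \<kappa> v0 H U f u T0 T
      by unfold_locales (use \<kappa> v0 H assms(1) U T0 T in auto)
    obtain M where "front bc \<kappa> v0 H U M f u (T t)"
      by (rule comb.front_exists[OF t uf(1-4)])
    then interpret fr: front bc \<kappa> v0 H U M f u "T t" .
    have V: "bulk_burning_rate H T t = fr.Q / H"
    proof -
      have "deriv (\<lambda>s. T s p) t = fr.\<tau> p" if "p \<in> strip H" for p
        using comb.T_pde[OF t, of p] that strip_subset_domain[of H bc]
        by (auto simp: fr.\<tau>_def fr.F_def algebra_simps)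
      then have "bulk_burning_rate H T t = (LINT p:strip H|lborel. fr.\<tau> p / H)"
        unfolding bulk_burning_rate_def set_lebesgue_integral_def
        by (intro Bochner_Integration.integral_cong) (auto simp: indicator_def)
      also have "\<dots> = fr.Q / H"
        using fr.Q_lebesgue by simp
      finally show ?thesis .
    qed
    have speed: "v0 * H \<le> (c + 1) * fr.Q"
    proof (rule fr.speed_lower_bound[OF cut(1-5)])
      show "continuous_on {0..1} g" using cut(6) by (meson DERIV_isCont continuous_at_imp_continuous_on)
    qed (use cut in auto)
    define W where "W i = (SUP q\<in>coord_range (D i). weighted_speed u (D i) q)" for i
    define a where "a i = 1 + (\<kappa> / v0) / hwidth (D i)" for i
    define I where "I i = (\<integral>\<^sup>+ p. ennreal (fr.n p) * indicator (open_tube (D i)) p \<partial>lborel)" for i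
    have dj: "open_tube (D i) \<inter> (\<lambda>(x, y). (x, y + of_int k * H)) ` open_tube (D j) = {}"
      if "i \<in> tube_index N" "j \<in> tube_index N" "k \<in> lattice_shifts bc" "i \<noteq> j \<or> k \<noteq> 0" for i j k
      using disj that unfolding disjoint_tubes_def by blast
    have st: "stream_tube bc H K u (D i)" if i: "i \<in> tube_index N" for i
      by unfold_locales (use H assms(2) uf tubes[OF i] dj[OF i i] in auto)
    have hw: "hwidth (D i) > 0" if "i \<in> tube_index N" for i
      using tubes(1)[OF that] by (simp add: stream_coords_def)
    have a1: "a i \<ge> 1" if "i \<in> tube_index N" for i
      using hw[OF that] \<kappa> v0 by (simp add: a_def)
    have W: "W i / 2 \<le> weighted_speed u (D i) q" "weighted_speed u (D i) q \<le> W i"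
      if "i \<in> tube_index N" "q \<in> coord_range (D i)" for i q
      using tubes(3)[OF that(1)] that(2) by (auto simp: speed_bounds_def W_def)
    have W0: "W i \<ge> 0" if i: "i \<in> tube_index N" for i
    proof -
      have "(centre (D i), 0) \<in> coord_range (D i)" using hw[OF i] by (simp add: coord_range_def rho_range_def)
      from W[OF i this] show ?thesis by linarith
    qed
    have tube: "ennreal (W i * hwidth (D i)) \<le> ennreal (8 * C2 * a i) * I i" if i: "i \<in> tube_index N" for i
    proof -
      interpret stream_tube bc H K u "D i" by (rule st[OF i])
      interpret ft: front_tube bc \<kappa> v0 H U M K f u "T t" "D i" \<alpha> \<beta> c g g' G
        by unfold_locales (use cut in auto)
      show ?thesis using ft.tube_inequality[of "W i"] W(1)[OF i]
        by (simp add: ft.C2_def C2_def a_def I_def)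
    qed
    have sumJ: "(\<Sum>i\<in>tube_index N. I i) \<le> ennreal (5 * fr.Q)"
      unfolding I_def
    proof (rule fr.sum_tubes_le)
      show "finite (tube_index N)" by (simp add: tube_index_def)
      show "open (open_tube (D i))" "open_tube (D i) \<subseteq> ?S" if "i \<in> tube_index N" for i
        using stream_tube.open_O[OF st[OF that]] stream_tube.O_region[OF st[OF that]]
          stream_tube.region_subset[OF st[OF that]] by auto
    qed (rule dj)
    have "ennreal (\<Sum>i\<in>tube_index N. W i * hwidth (D i) / a i) = (\<Sum>i\<in>tube_index N. ennreal (W i * hwidth (D i) / a i))"
      by (rule sum_ennreal[symmetric]) (use W0 hw a1 in \<open>force intro!: divide_nonneg_nonneg mult_nonneg_nonneg\<close>)
    also have "\<dots> \<le> (\<Sum>i\<in>tube_index N. ennreal (8 * C2) * I i)"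
    proof (rule sum_mono)
      fix i assume i: "i \<in> tube_index N"
      have pos: "a i > 0" using a1[OF i] by simp
      \<comment> \<open>Division by \<open>a i\<close> leaves a constant common to all tubes, so
        that the integrals over disjoint tubes can be added.\<close>
      have "ennreal (1 / a i) * ennreal (W i * hwidth (D i)) \<le> ennreal (1 / a i) * (ennreal (8 * C2 * a i) * I i)"
        by (rule mult_left_mono[OF tube[OF i]]) simp
      moreover have "ennreal (1 / a i) * ennreal (W i * hwidth (D i)) = ennreal (W i * hwidth (D i) / a i)"
        by (subst ennreal_mult[symmetric]) (use pos W0[OF i] hw[OF i] in auto)
      moreover have "ennreal (1 / a i) * ennreal (8 * C2 * a i) = ennreal (8 * C2)"
        by (subst ennreal_mult[symmetric]) (use pos C2 in auto)
      ultimately show "ennreal (W i * hwidth (D i) / a i) \<le> ennreal (8 * C2) * I i"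
        by (simp add: mult.assoc[symmetric])
    qed
    also have "\<dots> = ennreal (8 * C2) * (\<Sum>i\<in>tube_index N. I i)" by (simp add: sum_distrib_left)
    also have "\<dots> \<le> ennreal (8 * C2) * ennreal (5 * fr.Q)" by (rule mult_left_mono[OF sumJ]) simp
    also have "\<dots> = ennreal (8 * C2 * (5 * fr.Q))"
      by (rule ennreal_mult[symmetric]) (use C2 fr.Q_nonneg in auto)
    finally have sumW: "(\<Sum>i\<in>tube_index N. W i * hwidth (D i) / a i) \<le> 40 * C2 * fr.Q"
      using C2 fr.Q_nonneg by (subst (asm) ennreal_le_iff) auto
    \<comment> \<open>The flux over the full width is bounded by the maximal speed
      \<open>W i\<close>, whereas the tube estimate relied on the lower bound
      \<open>W i / 2\<close>; here the comparability of speeds across a tube pays off. A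
      nonintegrable integrand has integral 0 by convention and satisfies the bound as well.\<close>
    have int: "integral (rho_range (D i)) (\<lambda>\<rho>. norm (u (param (D i) (\<rho>, \<xi> i))) * E1 (D i) (\<rho>, \<xi> i) / H)
        \<le> 2 * (W i * hwidth (D i)) / H" if i: "i \<in> tube_index N" for i
    proof (cases "(\<lambda>\<rho>. norm (u (param (D i) (\<rho>, \<xi> i))) * E1 (D i) (\<rho>, \<xi> i) / H) integrable_on rho_range (D i)")
      case True
      have "integral (rho_range (D i)) (\<lambda>\<rho>. norm (u (param (D i) (\<rho>, \<xi> i))) * E1 (D i) (\<rho>, \<xi> i) / H)
          \<le> integral (rho_range (D i)) (\<lambda>\<rho>. W i / H)"
      proof (rule integral_le[OF True])
        show "(\<lambda>\<rho>. W i / H) integrable_on rho_range (D i)"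
          unfolding rho_range_def by (intro integrable_continuous_real continuous_on_const)
        show "norm (u (param (D i) (\<rho>, \<xi> i))) * E1 (D i) (\<rho>, \<xi> i) / H \<le> W i / H" if "\<rho> \<in> rho_range (D i)" for \<rho>
          using W(2)[OF i, of "(\<rho>, \<xi> i)"] that H
          by (intro divide_right_mono) (auto simp: weighted_speed_def coord_range_def)
      qed
      also have "\<dots> = 2 * (W i * hwidth (D i)) / H" using hw[OF i] by (simp add: rho_range_def)
      finally show ?thesis .
    next
      case False
      then show ?thesis using W0[OF i] hw[OF i] H by (simp add: not_integrable_integral)
    qed
    have "(\<Sum>i\<in>tube_index N. inverse (a i) *
          integral (rho_range (D i)) (\<lambda>\<rho>. norm (u (param (D i) (\<rho>, \<xi> i))) * E1 (D i) (\<rho>, \<xi> i) / H))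
        \<le> (\<Sum>i\<in>tube_index N. inverse (a i) * (2 * (W i * hwidth (D i)) / H))"
      by (intro sum_mono mult_left_mono int) (use a1 in force)+
    also have "\<dots> = 2 / H * (\<Sum>i\<in>tube_index N. W i * hwidth (D i) / a i)"
      by (simp add: sum_distrib_left field_simps)
    also have "\<dots> \<le> 2 / H * (40 * C2 * fr.Q)" using sumW H by (intro mult_left_mono) auto
    finally have tubes_sum: "(\<Sum>i\<in>tube_index N. inverse (a i) *
          integral (rho_range (D i)) (\<lambda>\<rho>. norm (u (param (D i) (\<rho>, \<xi> i))) * E1 (D i) (\<rho>, \<xi> i) / H))
        \<le> 80 * C2 * (fr.Q / H)" by simp
    have "v0 \<le> (c + 1) * (fr.Q / H)" using speed H by (simp add: field_simps)
    with tubes_sum have "v0 + (\<Sum>i\<in>tube_index N. inverse (a i) *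
          integral (rho_range (D i)) (\<lambda>\<rho>. norm (u (param (D i) (\<rho>, \<xi> i))) * E1 (D i) (\<rho>, \<xi> i) / H))
        \<le> (c + 1) * (fr.Q / H) + 80 * C2 * (fr.Q / H)" by (rule add_mono[rotated])
    also have "\<dots> = (c + 1 + 80 * C2) * (fr.Q / H)" by (simp only: distrib_right)
    finally have "v0 + (\<Sum>i\<in>tube_index N. inverse (a i) *
          integral (rho_range (D i)) (\<lambda>\<rho>. norm (u (param (D i) (\<rho>, \<xi> i))) * E1 (D i) (\<rho>, \<xi> i) / H))
        \<le> (c + 1 + 80 * C2) * (fr.Q / H)" .
    from mult_left_mono[OF this less_imp_le[OF C]] show ?thesis
      unfolding V a_def using C2 cut(4) by (simp add: C_def)
  qed
  show ?thesis using C main by blast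
qed

end
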